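(* Let $n\ge1$, $a\in\mathbb C$ and $\nu\in\mathbb C^{n+1}$ with $\nu\notin\mathbb Z^{n+1}$ and $a-|\nu|\in\mathbb Z$, where $|\nu|=\sum_{i=0}^n\nu_i$. Then the categories ${}_{\rm s}(\mathcal D,\mathcal H)_{\nu}$-mod and ${}_{\rm s}(\mathcal D^E,\mathcal H)^a_{\nu}$-mod are equivalent.
   Context: Ground field $\mathbb C$. $\mathcal D=\mathcal D(n+1)$ is the Weyl algebra of differential operators on $\mathbb C[t_0,\dots,t_n]$, $\mathcal H=\mathbb C[t_0\partial_0,\dots,t_n\partial_n]$, $\mathcal H'\subset\mathcal H$ the subalgebra generated by all $t_i\partial_i-t_j\partial_j$, $E=\sum_i t_i\partial_i$, and $\mathcal D^E$ the centralizer of $E$ in $\mathcal D$. For $\mathcal U=\mathcal D$ or $\mathcal D^E$, a generalized weight $(\mathcal U,\mathcal H)$-module is a $\mathcal U$-module $M=\bigoplus_{\lambda\in\mathbb C^{n+1}}M^{(\lambda)}$, $M^{(\lambda)}=\{m:(t_i\partial_i-\lambda_i)^Nm=0\text{ for some }N>0\text{ and all }i\}$; its support is $\{\lambda : M^{(\lambda)}\ne0\}$. ${}_{\rm s}(\mathcal D,\mathcal H)_\nu$-mod is the category of generalized weight $(\mathcal D,\mathcal H)$-modules with support in $\nu+\mathbb Z^{n+1}$ on which $\mathcal H'$ acts semisimply. ${}_{\rm s}(\mathcal D^E,\mathcal H)^a_\nu$-mod is the category of generalized weight $(\mathcal D^E,\mathcal H)$-modules with support in $\nu+\mathbb Z^{n+1}$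 on which $E-a$ acts locally nilpotently and $\mathcal H'$ acts semisimply. *)

theory Defs
  imports Complex_Main "HOL-Algebra.Module" "HOL-Algebra.Generated_Groups"
    "HOL-Library.Poly_Mapping" "HOL-Library.Cardinality"
begin

section \<open>Categories and equivalence of categories\<close>

text \<open>Hom-sets need not be disjoint, so composition takes the three objects as arguments:
  \<open>Cmp C X Y Z g f\<close> is the composite of \<open>f : X \<rightarrow> Y\<close> with \<open>g : Y \<rightarrow> Z\<close>.\<close>

record ('o, 'a) cat =
  Ob :: "'o set"
  Hom :: "'o \<Rightarrow> 'o \<Rightarrow> 'a set"
  Idt :: "'o \<Rightarrow> 'a"
  Cmp :: "'o \<Rightarrow> 'o \<Rightarrow> 'o \<Rightarrow> 'a \<Rightarrow> 'a \<Rightarrow> 'a"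

locale category =
  fixes C :: "('o, 'a) cat"
  assumes Idt_Hom: "X \<in> Ob C \<Longrightarrow> Idt C X \<in> Hom C X X"
    and Cmp_Hom: "\<lbrakk>X \<in> Ob C; Y \<in> Ob C; Z \<in> Ob C; f \<in> Hom C X Y; g \<in> Hom C Y Z\<rbrakk>
      \<Longrightarrow> Cmp C X Y Z g f \<in> Hom C X Z"
    and Cmp_Idt_right: "\<lbrakk>X \<in> Ob C; Y \<in> Ob C; f \<in> Hom C X Y\<rbrakk> \<Longrightarrow> Cmp C X X Y f (Idt C X) = f"
    and Cmp_Idt_left: "\<lbrakk>X \<in> Ob C; Y \<in> Ob C; f \<in> Hom C X Y\<rbrakk> \<Longrightarrow> Cmp C X Y Y (Idt C Y) f = f"
    and Cmp_assoc: "\<lbrakk>W \<in> Ob C; X \<in> Ob C; Y \<in> Ob C; Z \<in> Ob C;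
        f \<in> Hom C W X; g \<in> Hom C X Y; h \<in> Hom C Y Z\<rbrakk>
      \<Longrightarrow> Cmp C W Y Z h (Cmp C W X Y g f) = Cmp C W X Z (Cmp C X Y Z h g) f"

locale cat_functor = C: category C + D: category D
  for C :: "('o, 'a) cat" and D :: "('p, 'b) cat" +
  fixes Fo :: "'o \<Rightarrow> 'p" and Fa :: "'o \<Rightarrow> 'o \<Rightarrow> 'a \<Rightarrow> 'b"
  assumes Fo_Ob: "X \<in> Ob C \<Longrightarrow> Fo X \<in> Ob D"
    and Fa_Hom: "\<lbrakk>X \<in> Ob C; Y \<in> Ob C; f \<in> Hom C X Y\<rbrakk> \<Longrightarrow> Fa X Y f \<in> Hom D (Fo X) (Fo Y)"
    and Fa_Idt: "X \<in> Ob C \<Longrightarrow> Fa X X (Idt C X) = Idt D (Fo X)"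
    and Fa_Cmp: "\<lbrakk>X \<in> Ob C; Y \<in> Ob C; Z \<in> Ob C; f \<in> Hom C X Y; g \<in> Hom C Y Z\<rbrakk>
      \<Longrightarrow> Fa X Z (Cmp C X Y Z g f) = Cmp D (Fo X) (Fo Y) (Fo Z) (Fa Y Z g) (Fa X Y f)"

definition is_iso :: "('o, 'a) cat \<Rightarrow> 'o \<Rightarrow> 'o \<Rightarrow> 'a \<Rightarrow> bool" where
  "is_iso C X Y f \<longleftrightarrow> f \<in> Hom C X Y \<and>
     (\<exists>g \<in> Hom C Y X. Cmp C X Y X g f = Idt C X \<and> Cmp C Y X Y f g = Idt C Y)"

locale natural_iso = F: cat_functor C D Fo Fa + G: cat_functor C D Go Ga
  for C :: "('o, 'a) cat" and D :: "('p, 'b) cat" and Fo Fa Go Ga +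
  fixes \<eta> :: "'o \<Rightarrow> 'b"
  assumes component_iso: "X \<in> Ob C \<Longrightarrow> is_iso D (Fo X) (Go X) (\<eta> X)"
    and naturality: "\<lbrakk>X \<in> Ob C; Y \<in> Ob C; f \<in> Hom C X Y\<rbrakk> \<Longrightarrow>
      Cmp D (Fo X) (Fo Y) (Go Y) (\<eta> Y) (Fa X Y f) = Cmp D (Fo X) (Go X) (Go Y) (Ga X Y f) (\<eta> X)"

definition equivalent_categories :: "('o, 'a) cat \<Rightarrow> ('p, 'b) cat \<Rightarrow> bool" where
  "equivalent_categories C D \<longleftrightarrow>
     (\<exists>Fo Fa Go Ga \<eta> \<epsilon>.
        cat_functor C D Fo Fa \<and> cat_functor D C Go Ga \<and>
        natural_iso C C (\<lambda>X. X) (\<lambda>X Y f. f)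
          (\<lambda>X. Go (Fo X)) (\<lambda>X Y f. Ga (Fo X) (Fo Y) (Fa X Y f)) \<eta> \<and>
        natural_iso D D (\<lambda>X. Fo (Go X)) (\<lambda>X Y f. Fa (Go X) (Go Y) (Ga X Y f))
          (\<lambda>X. X) (\<lambda>X Y f. f) \<epsilon>)"


section \<open>Left modules over a noncommutative ring\<close>

text \<open>The locale \<^locale>\<open>module\<close> of HOL-Algebra requires a commutative ring.  We reuse its record
  type; the fields \<open>mult\<close> and \<open>one\<close> of the module are irrelevant.\<close>

locale left_module = R?: ring R + M?: abelian_group M
  for R :: "('r, 'm) ring_scheme" (structure) and M :: "('r, 'v) module" (structure) +
  assumes smult_closed:
      "\<lbrakk>a \<in> carrier R; x \<in> carrier M\<rbrakk> \<Longrightarrow> a \<odot>\<^bsub>M\<^esub> x \<in> carrier M"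
    and smult_l_distr:
      "\<lbrakk>a \<in> carrier R; b \<in> carrier R; x \<in> carrier M\<rbrakk>
        \<Longrightarrow> (a \<oplus>\<^bsub>R\<^esub> b) \<odot>\<^bsub>M\<^esub> x = a \<odot>\<^bsub>M\<^esub> x \<oplus>\<^bsub>M\<^esub> b \<odot>\<^bsub>M\<^esub> x"
    and smult_r_distr:
      "\<lbrakk>a \<in> carrier R; x \<in> carrier M; y \<in> carrier M\<rbrakk>
        \<Longrightarrow> a \<odot>\<^bsub>M\<^esub> (x \<oplus>\<^bsub>M\<^esub> y) = a \<odot>\<^bsub>M\<^esub> x \<oplus>\<^bsub>M\<^esub> a \<odot>\<^bsub>M\<^esub> y"
    and smult_assoc:
      "\<lbrakk>a \<in> carrier R; b \<in> carrier R; x \<in> carrier M\<rbrakk>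
        \<Longrightarrow> (a \<otimes>\<^bsub>R\<^esub> b) \<odot>\<^bsub>M\<^esub> x = a \<odot>\<^bsub>M\<^esub> (b \<odot>\<^bsub>M\<^esub> x)"
    and smult_one: "x \<in> carrier M \<Longrightarrow> \<one>\<^bsub>R\<^esub> \<odot>\<^bsub>M\<^esub> x = x"

text \<open>Homomorphisms are extensional functions, i.e. \<open>undefined\<close> outside the carrier, so that equality
  of morphisms is equality on the carrier.\<close>

definition lmod_hom ::
  "('r, 'm) ring_scheme \<Rightarrow> ('r, 'v) module \<Rightarrow> ('r, 'v) module \<Rightarrow> ('v \<Rightarrow> 'v) set" where
  "lmod_hom R M N = {f \<in> carrier M \<rightarrow>\<^sub>E carrier N.
     (\<forall>x \<in> carrier M. \<forall>y \<in> carrier M. f (x \<oplus>\<^bsub>M\<^esub> y) = f x \<oplus>\<^bsub>N\<^esub> f y) \<and>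
     (\<forall>a \<in> carrier R. \<forall>x \<in> carrier M. f (a \<odot>\<^bsub>M\<^esub> x) = a \<odot>\<^bsub>N\<^esub> f x)}"

text \<open>The full subcategory of left \<open>R\<close>-modules given by a class of modules.\<close>

definition lmod_cat ::
  "('r, 'm) ring_scheme \<Rightarrow> ('r, 'v) module set \<Rightarrow> (('r, 'v) module, 'v \<Rightarrow> 'v) cat" where
  "lmod_cat R K = \<lparr>Ob = {M \<in> K. left_module R M}, Hom = lmod_hom R,
     Idt = (\<lambda>M. \<lambda>x \<in> carrier M. x), Cmp = (\<lambda>L M N g f. compose (carrier L) g f)\<rparr>"

lemma category_lmod_cat: "category (lmod_cat R K)"
proof
  fix X assume "X \<in> Ob (lmod_cat R K)"
  then interpret left_module R X by (simp add: lmod_cat_def)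
  show "Idt (lmod_cat R K) X \<in> Hom (lmod_cat R K) X X"
    by (auto simp: lmod_cat_def lmod_hom_def smult_closed)
next
  fix X Y Z f g
  assume "X \<in> Ob (lmod_cat R K)" and f: "f \<in> Hom (lmod_cat R K) X Y"
    and g: "g \<in> Hom (lmod_cat R K) Y Z"
  then interpret left_module R X by (simp add: lmod_cat_def)
  have "f x \<in> carrier Y" if "x \<in> carrier X" for x
    using f that by (auto simp: lmod_cat_def lmod_hom_def)
  with f g show "Cmp (lmod_cat R K) X Y Z g f \<in> Hom (lmod_cat R K) X Z"
    by (auto simp: lmod_cat_def lmod_hom_def compose_def smult_closed PiE_iff)
qed (auto simp: lmod_cat_def lmod_hom_def compose_def fun_eq_iff PiE_iff extensional_def)

definition simple_submodule :: "'v set \<Rightarrow> ('r, 'm) ring_scheme \<Rightarrow> ('r, 'v) module \<Rightarrow> bool" where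
  "simple_submodule S R M \<longleftrightarrow> submodule S R M \<and> S \<noteq> {\<zero>\<^bsub>M\<^esub>} \<and>
     (\<forall>T. submodule T R M \<longrightarrow> T \<subseteq> S \<longrightarrow> T = {\<zero>\<^bsub>M\<^esub>} \<or> T = S)"

text \<open>\<open>M\<close> is the sum of its simple submodules (the additive subgroup generated by a union of
  submodules is their sum).\<close>

definition semisimple_module :: "('r, 'm) ring_scheme \<Rightarrow> ('r, 'v) module \<Rightarrow> bool" where
  "semisimple_module R M \<longleftrightarrow>
     generate (add_monoid M) (\<Union>{S. simple_submodule S R M}) = carrier M"


section \<open>The Weyl algebra\<close>

text \<open>The variables \<open>t\<^sub>0, \<dots>, t\<^sub>n\<close> are indexed by a finite type \<open>'i\<close> with \<open>n + 1\<close> elements;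
  monomials are \<open>'i \<Rightarrow>\<^sub>0 nat\<close>.\<close>

type_synonym 'i cpoly = "('i \<Rightarrow>\<^sub>0 nat) \<Rightarrow>\<^sub>0 complex"
type_synonym 'i oper = "'i cpoly \<Rightarrow> 'i cpoly"

definition scal :: "complex \<Rightarrow> 'i oper" where
  "scal c = (\<lambda>p. Poly_Mapping.single 0 c * p)"

definition tmul :: "'i \<Rightarrow> 'i oper" where
  "tmul i = (\<lambda>p. Poly_Mapping.single (Poly_Mapping.single i 1) 1 * p)"

text \<open>The partial derivative \<open>\<partial>\<^sub>i\<close>.  The subtraction of exponents is truncated, but only where
  the coefficient vanishes.\<close>

definition del :: "'i \<Rightarrow> 'i oper" where
  "del i = (\<lambda>p. \<Sum>m \<in> Poly_Mapping.keys p.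
     Poly_Mapping.single (m - Poly_Mapping.single i 1)
       (of_nat (Poly_Mapping.lookup m i) * Poly_Mapping.lookup p m))"

inductive_set gen_algebra :: "'i oper set \<Rightarrow> 'i oper set" for S :: "'i oper set" where
  scal: "scal c \<in> gen_algebra S"
| incl: "d \<in> S \<Longrightarrow> d \<in> gen_algebra S"
| add: "d \<in> gen_algebra S \<Longrightarrow> e \<in> gen_algebra S \<Longrightarrow> (\<lambda>p. d p + e p) \<in> gen_algebra S"
| comp: "d \<in> gen_algebra S \<Longrightarrow> e \<in> gen_algebra S \<Longrightarrow> d \<circ> e \<in> gen_algebra S"

definition oper_ring :: "'i oper set \<Rightarrow> 'i oper ring" where
  "oper_ring A = \<lparr>carrier = A, mult = (\<circ>), one = id, zero = (\<lambda>p. 0), add = (\<lambda>d e p. d p + e p)\<rparr>"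

definition weyl :: "'i oper set" where
  "weyl = gen_algebra (range tmul \<union> range del)"

definition euler :: "('i :: finite) oper" where
  "euler = (\<lambda>p. \<Sum>i \<in> UNIV. tmul i (del i p))"

definition weylE :: "('i :: finite) oper set" where
  "weylE = {d \<in> weyl. d \<circ> euler = euler \<circ> d}"

text \<open>The algebra \<open>\<H>'\<close> generated by the \<open>t\<^sub>i \<partial>\<^sub>i - t\<^sub>j \<partial>\<^sub>j\<close>.\<close>

definition Hprime :: "'i oper set" where
  "Hprime = gen_algebra {\<lambda>p. tmul i (del i p) - tmul j (del j p) | i j. True}"


lemma gen_algebra_additive:
  assumes "d \<in> gen_algebra S" and "\<And>s p q. s \<in> S \<Longrightarrow> s (p + q) = s p + s q"
  shows "d (p + q) = d p + d q"
  using assms(1) by (induction arbitrary: p q) (auto simp: scal_def algebra_simps assms(2))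

lemma del_eq_sum:
  assumes "finite A" "Poly_Mapping.keys p \<subseteq> A"
  shows "del i p = (\<Sum>m \<in> A. Poly_Mapping.single (m - Poly_Mapping.single i 1)
       (of_nat (Poly_Mapping.lookup m i) * Poly_Mapping.lookup p m))"
  unfolding del_def using assms
  by (intro sum.mono_neutral_left) (auto simp: in_keys_iff)

lemma del_add: "del i (p + q) = del i p + del i q"
  by (subst (1 2 3) del_eq_sum[where A = "Poly_Mapping.keys p \<union> Poly_Mapping.keys q"])
    (auto simp: sum.distrib[symmetric] single_add[symmetric] lookup_add algebra_simps
      dest: subsetD[OF Poly_Mapping.keys_add])

lemma generators_additive:
  "s \<in> range tmul \<union> range del \<Longrightarrow> s (p + q) = s p + s q"
  by (auto simp: tmul_def del_add algebra_simps)

lemma ring_oper_ring: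
  assumes "\<And>d p q. d \<in> A \<Longrightarrow> d (p + q) = d p + d q"
    and "\<And>c. scal c \<in> A"
    and "\<And>d e. d \<in> A \<Longrightarrow> e \<in> A \<Longrightarrow> (\<lambda>p. d p + e p) \<in> A"
    and "\<And>d e. d \<in> A \<Longrightarrow> e \<in> A \<Longrightarrow> d \<circ> e \<in> A"
  shows "ring (oper_ring A)"
proof -
  have id: "id \<in> A" using assms(2)[of 1] by (simp add: scal_def id_def)
  have zero: "(\<lambda>p. 0) \<in> A" using assms(2)[of 0] by (simp add: scal_def)
  have neg: "(\<lambda>p. - d p) \<in> A" if "d \<in> A" for d
    using assms(4)[OF assms(2)[of "-1"] that] by (simp add: scal_def comp_def single_uminus)
  show ?thesis
  proof (rule ringI)
    show "abelian_group (oper_ring A)"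
    proof (rule abelian_groupI)
      fix d assume "d \<in> carrier (oper_ring A)"
      then show "\<exists>e\<in>carrier (oper_ring A). e \<oplus>\<^bsub>oper_ring A\<^esub> d = \<zero>\<^bsub>oper_ring A\<^esub>"
        using neg by (intro bexI[of _ "\<lambda>p. - d p"]) (auto simp: oper_ring_def)
    qed (auto simp: oper_ring_def zero assms(3) algebra_simps)
    show "monoid (oper_ring A)"
      by (rule monoidI) (auto simp: oper_ring_def id assms(4))
  qed (auto simp: oper_ring_def fun_eq_iff assms(1))
qed

lemma ring_weyl: "ring (oper_ring weyl)"
  unfolding weyl_def
  by (rule ring_oper_ring)
    (auto intro: gen_algebra.intros gen_algebra_additive generators_additive)

lemma gen_algebra_sum:
  "finite I \<Longrightarrow> (\<And>i. i \<in> I \<Longrightarrow> d i \<in> gen_algebra S) \<Longrightarrow> (\<lambda>p. \<Sum>i \<in> I. d i p) \<in> gen_algebra S"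
proof (induction I rule: finite_induct)
  case empty
  show ?case using gen_algebra.scal[of 0 S] by (simp add: scal_def)
next
  case (insert i I)
  then show ?case by (auto intro: gen_algebra.add)
qed

lemma euler_in_weyl: "euler \<in> weyl"
proof -
  have "(\<lambda>p. tmul i (del i p)) \<in> weyl" for i :: 'a
    using gen_algebra.comp[of "tmul i" "range tmul \<union> range del" "del i"]
    by (auto simp: weyl_def comp_def intro: gen_algebra.incl)
  then show ?thesis unfolding euler_def weyl_def by (auto intro: gen_algebra_sum)
qed

lemma weyl_additive: "d \<in> weyl \<Longrightarrow> d (p + q) = d p + d q"
  unfolding weyl_def by (erule gen_algebra_additive) (rule generators_additive)

lemma del_scal: "del i (scal c p) = scal c (del i p)"
proof -
  have l: "Poly_Mapping.lookup (scal c p) m = c * Poly_Mapping.lookup p m" for p :: "'a cpoly" and m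
    by (simp add: scal_def mult_map_scale_conv_mult[symmetric] Poly_Mapping.map.rep_eq when_def)
  have k: "Poly_Mapping.keys (scal c p) \<subseteq> Poly_Mapping.keys p"
    by (auto simp: l in_keys_iff)
  have sc: "scal c (Poly_Mapping.single m x) = Poly_Mapping.single m (c * x)" for m :: "'a \<Rightarrow>\<^sub>0 nat" and x
    by (simp add: scal_def mult_single)
  have "scal c (\<Sum>m \<in> A. f m) = (\<Sum>m \<in> A. scal c (f m))" for A and f :: "('a \<Rightarrow>\<^sub>0 nat) \<Rightarrow> 'a cpoly"
    by (simp add: scal_def sum_distrib_left)
  then show ?thesis
    by (subst del_eq_sum[OF finite_keys k]) (simp add: del_def sc l mult.left_commute)
qed

lemma scal_in_weylE: "scal c \<in> weylE"
proof -
  have "tmul i (scal c p) = scal c (tmul i p)" for i :: 'a and p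
    by (simp add: tmul_def scal_def algebra_simps)
  moreover have "scal c (\<Sum>i \<in> UNIV. f i) = (\<Sum>i \<in> UNIV. scal c (f i))" for f :: "'a \<Rightarrow> 'a cpoly"
    by (simp add: scal_def sum_distrib_left)
  ultimately show ?thesis
    by (auto simp: weylE_def weyl_def fun_eq_iff euler_def del_scal intro: gen_algebra.scal)
qed

lemma ring_weylE: "ring (oper_ring weylE)"
proof (rule ring_oper_ring)
  fix d e :: "'a oper" assume d: "d \<in> weylE" and e: "e \<in> weylE"
  then show "(\<lambda>p. d p + e p) \<in> weylE"
    using weyl_additive[OF euler_in_weyl[where 'a = 'a]]
    by (auto simp: weylE_def weyl_def fun_eq_iff intro: gen_algebra.add)
  have "d (e (euler p)) = euler (d (e p))" for p
    using d e unfolding weylE_def by (metis (mono_tags, lifting) comp_apply mem_Collect_eq)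
  then show "d \<circ> e \<in> weylE"
    using d e by (auto simp: weylE_def weyl_def fun_eq_iff intro: gen_algebra.comp)
qed (use scal_in_weylE in \<open>auto simp: weylE_def weyl_additive\<close>)

lemma tmul_single:
  "tmul j (Poly_Mapping.single m c) = Poly_Mapping.single (Poly_Mapping.single j 1 + m) c"
  by (simp add: tmul_def mult_single)

lemma del_single: "del i (Poly_Mapping.single m c) =
    Poly_Mapping.single (m - Poly_Mapping.single i 1) (of_nat (Poly_Mapping.lookup m i) * c)"
  by (subst del_eq_sum[where A = "{m}"]) auto

text \<open>The canonical commutation relation \<open>[\<partial>\<^sub>i, t\<^sub>j] = \<delta>\<^sub>i\<^sub>j\<close>.\<close>

lemma del_tmul: "del i (tmul j p) = tmul j (del i p) + (if i = j then p else 0)"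
proof -
  have 1: "del i (tmul j (Poly_Mapping.single m c)) = tmul j (del i (Poly_Mapping.single m c)) +
      (if i = j then Poly_Mapping.single m c else 0)" for m c
  proof (cases "i = j")
    case True
    show ?thesis
    proof (cases "Poly_Mapping.lookup m i = 0")
      case False
      then have "Poly_Mapping.single i 1 + (m - Poly_Mapping.single i 1) = m"
        by (intro poly_mapping_eqI) (auto simp: lookup_add lookup_minus lookup_single when_def)
      with True show ?thesis
        by (simp add: tmul_single del_single lookup_add single_add[symmetric] algebra_simps)
    next
      case True': True
      have "tmul j 0 = 0" by (simp add: tmul_def)
      with True True' show ?thesis by (simp add: tmul_single del_single lookup_add)
    qed
  next
    case False
    then have "Poly_Mapping.single j 1 + m - Poly_Mapping.single i 1 =
        Poly_Mapping.single j 1 + (m - Poly_Mapping.single i 1)"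
      by (intro poly_mapping_eqI) (auto simp: lookup_add lookup_minus lookup_single when_def)
    with False show ?thesis
      by (simp add: tmul_single del_single lookup_add lookup_single)
  qed
  have add: "tmul j (p + q) = tmul j p + tmul j q" for p q
    by (simp add: tmul_def algebra_simps)
  have zero: "tmul j 0 = 0" "del i 0 = 0"
    by (simp_all add: tmul_def del_def)
  have "del i (tmul j (\<Sum>m \<in> A. Poly_Mapping.single m (f m))) =
      tmul j (del i (\<Sum>m \<in> A. Poly_Mapping.single m (f m))) +
      (if i = j then \<Sum>m \<in> A. Poly_Mapping.single m (f m) else 0)"
    if "finite A" for A and f :: "_ \<Rightarrow> complex"
    using that by (induction A rule: finite_induct) (auto simp: del_add add 1 zero)
  moreover have p: "(\<Sum>m \<in> Poly_Mapping.keys p. Poly_Mapping.single m (Poly_Mapping.lookup p m)) = p"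
    by (intro poly_mapping_eqI)
      (simp add: lookup_sum lookup_single when_def in_keys_iff sum.delta[where S = "Poly_Mapping.keys p"])
  ultimately show ?thesis
    using finite_keys[of p] by metis
qed


section \<open>Generalized weight modules\<close>

definition gen_weight_space :: "('i oper, 'v) module \<Rightarrow> ('i \<Rightarrow> complex) \<Rightarrow> 'v set" where
  "gen_weight_space M \<mu> = {m \<in> carrier M. \<exists>N>0. \<forall>i.
     ((\<lambda>p. tmul i (del i p) - scal (\<mu> i) p) ^^ N) \<odot>\<^bsub>M\<^esub> m = \<zero>\<^bsub>M\<^esub>}"

text \<open>\<open>M\<close> is the direct sum of its generalized weight spaces: every element has a unique
  decomposition into components, almost all zero.\<close>

definition gen_weight_decomp :: "('i oper, 'v) module \<Rightarrow> bool" where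
  "gen_weight_decomp M \<longleftrightarrow> (\<forall>m \<in> carrier M. \<exists>!f.
     (\<forall>\<mu>. f \<mu> \<in> gen_weight_space M \<mu>) \<and> finite {\<mu>. f \<mu> \<noteq> \<zero>\<^bsub>M\<^esub>} \<and>
     m = finsum M f {\<mu>. f \<mu> \<noteq> \<zero>\<^bsub>M\<^esub>})"

definition weight_support :: "('i oper, 'v) module \<Rightarrow> ('i \<Rightarrow> complex) set" where
  "weight_support M = {\<mu>. gen_weight_space M \<mu> \<noteq> {\<zero>\<^bsub>M\<^esub>}}"

definition E_locally_nilpotent :: "complex \<Rightarrow> ('i :: finite oper, 'v) module \<Rightarrow> bool" where
  "E_locally_nilpotent a M \<longleftrightarrow>
     (\<forall>m \<in> carrier M. \<exists>N>0. ((\<lambda>p. euler p - scal a p) ^^ N) \<odot>\<^bsub>M\<^esub> m = \<zero>\<^bsub>M\<^esub>)"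

text \<open>The categories of modules whose carriers are subsets of the type \<open>'v\<close>, which acts as the
  universe.\<close>

definition sDH_mod ::
  "('i :: finite \<Rightarrow> complex) \<Rightarrow> (('i oper, 'v) module, 'v \<Rightarrow> 'v) cat" where
  "sDH_mod \<nu> = lmod_cat (oper_ring weyl)
     {M. gen_weight_decomp M \<and> weight_support M \<subseteq> {\<mu>. \<forall>i. \<mu> i - \<nu> i \<in> \<int>} \<and>
         semisimple_module (oper_ring Hprime) M}"

definition sDEH_mod ::
  "complex \<Rightarrow> ('i :: finite \<Rightarrow> complex) \<Rightarrow> (('i oper, 'v) module, 'v \<Rightarrow> 'v) cat" where
  "sDEH_mod a \<nu> = lmod_cat (oper_ring weylE)
     {M. gen_weight_decomp M \<and> weight_support M \<subseteq> {\<mu>. \<forall>i. \<mu> i - \<nu> i \<in> \<int>} \<and>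
         E_locally_nilpotent a M \<and> semisimple_module (oper_ring Hprime) M}"

end

theory Submission
  imports Defs
begin

text \<open>The functor sends a \<open>\<D>\<close>-module \<open>M\<close> to the generalized eigenspace of \<open>E\<close> for the eigenvalue \<open>a\<close>.
  Choose \<open>i\<close> with \<open>\<nu>\<^sub>i\<close> not an integer.  Then \<open>t\<^sub>i \<partial>\<^sub>i\<close> and \<open>\<partial>\<^sub>i t\<^sub>i\<close> have only nonzero generalized eigenvalues, so \<open>t\<^sub>i\<close>
  and \<open>\<partial>\<^sub>i\<close> are bijective on \<open>M\<close> and connect every degree with degree \<open>a\<close>.  Hence \<open>M\<close> is generated by its
  degree \<open>a\<close> part and has no nonzero submodule that vanishes there, which makes the functor fully
  faithful.  A \<open>\<D>\<^sup>E\<close>-module \<open>N\<close> is the degree \<open>a\<close> part of the image of \<open>\<D> \<otimes> N\<close> in the coinduced module.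
  This image has at most the cardinality of \<open>N\<close>, so it can be realized in the same universe.\<close>

section \<open>Fully faithful and essentially surjective functors\<close>

text \<open>Since a - |\<nu>| is an integer, every weight \<mu> in \<nu> + Z^(n+1) has its degree
  |\<mu>| in a + Z, so a power of \<open>tmul i\<close> or \<open>del i\<close> leads from it to
  degree a. The eigenvalues of \<open>theta i\<close>, which is \<open>tmul i\<close> after
  \<open>del i\<close>, lie in \<nu> i + Z and so avoid 0 and -1; this is the source of bijectivity.
  Semisimplicity enters through weight vectors on which \<open>Hprime\<close> acts by scalars: on
  them \<open>euler\<close> - |\<mu>| equals n + 1 times the locally nilpotent operator
  \<open>theta i\<close> - \<mu> i. Fullness uses both consequences: generation in degree a gives an
  extension of a map, and the absence of submodules vanishing there makes it single-valued. The
  obstacle is essential surjectivity inside one fixed type. Passing from the tensor product to its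
  image among functions on \<open>weyl\<close> replaces a quotient by pointwise equality, and
  evaluation at \<open>id\<close> shows that N embeds. The cardinality bound rests on two facts: a
  nonzero N contains a complex line, and \<open>weyl\<close> has at most as many elements as the
  complex numbers. The zero module needs separate treatment.\<close>

lemma equivalent_categories_if_fully_faithful:
  assumes F: "cat_functor C D Fo Fa"
    and ff: "\<And>X Y. X \<in> Ob C \<Longrightarrow> Y \<in> Ob C \<Longrightarrow> bij_betw (Fa X Y) (Hom C X Y) (Hom D (Fo X) (Fo Y))"
    and es: "\<And>Y. Y \<in> Ob D \<Longrightarrow> \<exists>X\<in>Ob C. \<exists>f. is_iso D (Fo X) Y f"
  shows "equivalent_categories C D"
proof -
  interpret F: cat_functor C D Fo Fa by fact
  have "\<exists>X f g. X \<in> Ob C \<and> f \<in> Hom D (Fo X) Y \<and> g \<in> Hom D Y (Fo X) \<and>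
      Cmp D (Fo X) Y (Fo X) g f = Idt D (Fo X) \<and> Cmp D Y (Fo X) Y f g = Idt D Y"
    if "Y \<in> Ob D" for Y
    using es[OF that] unfolding is_iso_def by blast
  then obtain Go e e' where G: "\<And>Y. Y \<in> Ob D \<Longrightarrow> Go Y \<in> Ob C"
    "\<And>Y. Y \<in> Ob D \<Longrightarrow> e Y \<in> Hom D (Fo (Go Y)) Y" "\<And>Y. Y \<in> Ob D \<Longrightarrow> e' Y \<in> Hom D Y (Fo (Go Y))"
    "\<And>Y. Y \<in> Ob D \<Longrightarrow> Cmp D (Fo (Go Y)) Y (Fo (Go Y)) (e' Y) (e Y) = Idt D (Fo (Go Y))"
    "\<And>Y. Y \<in> Ob D \<Longrightarrow> Cmp D Y (Fo (Go Y)) Y (e Y) (e' Y) = Idt D Y"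
    by metis
  note [simp] = G F.Fo_Ob F.Fa_Hom F.Fa_Idt F.Fa_Cmp F.C.Idt_Hom F.D.Idt_Hom F.C.Cmp_Hom F.D.Cmp_Hom
    F.C.Cmp_Idt_left F.C.Cmp_Idt_right F.D.Cmp_Idt_left F.D.Cmp_Idt_right
  define L where "L X Y h = inv_into (Hom C X Y) (Fa X Y) h" for X Y h
  have L_Hom[simp]: "L X Y h \<in> Hom C X Y" and Fa_L[simp]: "Fa X Y (L X Y h) = h"
    if "X \<in> Ob C" "Y \<in> Ob C" "h \<in> Hom D (Fo X) (Fo Y)" for X Y h
    using ff[OF that(1,2)] that(3) unfolding L_def bij_betw_def
    by (metis inv_into_into, metis f_inv_into_f)
  have Fa_inj: "f = g" if "X \<in> Ob C" "Y \<in> Ob C" "f \<in> Hom C X Y" "g \<in> Hom C X Y" "Fa X Y f = Fa X Y g"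
    for X Y f g
    using ff[OF that(1,2)] that(3-) unfolding bij_betw_def inj_on_def by blast
  \<comment> \<open>Naturality of the isomorphisms \<open>e\<close> forces the image of
    \<open>Ga Y Z h\<close> under the functor to be \<open>h\<close> conjugated by \<open>e\<close>;
    fullness lifts this morphism.\<close>
  define Ga where "Ga Y Z h =
    L (Go Y) (Go Z) (Cmp D (Fo (Go Y)) Z (Fo (Go Z)) (e' Z) (Cmp D (Fo (Go Y)) Y Z h (e Y)))" for Y Z h
  have Ga_Hom[simp]: "Ga Y Z h \<in> Hom C (Go Y) (Go Z)"
    and Fa_Ga: "Fa (Go Y) (Go Z) (Ga Y Z h) =
      Cmp D (Fo (Go Y)) Z (Fo (Go Z)) (e' Z) (Cmp D (Fo (Go Y)) Y Z h (e Y))"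
    if "Y \<in> Ob D" "Z \<in> Ob D" "h \<in> Hom D Y Z" for Y Z h
    using that by (auto simp: Ga_def intro!: L_Hom Fa_L F.D.Cmp_Hom[of _ Z] F.D.Cmp_Hom[of _ Y])
  have e'_nat: "Cmp D (Fo (Go Y)) (Fo (Go Z)) Z (e Z) (Fa (Go Y) (Go Z) (Ga Y Z h)) =
      Cmp D (Fo (Go Y)) Y Z h (e Y)"
    if "Y \<in> Ob D" "Z \<in> Ob D" "h \<in> Hom D Y Z" for Y Z h
  proof -
    have h: "Cmp D (Fo (Go Y)) Y Z h (e Y) \<in> Hom D (Fo (Go Y)) Z"
      using that by (auto intro!: F.D.Cmp_Hom[of _ Y])
    show ?thesis
      using that h by (simp add: Fa_Ga F.D.Cmp_assoc[of _ Z "Fo (Go Z)" Z])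
  qed
  \<comment> \<open>\<open>e Y\<close> has the left inverse \<open>e' Y\<close>. Cancelling it
    reduces functoriality of \<open>Ga\<close> to the naturality of \<open>e\<close>.\<close>
  have e_mono: "f = g" if "X \<in> Ob D" "Y \<in> Ob D" "f \<in> Hom D X (Fo (Go Y))" "g \<in> Hom D X (Fo (Go Y))"
    "Cmp D X (Fo (Go Y)) Y (e Y) f = Cmp D X (Fo (Go Y)) Y (e Y) g" for X Y f g
  proof -
    have "k = Cmp D X Y (Fo (Go Y)) (e' Y) (Cmp D X (Fo (Go Y)) Y (e Y) k)"
      if "k \<in> Hom D X (Fo (Go Y))" for k
      using that \<open>X \<in> Ob D\<close> \<open>Y \<in> Ob D\<close> by (simp add: F.D.Cmp_assoc[of _ "Fo (Go Y)" Y "Fo (Go Y)"])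
    with that show ?thesis by metis
  qed
  have FG: "cat_functor D C Go Ga"
  proof
    fix Y assume Y: "Y \<in> Ob D"
    show "Ga Y Y (Idt D Y) = Idt C (Go Y)"
      using Y by (intro Fa_inj[of "Go Y" "Go Y"]) (auto simp: Fa_Ga)
  next
    fix X Y Z f g assume X: "X \<in> Ob D" "Y \<in> Ob D" "Z \<in> Ob D" "f \<in> Hom D X Y" "g \<in> Hom D Y Z"
    let ?X = "Fo (Go X)" and ?Y = "Fo (Go Y)" and ?Z = "Fo (Go Z)"
    let ?f = "Fa (Go X) (Go Y) (Ga X Y f)" and ?g = "Fa (Go Y) (Go Z) (Ga Y Z g)"
    have H: "?f \<in> Hom D ?X ?Y" "?g \<in> Hom D ?Y ?Z" using X by auto
    have gf: "Cmp D X Y Z g f \<in> Hom D X Z" using X by (auto intro: F.D.Cmp_Hom[of _ Y])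
    have "Cmp D ?X ?Z Z (e Z) (Cmp D ?X ?Y ?Z ?g ?f) = Cmp D ?X Y Z g (Cmp D ?X ?Y Y (e Y) ?f)"
      using X H F.D.Cmp_assoc[of ?X ?Y ?Z Z ?f ?g "e Z"] F.D.Cmp_assoc[of ?X ?Y Y Z ?f "e Y" g]
        e'_nat[of Y Z g] by (metis F.Fo_Ob G(1,2))
    also have "\<dots> = Cmp D ?X ?Z Z (e Z) (Fa (Go X) (Go Z) (Ga X Z (Cmp D X Y Z g f)))"
      using X gf by (simp add: e'_nat F.D.Cmp_assoc[of ?X X Y Z])
    finally have "Cmp D ?X ?Y ?Z ?g ?f = Fa (Go X) (Go Z) (Ga X Z (Cmp D X Y Z g f))"
      using X H gf F.D.Cmp_Hom[of ?X ?Y ?Z ?f ?g] by - (rule e_mono[of ?X Z], simp_all)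
    then have "Fa (Go X) (Go Z) (Ga X Z (Cmp D X Y Z g f)) =
        Fa (Go X) (Go Z) (Cmp C (Go X) (Go Y) (Go Z) (Ga Y Z g) (Ga X Y f))"
      using F.Fa_Cmp[of "Go X" "Go Y" "Go Z" "Ga X Y f" "Ga Y Z g"] Ga_Hom G(1) X(1-5) by metis
    moreover have "Cmp C (Go X) (Go Y) (Go Z) (Ga Y Z g) (Ga X Y f) \<in> Hom C (Go X) (Go Z)"
      using X by (intro F.C.Cmp_Hom[of _ "Go Y"]) simp_all
    ultimately show "Ga X Z (Cmp D X Y Z g f) = Cmp C (Go X) (Go Y) (Go Z) (Ga Y Z g) (Ga X Y f)"
      using Fa_inj Ga_Hom G(1) X(1-3) gf by blast
  qed auto
  \<comment> \<open>The unit is the lift of \<open>e' (Fo X)\<close>. Its inverse is the lift of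
    \<open>e (Fo X)\<close>, and faithfulness transfers the equations between them back to
    \<open>C\<close>.\<close>
  define \<eta> where "\<eta> X = L X (Go (Fo X)) (e' (Fo X))" for X
  have \<eta>[simp]: "\<eta> X \<in> Hom C X (Go (Fo X))" "Fa X (Go (Fo X)) (\<eta> X) = e' (Fo X)" if "X \<in> Ob C" for X
    using that by (auto simp: \<eta>_def)
  have "natural_iso D D (\<lambda>X. Fo (Go X)) (\<lambda>X Y f. Fa (Go X) (Go Y) (Ga X Y f)) (\<lambda>X. X) (\<lambda>X Y f. f) e"
  proof (intro natural_iso.intro natural_iso_axioms.intro)
    interpret G: cat_functor D C Go Ga by fact
    show "cat_functor D D (\<lambda>X. Fo (Go X)) (\<lambda>X Y f. Fa (Go X) (Go Y) (Ga X Y f))"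
      by unfold_locales (use G.Fa_Idt G.Fa_Cmp in auto)
    show "cat_functor D D (\<lambda>X. X) (\<lambda>X Y f. f)" by unfold_locales auto
    show "is_iso D (Fo (Go X)) X (e X)" if "X \<in> Ob D" for X
      using that G unfolding is_iso_def by blast
  qed (rule e'_nat)
  moreover have "natural_iso C C (\<lambda>X. X) (\<lambda>X Y f. f)
      (\<lambda>X. Go (Fo X)) (\<lambda>X Y f. Ga (Fo X) (Fo Y) (Fa X Y f)) \<eta>"
  proof (intro natural_iso.intro natural_iso_axioms.intro)
    interpret G: cat_functor D C Go Ga by fact
    show "cat_functor C C (\<lambda>X. Go (Fo X)) (\<lambda>X Y f. Ga (Fo X) (Fo Y) (Fa X Y f))"
      by unfold_locales (use G.Fa_Idt G.Fa_Cmp in auto)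
    show "cat_functor C C (\<lambda>X. X) (\<lambda>X Y f. f)" by unfold_locales auto
    show "is_iso C X (Go (Fo X)) (\<eta> X)" if X: "X \<in> Ob C" for X
      unfolding is_iso_def
    proof (intro conjI bexI)
      show "L (Go (Fo X)) X (e (Fo X)) \<in> Hom C (Go (Fo X)) X" using X by simp
      show "Cmp C X (Go (Fo X)) X (L (Go (Fo X)) X (e (Fo X))) (\<eta> X) = Idt C X"
        using X by (intro Fa_inj[of X X]) (auto intro!: F.C.Cmp_Hom[of _ "Go (Fo X)"])
      show "Cmp C (Go (Fo X)) X (Go (Fo X)) (\<eta> X) (L (Go (Fo X)) X (e (Fo X))) = Idt C (Go (Fo X))"
        using X by (intro Fa_inj[of "Go (Fo X)" "Go (Fo X)"]) (auto intro!: F.C.Cmp_Hom[of _ X])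
    qed (use X in simp)
    show "Cmp C X Y (Go (Fo Y)) (\<eta> Y) f =
        Cmp C X (Go (Fo X)) (Go (Fo Y)) (Ga (Fo X) (Fo Y) (Fa X Y f)) (\<eta> X)"
      if X: "X \<in> Ob C" "Y \<in> Ob C" "f \<in> Hom C X Y" for X Y f
    proof -
      let ?Y = "Fo (Go (Fo Y))" and ?X = "Fo (Go (Fo X))"
      have f: "Fa X Y f \<in> Hom D (Fo X) (Fo Y)" using X by simp
      let ?g = "Cmp C X Y (Go (Fo Y)) (\<eta> Y) f"
      let ?h = "Cmp C X (Go (Fo X)) (Go (Fo Y)) (Ga (Fo X) (Fo Y) (Fa X Y f)) (\<eta> X)"
      have gh: "?g \<in> Hom C X (Go (Fo Y))" "?h \<in> Hom C X (Go (Fo Y))"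
        using X f by (auto intro: F.C.Cmp_Hom[of _ Y] F.C.Cmp_Hom[of _ "Go (Fo X)"])
      have ef: "Cmp D ?X (Fo X) (Fo Y) (Fa X Y f) (e (Fo X)) \<in> Hom D ?X (Fo Y)"
        using X f by (auto intro: F.D.Cmp_Hom[of _ "Fo X"])
      have "Fa X (Go (Fo Y)) ?h = Cmp D (Fo X) ?X ?Y (Cmp D ?X (Fo Y) ?Y (e' (Fo Y))
          (Cmp D ?X (Fo X) (Fo Y) (Fa X Y f) (e (Fo X)))) (e' (Fo X))"
        using X f by (simp add: Fa_Ga)
      also have "\<dots> = Cmp D (Fo X) (Fo Y) ?Y (e' (Fo Y)) (Fa X Y f)"
        using X f ef F.D.Cmp_assoc[of "Fo X" ?X "Fo Y" ?Y] F.D.Cmp_assoc[of "Fo X" ?X "Fo X" "Fo Y"]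
        by (metis F.D.Cmp_Idt_right F.Fo_Ob G)
      finally have "Fa X (Go (Fo Y)) ?h = Fa X (Go (Fo Y)) ?g" using X by simp
      then show ?thesis using X gh by (intro Fa_inj[of X "Go (Fo Y)"]) auto
    qed
  qed
  ultimately show ?thesis using F FG unfolding equivalent_categories_def by blast
qed

section \<open>The grading of the Weyl algebra\<close>

lemma poly_mapping_sum_single:
  "(\<Sum>m \<in> Poly_Mapping.keys p. Poly_Mapping.single m (Poly_Mapping.lookup p m)) = p"
  by (intro poly_mapping_eqI)
    (simp add: lookup_sum lookup_single when_def in_keys_iff sum.delta[where S = "Poly_Mapping.keys p"])

lemma lookup_scal [simp]: "Poly_Mapping.lookup (scal c p) m = c * Poly_Mapping.lookup p m"
  by (simp add: scal_def mult_map_scale_conv_mult[symmetric] Poly_Mapping.map.rep_eq when_def)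

text \<open>Only the monomial \<open>m + single i 1\<close> contributes to the coefficient at
  \<open>m\<close>. Truncated subtraction also sends a monomial without the variable to itself, but
  with coefficient 0.\<close>

lemma lookup_del:
  "Poly_Mapping.lookup (del i p) m =
    of_nat (Poly_Mapping.lookup m i + 1) * Poly_Mapping.lookup p (m + Poly_Mapping.single i 1)"
proof -
  let ?e = "Poly_Mapping.single i 1 :: 'a \<Rightarrow>\<^sub>0 nat"
  have "Poly_Mapping.lookup (del i p) m = (\<Sum>k \<in> Poly_Mapping.keys p.
      if k = m + ?e then of_nat (Poly_Mapping.lookup k i) * Poly_Mapping.lookup p k else 0)"
    unfolding del_def lookup_sum
  proof (intro sum.cong refl)
    fix k
    show "Poly_Mapping.lookup (Poly_Mapping.single (k - ?e)
        (of_nat (Poly_Mapping.lookup k i) * Poly_Mapping.lookup p k)) m =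
      (if k = m + ?e then of_nat (Poly_Mapping.lookup k i) * Poly_Mapping.lookup p k else 0)"
    proof (cases "Poly_Mapping.lookup k i = 0")
      case True
      then have "k \<noteq> m + ?e" by (auto simp: lookup_add)
      with True show ?thesis by simp
    next
      case False
      have "k - ?e = m \<longleftrightarrow> k = m + ?e"
      proof
        assume "k - ?e = m"
        then show "k = m + ?e" using False
          by (intro poly_mapping_eqI) (auto simp: lookup_add lookup_minus lookup_single when_def)
      qed simp
      then show ?thesis by (auto simp: lookup_single when_def)
    qed
  qed
  also have "\<dots> = of_nat (Poly_Mapping.lookup m i + 1) * Poly_Mapping.lookup p (m + ?e)"
    by (simp add: sum.delta in_keys_iff lookup_add)
  finally show ?thesis .
qed

definition theta :: "'i \<Rightarrow> 'i oper" where
  "theta i = (\<lambda>p. tmul i (del i p))"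

lemma tmul_add: "tmul j (p + q) = tmul j p + tmul j q"
  by (simp add: tmul_def algebra_simps)

lemma tmul_scal: "tmul i (scal c p) = scal c (tmul i p)"
  by (simp add: tmul_def scal_def algebra_simps)

lemma scal_add: "scal c (p + q) = scal c p + scal c q"
  by (simp add: scal_def algebra_simps)

lemma scal_scal: "scal c (scal d p) = scal (c * d) p"
  by (intro poly_mapping_eqI) simp

lemma weyl_add: "d \<in> weyl \<Longrightarrow> e \<in> weyl \<Longrightarrow> (\<lambda>p. d p + e p) \<in> weyl"
  unfolding weyl_def by (rule gen_algebra.add)

lemma weyl_comp: "d \<in> weyl \<Longrightarrow> e \<in> weyl \<Longrightarrow> d \<circ> e \<in> weyl"
  unfolding weyl_def by (rule gen_algebra.comp)

lemma weyl_gen [simp]: "tmul i \<in> weyl" "del i \<in> weyl" "scal c \<in> weyl"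
  unfolding weyl_def by (auto intro: gen_algebra.intros)

lemma weyl_scal: "d \<in> weyl \<Longrightarrow> d (scal c p) = scal c (d p)"
  unfolding weyl_def
  by (induction arbitrary: p rule: gen_algebra.induct)
    (auto simp: tmul_scal del_scal scal_scal scal_add mult.commute)

lemma weyl_zero [simp]: "d \<in> weyl \<Longrightarrow> d 0 = 0"
  using weyl_additive[of d 0 0] by simp

lemma weyl_sum: "d \<in> weyl \<Longrightarrow> d (\<Sum>m \<in> A. f m) = (\<Sum>m \<in> A. d (f m))"
  by (induction A rule: infinite_finite_induct) (auto simp: weyl_additive)

lemma scal_zero_left: "scal 0 = (\<lambda>p. 0)"
  by (simp add: scal_def)

lemma scal_one: "scal 1 = id"
  by (auto simp: scal_def)

lemma scal_add_left: "scal (c + d) p = scal c p + scal d p"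
  by (intro poly_mapping_eqI) (simp add: lookup_add algebra_simps)

lemma scal_minus_left: "scal (- c) p = - scal c p"
  by (intro poly_mapping_eqI) simp

lemma weyl_minus: "d \<in> weyl \<Longrightarrow> d (p - q) = d p - d q"
  using weyl_additive[of d "p - q" q] by simp

text \<open>Monomials are eigenvectors of \<open>theta i\<close>. As a simp rule this reduces every
  identity between \<open>theta\<close>, \<open>euler\<close> and \<open>scal\<close> to commutative
  arithmetic of coefficients.\<close>

lemma lookup_theta [simp]:
  "Poly_Mapping.lookup (theta i p) m = of_nat (Poly_Mapping.lookup m i) * Poly_Mapping.lookup p m"
proof -
  have w: "theta i \<in> weyl"
    using weyl_comp[of "tmul i" "del i"] by (simp add: theta_def comp_def)
  have "theta i (Poly_Mapping.single k c) = Poly_Mapping.single k (of_nat (Poly_Mapping.lookup k i) * c)" for k c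
  proof (cases "Poly_Mapping.lookup k i = 0")
    case True
    then show ?thesis by (simp add: theta_def del_single)
  next
    case False
    then have "Poly_Mapping.single i 1 + (k - Poly_Mapping.single i 1) = k"
      by (intro poly_mapping_eqI) (auto simp: lookup_add lookup_minus lookup_single when_def)
    then show ?thesis by (simp add: theta_def del_single tmul_single)
  qed
  then have "theta i (\<Sum>k \<in> Poly_Mapping.keys p. Poly_Mapping.single k (Poly_Mapping.lookup p k)) =
     (\<Sum>k \<in> Poly_Mapping.keys p. Poly_Mapping.single k (of_nat (Poly_Mapping.lookup k i) * Poly_Mapping.lookup p k))"
    by (simp add: weyl_sum[OF w])
  then have "theta i p = (\<Sum>k \<in> Poly_Mapping.keys p. Poly_Mapping.single k (of_nat (Poly_Mapping.lookup k i) * Poly_Mapping.lookup p k))"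
    by (simp only: poly_mapping_sum_single)
  then show ?thesis
    by (simp add: lookup_sum lookup_single when_def in_keys_iff sum.delta[where S = "Poly_Mapping.keys p"])
qed

definition mdeg :: "('i :: finite \<Rightarrow>\<^sub>0 nat) \<Rightarrow> nat" where
  "mdeg m = (\<Sum>i \<in> UNIV. Poly_Mapping.lookup m i)"

lemma euler_eq: "euler = (\<lambda>p. \<Sum>i \<in> UNIV. theta i p)"
  by (simp add: euler_def theta_def)

lemma lookup_euler [simp]:
  "Poly_Mapping.lookup (euler p) m = of_nat (mdeg m) * Poly_Mapping.lookup p m"
  by (simp add: euler_eq lookup_sum mdeg_def sum_distrib_right)

lemma theta_in_weyl: "theta i \<in> weyl"
  using weyl_comp[of "tmul i" "del i"] by (simp add: theta_def comp_def)

lemma weylE_iff: "d \<in> weylE \<longleftrightarrow> d \<in> weyl \<and> (\<forall>p. d (euler p) = euler (d p))"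
  by (auto simp: weylE_def fun_eq_iff)

lemma theta_in_weylE: "theta i \<in> weylE"
  by (auto simp: weylE_iff theta_in_weyl intro!: poly_mapping_eqI)

lemma euler_in_weylE: "euler \<in> weylE"
  by (simp add: weylE_iff euler_in_weyl)

section \<open>Commutation relations with \<open>theta\<close>\<close>

lemma theta_comm: "theta i (theta j p) = theta j (theta i p)"
  by (intro poly_mapping_eqI) simp

lemma del_comm: "del i (del j p) = del j (del i p)"
  by (intro poly_mapping_eqI)
    (auto simp: lookup_del lookup_add lookup_single when_def algebra_simps)

lemma tmul_comm: "tmul i (tmul j p) = tmul j (tmul i p)"
  by (simp add: tmul_def algebra_simps)

text \<open>The commutator is kept as a scalar multiple, with scalar 0 for distinct indices, so that
  all pairs of indices have the one form T d = d T + k d that the later intertwining lemmas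
  expect.\<close>

lemma theta_tmul: "theta i (tmul j p) = tmul j (theta i p) + scal (if i = j then 1 else 0) (tmul j p)"
proof (cases "i = j")
  case False
  then show ?thesis
    by (simp add: theta_def del_tmul tmul_comm[of i j] scal_zero_left)
qed (simp add: theta_def del_tmul tmul_add scal_one)

lemma theta_del: "theta i (del j p) = del j (theta i p) + scal (if i = j then - 1 else 0) (del j p)"
proof (cases "i = j")
  case False
  then show ?thesis
    by (simp add: theta_def del_tmul del_comm[of i j] scal_zero_left)
qed (simp add: theta_def del_tmul scal_one scal_minus_left)

lemma del_theta_self: "del i (tmul i p) = theta i p + p"
  by (simp add: theta_def del_tmul)

section \<open>Grading of operators by the eigenvalue of the commutator with
  \<open>euler\<close>\<close>

definition weyl_deg :: "int \<Rightarrow> ('i :: finite) oper set" where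
  "weyl_deg k = {d \<in> weyl. \<forall>p. euler (d p) = d (euler p) + scal (of_int k) (d p)}"

lemma tmul_in_weyl_deg: "tmul j \<in> weyl_deg 1"
proof -
  have "(\<Sum>i\<in>UNIV. scal (if i = j then 1 else 0) p) = p" for p :: "'a cpoly"
    by (subst sum.cong[OF refl, of _ _ "\<lambda>i. if i = j then p else 0"])
      (auto simp: scal_one scal_zero_left)
  then show ?thesis
    by (simp add: weyl_deg_def euler_eq theta_tmul sum.distrib weyl_sum scal_one)
qed

lemma del_in_weyl_deg: "del j \<in> weyl_deg (- 1)"
proof -
  have "(\<Sum>i\<in>UNIV. scal (if i = j then - 1 else 0) p) = - p" for p :: "'a cpoly"
    by (subst sum.cong[OF refl, of _ _ "\<lambda>i. if i = j then - p else 0"])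
      (auto simp: scal_one scal_zero_left scal_minus_left)
  then show ?thesis
    by (simp add: weyl_deg_def euler_eq theta_del sum.distrib weyl_sum scal_one scal_minus_left)
qed

lemma weyl_deg_0: "weyl_deg 0 = weylE"
  by (auto simp: weyl_deg_def weylE_iff scal_zero_left)

lemma weyl_deg_comp: "d \<in> weyl_deg k \<Longrightarrow> e \<in> weyl_deg l \<Longrightarrow> d \<circ> e \<in> weyl_deg (k + l)"
  by (auto simp: weyl_deg_def weyl_comp weyl_additive weyl_scal scal_add_left)

lemma weyl_degD: "d \<in> weyl_deg k \<Longrightarrow> d \<in> weyl"
  by (simp add: weyl_deg_def)

text \<open>Sums of homogeneous operators. They are closed under composition by bilinearity and
  contain the generators, hence exhaust \<open>weyl\<close>; this yields an induction over
  homogeneous summands.\<close>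

inductive_set deg_span :: "('i :: finite) oper set" where
  deg: "d \<in> weyl_deg k \<Longrightarrow> d \<in> deg_span"
| add: "d \<in> deg_span \<Longrightarrow> e \<in> deg_span \<Longrightarrow> (\<lambda>p. d p + e p) \<in> deg_span"

lemma deg_span_weyl: "d \<in> deg_span \<Longrightarrow> d \<in> weyl"
  by (induction rule: deg_span.induct) (auto simp: weyl_degD weyl_add)

lemma deg_span_comp:
  assumes "d \<in> deg_span" "e \<in> deg_span"
  shows "d \<circ> e \<in> deg_span"
  using assms(1)
proof (induction rule: deg_span.induct)
  case (deg d k)
  show ?case using assms(2)
  proof (induction rule: deg_span.induct)
    case (deg e l)
    then show ?case using weyl_deg_comp[OF \<open>d \<in> weyl_deg k\<close>] deg_span.deg by blast
  next
    case (add e e')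
    then show ?case using deg_span.add[OF add.IH] deg
      by (simp add: comp_def weyl_additive weyl_degD)
  qed
next
  case (add d d')
  then show ?case using deg_span.add[OF add.IH] by (simp add: comp_def)
qed

lemma weyl_eq_deg_span: "weyl = deg_span"
proof
  have "d \<in> deg_span" if "d \<in> weyl" for d :: "'a oper"
    using that unfolding weyl_def
  proof (induction rule: gen_algebra.induct)
    case (scal c)
    then show ?case using scal_in_weylE weyl_deg_0 by (auto intro: deg_span.deg[of _ 0])
  next
    case (comp d e)
    then show ?case by (intro deg_span_comp)
  qed (auto intro: deg_span.add deg_span.deg tmul_in_weyl_deg del_in_weyl_deg)
  then show "weyl \<subseteq> (deg_span :: 'a oper set)" by blast
qed (auto simp: deg_span_weyl)

lemma weyl_deg_induct [consumes 1, case_names deg add]: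
  assumes "d \<in> weyl"
    and "\<And>d k. d \<in> weyl_deg k \<Longrightarrow> P d"
    and "\<And>d e. d \<in> weyl \<Longrightarrow> e \<in> weyl \<Longrightarrow> P d \<Longrightarrow> P e \<Longrightarrow> P (\<lambda>p. d p + e p)"
  shows "P d"
  using assms(1) unfolding weyl_eq_deg_span
  by (induction rule: deg_span.induct) (auto simp: assms(2,3) deg_span_weyl)

section \<open>Homogeneous components of polynomials and the degree zero part of an operator\<close>

definition hcomp :: "nat \<Rightarrow> ('i :: finite) cpoly \<Rightarrow> 'i cpoly" where
  "hcomp k p = (\<Sum>m \<in> Poly_Mapping.keys p.
     Poly_Mapping.single m (if mdeg m = k then Poly_Mapping.lookup p m else 0))"

lemma lookup_hcomp [simp]:
  "Poly_Mapping.lookup (hcomp k p) m = (if mdeg m = k then Poly_Mapping.lookup p m else 0)"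
  by (simp add: hcomp_def lookup_sum lookup_single when_def in_keys_iff
      sum.delta[where S = "Poly_Mapping.keys p"])

lemma sum_hcomp: "(\<Sum>k \<in> mdeg ` Poly_Mapping.keys p. hcomp k p) = p"
  by (intro poly_mapping_eqI) (auto simp: lookup_sum sum.delta in_keys_iff)

lemma euler_hcomp: "euler (hcomp k p) = scal (of_nat k) (hcomp k p)"
  by (intro poly_mapping_eqI) auto

text \<open>\<open>euler\<close> multiplies each monomial by its degree, so an eigenvector with
  eigenvalue c involves only monomials of degree c.\<close>

lemma hcomp_eigen:
  assumes "euler p = scal c p"
  shows "hcomp j p = (if c = of_nat j then p else 0)"
proof (rule poly_mapping_eqI)
  fix m
  have "of_nat (mdeg m) * Poly_Mapping.lookup p m = c * Poly_Mapping.lookup p m"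
    using arg_cong[OF assms, of "\<lambda>p. Poly_Mapping.lookup p m"] by simp
  then show "Poly_Mapping.lookup (hcomp j p) m = Poly_Mapping.lookup (if c = of_nat j then p else 0) m"
    by auto
qed

text \<open>With P_k the projection onto polynomials of degree k, this is the sum of all P_k d P_k,
  restricted to the finitely many k that occur in \<open>p\<close>. Being read off from the action
  of \<open>d\<close>, it is well defined without choosing a decomposition of \<open>d\<close> into
  homogeneous operators.\<close>

definition proj0 :: "('i :: finite) oper \<Rightarrow> 'i oper" where
  "proj0 d = (\<lambda>p. \<Sum>k \<in> mdeg ` Poly_Mapping.keys p. hcomp k (d (hcomp k p)))"

lemma lookup_proj0:
  assumes "d \<in> weyl"
  shows "Poly_Mapping.lookup (proj0 d p) m = Poly_Mapping.lookup (d (hcomp (mdeg m) p)) m"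
proof -
  have "hcomp (mdeg m) p = 0" if "mdeg m \<notin> mdeg ` Poly_Mapping.keys p"
  proof (rule poly_mapping_eqI)
    fix k
    have "Poly_Mapping.lookup p k = 0" if "mdeg k = mdeg m"
      using that \<open>mdeg m \<notin> mdeg ` Poly_Mapping.keys p\<close> by (metis image_eqI in_keys_iff)
    then show "Poly_Mapping.lookup (hcomp (mdeg m) p) k = Poly_Mapping.lookup 0 k" by simp
  qed
  then show ?thesis using assms
    by (auto simp: proj0_def lookup_sum sum.delta)
qed

text \<open>An operator of degree k sends polynomials of degree j to eigenvectors of
  \<open>euler\<close> with eigenvalue j + k, whose component of degree j vanishes unless k =
  0.\<close>

lemma hcomp_weyl_deg:
  assumes "d \<in> weyl_deg k"
  shows "hcomp j (d (hcomp j p)) = (if k = 0 then d (hcomp j p) else 0)"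
proof -
  have "euler (d (hcomp j p)) = scal (of_nat j + of_int k) (d (hcomp j p))"
    using assms by (simp add: weyl_deg_def euler_hcomp weyl_scal scal_add_left)
  then show ?thesis by (subst hcomp_eigen) auto
qed

lemma proj0_weylE: "d \<in> weylE \<Longrightarrow> proj0 d = d"
proof
  fix p assume d: "d \<in> weylE"
  then have "proj0 d p = (\<Sum>k \<in> mdeg ` Poly_Mapping.keys p. d (hcomp k p))"
    using hcomp_weyl_deg[of d 0] by (simp add: proj0_def weyl_deg_0)
  also have "\<dots> = d (\<Sum>k \<in> mdeg ` Poly_Mapping.keys p. hcomp k p)"
    using d by (simp only: weylE_iff weyl_sum)
  finally show "proj0 d p = d p" by (simp only: sum_hcomp)
qed

lemma proj0_weyl_deg: "d \<in> weyl_deg k \<Longrightarrow> k \<noteq> 0 \<Longrightarrow> proj0 d = (\<lambda>p. 0)"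
  by (simp add: fun_eq_iff proj0_def hcomp_weyl_deg)

lemma proj0_add: "d \<in> weyl \<Longrightarrow> e \<in> weyl \<Longrightarrow> proj0 (\<lambda>p. d p + e p) = (\<lambda>p. proj0 d p + proj0 e p)"
  by (intro ext poly_mapping_eqI) (simp add: lookup_proj0 weyl_add lookup_add)

lemma weylE_hcomp:
  assumes "e \<in> weylE"
  shows "hcomp j (e p) = e (hcomp j p)"
proof -
  have e: "e \<in> weyl" using assms by (simp add: weylE_iff)
  have *: "hcomp j (\<Sum>k\<in>A. f k) = (\<Sum>k\<in>A. hcomp j (f k))" for A and f :: "nat \<Rightarrow> 'a cpoly"
    by (intro poly_mapping_eqI) (auto simp: lookup_sum)
  let ?K = "mdeg ` Poly_Mapping.keys p"
  have "hcomp j (e (hcomp k p)) = e (hcomp j (hcomp k p))" for k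
  proof -
    have "euler (e (hcomp k p)) = e (euler (hcomp k p))"
      using assms by (simp add: weylE_iff)
    also have "\<dots> = scal (of_nat k) (e (hcomp k p))"
      by (simp only: euler_hcomp weyl_scal[OF e])
    finally show ?thesis
      using hcomp_eigen[of "e (hcomp k p)" "of_nat k" j] hcomp_eigen[OF euler_hcomp, of j k p] e
      by simp
  qed
  then have "hcomp j (\<Sum>k \<in> ?K. e (hcomp k p)) = e (hcomp j (\<Sum>k \<in> ?K. hcomp k p))"
    unfolding * by (simp add: weyl_sum[OF e])
  then show ?thesis by (simp add: weyl_sum[OF e, symmetric] sum_hcomp)
qed

text \<open>Operators in \<open>weylE\<close> commute with every \<open>hcomp k\<close>. This right
  linearity is what makes \<open>unit_map\<close> linear over \<open>weylE\<close>.\<close>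

lemma proj0_comp_weylE: "d \<in> weyl \<Longrightarrow> e \<in> weylE \<Longrightarrow> proj0 (d \<circ> e) = proj0 d \<circ> e"
  by (intro ext poly_mapping_eqI)
    (simp add: lookup_proj0 weyl_comp weylE_iff weylE_hcomp)

lemma weylE_add: "d \<in> weylE \<Longrightarrow> e \<in> weylE \<Longrightarrow> (\<lambda>p. d p + e p) \<in> weylE"
  by (simp add: weylE_iff weyl_add weyl_additive euler_in_weyl)

lemma weylE_comp: "d \<in> weylE \<Longrightarrow> e \<in> weylE \<Longrightarrow> d \<circ> e \<in> weylE"
  by (simp add: weylE_iff weyl_comp)

text \<open>On homogeneous summands \<open>proj0\<close> is the identity or zero, so additivity
  keeps it inside \<open>weylE\<close>.\<close>

lemma proj0_in_weylE: "d \<in> weyl \<Longrightarrow> proj0 d \<in> weylE"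
proof (induction rule: weyl_deg_induct)
  case (deg d k)
  then show ?case
    using proj0_weylE[of d] proj0_weyl_deg[OF deg] scal_in_weylE[of 0]
    by (cases "k = 0") (auto simp: weyl_deg_0 scal_zero_left)
qed (simp add: proj0_add weylE_add)

section \<open>Locally finite operators\<close>

lemma (in abelian_group) minus_eq_zero_iff:
  assumes "x \<in> carrier G" "y \<in> carrier G"
  shows "x \<ominus> y = \<zero> \<longleftrightarrow> x = y"
  using assms minus_equality[of x "\<ominus> y"] by (auto simp: minus_eq r_neg)

context left_module begin

lemma smult_zero_right:
  assumes "a \<in> carrier R"
  shows "a \<odot>\<^bsub>M\<^esub> \<zero>\<^bsub>M\<^esub> = \<zero>\<^bsub>M\<^esub>"
proof -
  have "a \<odot>\<^bsub>M\<^esub> \<zero>\<^bsub>M\<^esub> \<oplus>\<^bsub>M\<^esub> a \<odot>\<^bsub>M\<^esub> \<zero>\<^bsub>M\<^esub> = a \<odot>\<^bsub>M\<^esub> \<zero>\<^bsub>M\<^esub>"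
    using smult_r_distr[OF assms, of "\<zero>\<^bsub>M\<^esub>" "\<zero>\<^bsub>M\<^esub>"] by simp
  then show ?thesis
    using M.add.l_cancel_one[of "a \<odot>\<^bsub>M\<^esub> \<zero>\<^bsub>M\<^esub>" "a \<odot>\<^bsub>M\<^esub> \<zero>\<^bsub>M\<^esub>"] smult_closed[OF assms] by simp
qed

lemma smult_zero_left:
  assumes "x \<in> carrier M"
  shows "\<zero>\<^bsub>R\<^esub> \<odot>\<^bsub>M\<^esub> x = \<zero>\<^bsub>M\<^esub>"
proof -
  have "\<zero>\<^bsub>R\<^esub> \<odot>\<^bsub>M\<^esub> x \<oplus>\<^bsub>M\<^esub> \<zero>\<^bsub>R\<^esub> \<odot>\<^bsub>M\<^esub> x = \<zero>\<^bsub>R\<^esub> \<odot>\<^bsub>M\<^esub> x"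
    using smult_l_distr[of "\<zero>\<^bsub>R\<^esub>" "\<zero>\<^bsub>R\<^esub>" x] assms by simp
  then show ?thesis
    using M.add.l_cancel_one[of "\<zero>\<^bsub>R\<^esub> \<odot>\<^bsub>M\<^esub> x" "\<zero>\<^bsub>R\<^esub> \<odot>\<^bsub>M\<^esub> x"] smult_closed[of "\<zero>\<^bsub>R\<^esub>" x] assms
    by simp
qed

lemma smult_minus_one:
  assumes "x \<in> carrier M"
  shows "(\<ominus>\<^bsub>R\<^esub> \<one>\<^bsub>R\<^esub>) \<odot>\<^bsub>M\<^esub> x = \<ominus>\<^bsub>M\<^esub> x"
proof -
  have "(\<ominus>\<^bsub>R\<^esub> \<one>\<^bsub>R\<^esub>) \<odot>\<^bsub>M\<^esub> x \<oplus>\<^bsub>M\<^esub> x = \<zero>\<^bsub>M\<^esub>"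
    using smult_l_distr[of "\<ominus>\<^bsub>R\<^esub> \<one>\<^bsub>R\<^esub>" "\<one>\<^bsub>R\<^esub>" x] assms
    by (simp add: R.l_neg smult_one smult_zero_left)
  then show ?thesis
    using assms M.minus_equality[of "(\<ominus>\<^bsub>R\<^esub> \<one>\<^bsub>R\<^esub>) \<odot>\<^bsub>M\<^esub> x" x] by (simp add: smult_closed)
qed

lemma smult_minus_right:
  assumes "a \<in> carrier R" "x \<in> carrier M"
  shows "a \<odot>\<^bsub>M\<^esub> (\<ominus>\<^bsub>M\<^esub> x) = \<ominus>\<^bsub>M\<^esub> (a \<odot>\<^bsub>M\<^esub> x)"
proof -
  have "a \<odot>\<^bsub>M\<^esub> (\<ominus>\<^bsub>M\<^esub> x) \<oplus>\<^bsub>M\<^esub> a \<odot>\<^bsub>M\<^esub> x = \<zero>\<^bsub>M\<^esub>"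
    using smult_r_distr[of a "\<ominus>\<^bsub>M\<^esub> x" x] assms by (simp add: M.l_neg smult_zero_right)
  then show ?thesis
    using assms M.minus_equality[of "a \<odot>\<^bsub>M\<^esub> (\<ominus>\<^bsub>M\<^esub> x)" "a \<odot>\<^bsub>M\<^esub> x"] by (simp add: smult_closed)
qed

text \<open>Negatives are obtained from the action of - 1. The lemma provides both the degree a part
  of a module and the induced module.\<close>

lemma left_module_restrict:
  assumes H: "H \<subseteq> carrier M" "\<zero>\<^bsub>M\<^esub> \<in> H"
    and add: "\<And>x y. x \<in> H \<Longrightarrow> y \<in> H \<Longrightarrow> x \<oplus>\<^bsub>M\<^esub> y \<in> H"
    and smult: "\<And>a x. a \<in> carrier R \<Longrightarrow> x \<in> H \<Longrightarrow> a \<odot>\<^bsub>M\<^esub> x \<in> H"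
  shows "left_module R (M\<lparr>carrier := H\<rparr>)"
proof -
  have c: "x \<in> carrier M" if "x \<in> H" for x using H that by blast
  have "abelian_group (M\<lparr>carrier := H\<rparr>)"
  proof (rule abelian_groupI)
    fix x assume "x \<in> carrier (M\<lparr>carrier := H\<rparr>)"
    then have x: "x \<in> H" by simp
    have "\<ominus>\<^bsub>M\<^esub> x \<in> H" using smult[of "\<ominus>\<^bsub>R\<^esub> \<one>\<^bsub>R\<^esub>" x] x c[OF x] by (simp add: smult_minus_one)
    then show "\<exists>y\<in>carrier (M\<lparr>carrier := H\<rparr>). y \<oplus>\<^bsub>M\<lparr>carrier := H\<rparr>\<^esub> x = \<zero>\<^bsub>M\<lparr>carrier := H\<rparr>\<^esub>"
      using M.l_neg[OF c[OF x]] by auto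
  qed (auto simp: add H c M.a_ac)
  then show ?thesis
    by (intro left_module.intro left_module_axioms.intro R.ring_axioms)
      (auto simp: c smult smult_l_distr smult_r_distr smult_assoc smult_one)
qed

end

text \<open>A monoid span is enough here: the generating sets to which it is applied are stable
  under multiplication by - 1. Inductions over it have only the cases zero, generator and
  sum.\<close>

inductive_set addspan :: "('r, 'v) module \<Rightarrow> 'v set \<Rightarrow> 'v set" for M S where
  zero: "\<zero>\<^bsub>M\<^esub> \<in> addspan M S"
| incl: "x \<in> S \<Longrightarrow> x \<in> addspan M S"
| add: "x \<in> addspan M S \<Longrightarrow> y \<in> addspan M S \<Longrightarrow> x \<oplus>\<^bsub>M\<^esub> y \<in> addspan M S"

lemma addspan_mono: "S \<subseteq> addspan M T \<Longrightarrow> addspan M S \<subseteq> addspan M T"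
proof
  fix x assume "S \<subseteq> addspan M T" "x \<in> addspan M S"
  from this(2,1) show "x \<in> addspan M T"
    by (induction rule: addspan.induct) (auto intro: addspan.intros)
qed

lemma (in left_module) addspan_closed:
  assumes "S \<subseteq> carrier M" "x \<in> addspan M S"
  shows "x \<in> carrier M"
  using assms(2,1) by induction auto

lemma (in left_module) addspan_smult:
  assumes "S \<subseteq> carrier M" "a \<in> carrier R" "\<And>x. x \<in> S \<Longrightarrow> a \<odot>\<^bsub>M\<^esub> x \<in> addspan M S'"
    and "x \<in> addspan M S"
  shows "a \<odot>\<^bsub>M\<^esub> x \<in> addspan M S'"
  using assms(4)
proof induction
  case zero
  then show ?case using assms(2) by (simp add: smult_zero_right addspan.zero)
next
  case (add x y)
  then show ?case
    using assms(1,2) by (simp add: smult_r_distr addspan_closed addspan.add)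
qed (use assms in auto)

lemma oper_ring_simps [simp]:
  "carrier (oper_ring A) = A" "mult (oper_ring A) = (\<circ>)" "one (oper_ring A) = id"
  "zero (oper_ring A) = (\<lambda>p. 0)" "add (oper_ring A) = (\<lambda>d e p. d p + e p)"
  by (simp_all add: oper_ring_def)

definition shift :: "'i oper \<Rightarrow> complex \<Rightarrow> 'i oper" where
  "shift T c = (\<lambda>p. T p - scal c p)"

text \<open>The product of the factors T - c over the list, that is, a monic polynomial in T given
  by its roots. Lists record multiplicities, and appending them multiplies the polynomials.\<close>

definition lp :: "'i oper \<Rightarrow> complex list \<Rightarrow> 'i oper" where
  "lp T cs = foldr (\<lambda>c d. shift T c \<circ> d) cs id"

lemma lp_simps: "lp T [] = id" "lp T (c # cs) = shift T c \<circ> lp T cs"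
  by (simp_all add: lp_def)

lemma lp_append: "lp T (cs @ ds) = lp T cs \<circ> lp T ds"
  by (induction cs) (auto simp: lp_simps)

lemma lp_replicate: "lp T (replicate N c) = shift T c ^^ N"
  by (induction N) (auto simp: lp_simps)

lemma shift_in_weyl: "T \<in> weyl \<Longrightarrow> shift T c \<in> weyl"
  using weyl_add[of T "scal (- c)"] by (simp add: shift_def scal_minus_left)

lemma lp_in_weyl: "T \<in> weyl \<Longrightarrow> lp T cs \<in> weyl"
proof (induction cs)
  case (Cons c cs)
  then show ?case unfolding lp_simps by (intro weyl_comp shift_in_weyl)
qed (use weyl_gen(3)[of 1] in \<open>simp add: lp_simps scal_one\<close>)

text \<open>The hypothesis says T d = d (T + k), so moving \<open>d\<close> to the left of a factor
  lowers its root by k. For a product of factors the roots are translated simultaneously.\<close>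

lemma shift_intertwine:
  assumes "d \<in> weyl" "\<And>p. T (d p) = d (T p) + scal k (d p)"
  shows "shift T (k + c) \<circ> d = d \<circ> shift T c"
  using assms by (auto simp: shift_def weyl_minus weyl_scal scal_add_left)

lemma lp_intertwine:
  assumes "d \<in> weyl" "\<And>p. T (d p) = d (T p) + scal k (d p)"
  shows "lp T (map ((+) k) cs) \<circ> d = d \<circ> lp T cs"
proof (induction cs)
  case (Cons c cs)
  then show ?case using shift_intertwine[OF assms]
    by (auto simp: lp_simps fun_eq_iff)
qed (auto simp: lp_simps)

lemma lp_commute:
  assumes "d \<in> weyl" "\<And>p. T (d p) = d (T p)"
  shows "lp T cs \<circ> d = d \<circ> lp T cs"
proof -
  have "map ((+) 0) cs = cs" by (induction cs) auto
  then show ?thesis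
    using lp_intertwine[of d T 0 cs] assms by (simp add: scal_zero_left)
qed

lemma lp_lp_commute: "T \<in> weyl \<Longrightarrow> lp T cs \<circ> lp T ds = lp T ds \<circ> lp T cs"
proof (rule lp_commute[OF lp_in_weyl])
  fix p assume "T \<in> weyl"
  then show "T (lp T ds p) = lp T ds (T p)"
    using lp_commute[of T T ds] by (simp add: fun_eq_iff)
qed

text \<open>One setting for modules over \<open>weyl\<close> and over \<open>weylE\<close>. The
  lower bound on \<open>A\<close> supplies the scalars, \<open>theta\<close> and
  \<open>euler\<close>; the upper bound makes each operator linear.\<close>

locale opmod = left_module "oper_ring A" M
  for A :: "('i :: finite) oper set" and M :: "('i oper, 'v) module" (structure) +
  assumes weylE_sub: "weylE \<subseteq> A" and sub_weyl: "A \<subseteq> weyl"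
begin

lemma act_closed [simp]: "d \<in> A \<Longrightarrow> m \<in> carrier M \<Longrightarrow> d \<odot> m \<in> carrier M"
  using smult_closed by simp

lemma act_comp [simp]: "d \<in> A \<Longrightarrow> e \<in> A \<Longrightarrow> m \<in> carrier M \<Longrightarrow> (d \<circ> e) \<odot> m = d \<odot> (e \<odot> m)"
  using smult_assoc by simp

lemma act_commute:
  assumes "d \<in> A" "e \<in> A" "\<And>p. d (e p) = e (d p)" "m \<in> carrier M"
  shows "d \<odot> (e \<odot> m) = e \<odot> (d \<odot> m)"
proof -
  have "d \<circ> e = e \<circ> d" using assms(3) by auto
  then show ?thesis using act_comp assms by metis
qed

lemma act_add: "d \<in> A \<Longrightarrow> e \<in> A \<Longrightarrow> m \<in> carrier M \<Longrightarrow> (\<lambda>p. d p + e p) \<odot> m = d \<odot> m \<oplus> e \<odot> m"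
  using smult_l_distr by simp

lemma act_add_right: "d \<in> A \<Longrightarrow> m \<in> carrier M \<Longrightarrow> m' \<in> carrier M \<Longrightarrow> d \<odot> (m \<oplus> m') = d \<odot> m \<oplus> d \<odot> m'"
  using smult_r_distr by simp

lemma act_id [simp]: "m \<in> carrier M \<Longrightarrow> id \<odot> m = m"
  using smult_one by simp

lemma act_zero [simp]: "d \<in> A \<Longrightarrow> d \<odot> \<zero> = \<zero>" "m \<in> carrier M \<Longrightarrow> (\<lambda>p. 0) \<odot> m = \<zero>"
  using smult_zero_right smult_zero_left by simp_all

lemma act_minus: "d \<in> A \<Longrightarrow> m \<in> carrier M \<Longrightarrow> d \<odot> (\<ominus> m) = \<ominus> (d \<odot> m)"
  using smult_minus_right by simp

lemma A_weyl: "d \<in> A \<Longrightarrow> d \<in> weyl"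
  using sub_weyl by blast

lemma A_add: "d \<in> A \<Longrightarrow> e \<in> A \<Longrightarrow> (\<lambda>p. d p + e p) \<in> A"
  using R.a_closed by simp

lemma A_comp [simp]: "d \<in> A \<Longrightarrow> e \<in> A \<Longrightarrow> d \<circ> e \<in> A"
  using R.m_closed by simp

lemma A_basic [simp]: "scal c \<in> A" "theta i \<in> A" "euler \<in> A" "id \<in> A"
  using weylE_sub scal_in_weylE theta_in_weylE euler_in_weylE R.one_closed by auto

lemma scal_act_scal [simp]: "m \<in> carrier M \<Longrightarrow> scal c \<odot> (scal d \<odot> m) = scal (c * d) \<odot> m"
  by (subst act_comp[symmetric]) (simp_all add: comp_def scal_scal)

lemma scal_one_act [simp]: "m \<in> carrier M \<Longrightarrow> scal 1 \<odot> m = m"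
  by (simp add: scal_one)

lemma scal_zero_act [simp]: "m \<in> carrier M \<Longrightarrow> scal 0 \<odot> m = \<zero>"
  by (simp add: scal_zero_left)

lemma scal_add_act: "m \<in> carrier M \<Longrightarrow> scal (c + d) \<odot> m = scal c \<odot> m \<oplus> scal d \<odot> m"
  by (simp add: act_add[symmetric] scal_add_left[symmetric])

lemma scal_minus_act: "m \<in> carrier M \<Longrightarrow> scal (- c) \<odot> m = \<ominus> (scal c \<odot> m)"
  using scal_add_act[of m "- c" c] by (simp add: M.minus_equality)

lemma scal_act_comm: "d \<in> A \<Longrightarrow> m \<in> carrier M \<Longrightarrow> d \<odot> (scal c \<odot> m) = scal c \<odot> (d \<odot> m)"
  using act_commute[of d "scal c" m] weyl_scal[OF A_weyl] by simp

lemma scal_act_zeroD: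
  assumes "m \<in> carrier M" "scal c \<odot> m = \<zero>" "c \<noteq> 0"
  shows "m = \<zero>"
proof -
  have "m = scal (1 / c) \<odot> (scal c \<odot> m)" using assms(1,3) by simp
  then show ?thesis using assms(2) by simp
qed

lemma A_shift [simp]: "T \<in> A \<Longrightarrow> shift T c \<in> A"
  using A_add[of T "scal (- c)"] by (simp add: shift_def scal_minus_left)

lemma A_lp [simp]: "T \<in> A \<Longrightarrow> lp T cs \<in> A"
  by (induction cs) (simp_all add: lp_simps)

lemma lp_Nil_act [simp]: "m \<in> carrier M \<Longrightarrow> lp T [] \<odot> m = m"
  by (simp add: lp_simps)

lemma lp_Cons_act [simp]:
  "T \<in> A \<Longrightarrow> m \<in> carrier M \<Longrightarrow> lp T (c # cs) \<odot> m = shift T c \<odot> (lp T cs \<odot> m)"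
  unfolding lp_simps by (intro act_comp) simp_all

lemma lp_append_act:
  "T \<in> A \<Longrightarrow> m \<in> carrier M \<Longrightarrow> lp T (cs @ ds) \<odot> m = lp T cs \<odot> (lp T ds \<odot> m)"
  unfolding lp_append by (intro act_comp) simp_all

lemma lp_lp_act:
  "T \<in> A \<Longrightarrow> m \<in> carrier M \<Longrightarrow> lp T cs \<odot> (lp T ds \<odot> m) = lp T ds \<odot> (lp T cs \<odot> m)"
  using lp_lp_commute[of T cs ds] A_weyl by (intro act_commute) (auto simp: fun_eq_iff)

lemma shift_act: "T \<in> A \<Longrightarrow> m \<in> carrier M \<Longrightarrow> shift T c \<odot> m = T \<odot> m \<ominus> scal c \<odot> m"
  using act_add[of T "scal (- c)"] by (simp add: shift_def scal_minus_left scal_minus_act M.minus_eq)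

lemma shift_act_zero:
  assumes "T \<in> A" "m \<in> carrier M"
  shows "shift T c \<odot> m = \<zero> \<longleftrightarrow> T \<odot> m = scal c \<odot> m"
  using assms by (simp add: shift_act M.minus_eq_zero_iff)

lemma lp_commute_act:
  assumes "T \<in> A" "d \<in> A" "\<And>p. T (d p) = d (T p)" "m \<in> carrier M"
  shows "lp T cs \<odot> (d \<odot> m) = d \<odot> (lp T cs \<odot> m)"
  using lp_commute[of d T cs] assms A_weyl by (intro act_commute) (auto simp: fun_eq_iff)

text \<open>A polynomial in T acts on an eigenvector by its value at the eigenvalue.\<close>

lemma lp_eigen:
  assumes "T \<in> A" "m \<in> carrier M" "T \<odot> m = scal c \<odot> m"
  shows "lp T ds \<odot> m = scal (\<Prod>d\<leftarrow>ds. c - d) \<odot> m"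
proof (induction ds)
  case (Cons d ds)
  let ?q = "\<Prod>d\<leftarrow>ds. c - d"
  have "lp T (d # ds) \<odot> m = scal ?q \<odot> (shift T d \<odot> m)"
    using assms Cons by (simp add: scal_act_comm)
  also have "shift T d \<odot> m = scal (c + - d) \<odot> m"
    unfolding scal_add_act[OF assms(2)] scal_minus_act[OF assms(2)] using assms
    by (simp add: shift_act M.minus_eq)
  finally show ?case using assms by (simp add: mult.commute)
qed (use assms in simp)

end

text \<open>For \<open>X = {c}\<close> this is the generalized eigenspace of \<open>T\<close>.  Disjoint sets \<open>X\<close> give subspaces with
  intersection zero, without decomposing the elements into generalized eigenvectors.\<close>

definition kset :: "('i oper, 'v) module \<Rightarrow> 'i oper \<Rightarrow> complex set \<Rightarrow> 'v set" where
  "kset M T X = {m \<in> carrier M. \<exists>cs. set cs \<subseteq> X \<and> lp T cs \<odot>\<^bsub>M\<^esub> m = \<zero>\<^bsub>M\<^esub>}"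

lemma ksetI: "m \<in> carrier M \<Longrightarrow> set cs \<subseteq> X \<Longrightarrow> lp T cs \<odot>\<^bsub>M\<^esub> m = \<zero>\<^bsub>M\<^esub> \<Longrightarrow> m \<in> kset M T X"
  by (auto simp: kset_def)

lemma kset_mono: "X \<subseteq> Y \<Longrightarrow> kset M T X \<subseteq> kset M T Y"
  by (auto simp: kset_def)

lemma kset_carrier: "m \<in> kset M T X \<Longrightarrow> m \<in> carrier M"
  by (auto simp: kset_def)

context opmod begin

lemma lp_append_zero:
  assumes "T \<in> A" "m \<in> carrier M" "lp T cs \<odot> m = \<zero> \<or> lp T ds \<odot> m = \<zero>"
  shows "lp T (cs @ ds) \<odot> m = \<zero>"
  using assms lp_lp_act[of T m cs ds] by (auto simp: lp_append_act)

lemma kset_zero: "\<zero> \<in> kset M T X"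
  by (rule ksetI[of _ _ "[]"]) auto

lemma kset_add:
  assumes "T \<in> A" "m \<in> kset M T X" "m' \<in> kset M T X"
  shows "m \<oplus> m' \<in> kset M T X"
proof -
  from assms obtain cs ds where cs: "m \<in> carrier M" "set cs \<subseteq> X" "lp T cs \<odot> m = \<zero>"
    and ds: "m' \<in> carrier M" "set ds \<subseteq> X" "lp T ds \<odot> m' = \<zero>"
    by (auto simp: kset_def)
  show ?thesis
    using cs ds assms(1)
    by (intro ksetI[of _ _ "cs @ ds"]) (auto simp: act_add_right lp_append_zero)
qed

lemma kset_intertwine:
  assumes "T \<in> A" "d \<in> A" "\<And>p. T (d p) = d (T p) + scal k (d p)" "m \<in> kset M T X"
  shows "d \<odot> m \<in> kset M T ((+) k ` X)"
proof -
  from assms obtain cs where cs: "m \<in> carrier M" "set cs \<subseteq> X" "lp T cs \<odot> m = \<zero>"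
    by (auto simp: kset_def)
  have "lp T (map ((+) k) cs) \<odot> (d \<odot> m) = (lp T (map ((+) k) cs) \<circ> d) \<odot> m"
    using assms cs by (intro act_comp[symmetric]) simp_all
  also have "\<dots> = d \<odot> (lp T cs \<odot> m)"
    unfolding lp_intertwine[OF A_weyl[OF assms(2)] assms(3)] using assms cs by (intro act_comp) simp_all
  finally show ?thesis
    using cs assms by (intro ksetI[of _ _ "map ((+) k) cs"]) auto
qed

lemma kset_commute:
  assumes "T \<in> A" "d \<in> A" "\<And>p. T (d p) = d (T p)" "m \<in> kset M T X"
  shows "d \<odot> m \<in> kset M T X"
  using kset_intertwine[of T d 0 m X] assms by (simp add: scal_zero_left)

lemma kset_minus:
  assumes "T \<in> A" "m \<in> kset M T X"
  shows "\<ominus> m \<in> kset M T X"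
  using assms by (auto simp: kset_def act_minus)

text \<open>The roots from X are removed one at a time. If T - c kills y, a polynomial with roots in
  Y acts on y by the product of the c - d, which is nonzero; since it also kills y, already y =
  0.\<close>

lemma kset_disjoint:
  assumes "T \<in> A" "m \<in> kset M T X" "m \<in> kset M T Y" "X \<inter> Y = {}"
  shows "m = \<zero>"
proof -
  from assms obtain cs ds where m: "m \<in> carrier M"
    and cs: "set cs \<subseteq> X" "lp T cs \<odot> m = \<zero>" and ds: "set ds \<subseteq> Y" "lp T ds \<odot> m = \<zero>"
    by (auto simp: kset_def)
  from cs show ?thesis
  proof (induction cs)
    case (Cons c cs)
    let ?y = "lp T cs \<odot> m"
    have y: "?y \<in> carrier M" "T \<odot> ?y = scal c \<odot> ?y"
      using assms(1) m Cons.prems by (simp_all add: shift_act_zero)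
    have "lp T ds \<odot> ?y = lp T cs \<odot> (lp T ds \<odot> m)"
      using assms(1) m by (rule lp_lp_act)
    then have "scal (\<Prod>d\<leftarrow>ds. c - d) \<odot> ?y = \<zero>"
      using assms(1) y ds by (simp add: lp_eigen)
    moreover have "(\<Prod>d\<leftarrow>ds. c - d) \<noteq> 0"
      using ds(1) Cons.prems(1) assms(4) by (auto simp: prod_list_zero_iff)
    ultimately have "?y = \<zero>" using y scal_act_zeroD by blast
    then show ?case using Cons by auto
  qed (use m in simp)
qed

text \<open>T is invertible on a generalized eigenspace for a nonzero eigenvalue. The subspace
  \<open>W\<close> is carried along so that the preimage keeps the weight of
  \<open>m\<close>.\<close>

lemma kset_surj:
  assumes T: "T \<in> A" and W: "W \<subseteq> carrier M" "\<And>x y. x \<in> W \<Longrightarrow> y \<in> W \<Longrightarrow> x \<oplus> y \<in> W"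
    "\<And>c x. x \<in> W \<Longrightarrow> scal c \<odot> x \<in> W" "\<And>x. x \<in> W \<Longrightarrow> T \<odot> x \<in> W"
    and m: "m \<in> W" "m \<in> kset M T {c}" and "c \<noteq> 0"
  shows "\<exists>u\<in>W. T \<odot> u = m"
proof -
  from m obtain cs where "set cs \<subseteq> {c}" "lp T cs \<odot> m = \<zero>" by (auto simp: kset_def)
  then show ?thesis using m(1)
  proof (induction cs arbitrary: m)
    case Nil
    then have "m = \<zero>" using W(1) by (metis lp_Nil_act subsetD)
    then show ?case using T Nil by (intro bexI[of _ \<zero>]) auto
  next
    case (Cons b cs)
    have mc: "m \<in> carrier M" using Cons.prems W by blast
    have b: "b = c" using Cons.prems by simp
    let ?m = "shift T c \<odot> m"
    have m': "?m = T \<odot> m \<oplus> scal (- c) \<odot> m"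
      using T mc by (simp add: shift_act M.minus_eq scal_minus_act)
    then have "?m \<in> W" using W Cons.prems by simp
    moreover have "lp T cs \<odot> ?m = lp T (b # cs) \<odot> m"
      using lp_lp_act[OF T mc, of cs "[c]"] T mc b by simp
    ultimately obtain u where u: "u \<in> W" "T \<odot> u = ?m"
      using Cons.IH[of ?m] Cons.prems by auto
    have uc: "u \<in> carrier M" using u W by blast
    \<comment> \<open>From T u = (T - c) m it follows that T (m - u) = c m, so (m - u) / c is the
      preimage.\<close>
    let ?u = "scal (1 / c) \<odot> (m \<oplus> scal (- 1) \<odot> u)"
    have "T \<odot> ?u = scal (1 / c) \<odot> (T \<odot> m \<oplus> \<ominus> (T \<odot> u))"
      using T mc uc by (simp add: scal_act_comm act_add_right scal_minus_act act_minus)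
    also have "T \<odot> u = T \<odot> m \<oplus> scal (- c) \<odot> m" using u(2) m' by simp
    also have "T \<odot> m \<oplus> \<ominus> (T \<odot> m \<oplus> scal (- c) \<odot> m) = scal c \<odot> m"
      using T mc by (simp add: M.minus_add scal_minus_act M.a_assoc[symmetric] M.r_neg)
    also have "scal (1 / c) \<odot> (scal c \<odot> m) = m" using \<open>c \<noteq> 0\<close> mc by simp
    finally show ?case using W u Cons.prems by blast
  qed
qed

end

section \<open>Weight decompositions\<close>

definition dtheta :: "'i \<Rightarrow> 'i \<Rightarrow> 'i oper" where
  "dtheta i j = (\<lambda>p. tmul i (del i p) - tmul j (del j p))"

lemma lookup_dtheta [simp]:
  "Poly_Mapping.lookup (dtheta i j p) m =
    (of_nat (Poly_Mapping.lookup m i) - of_nat (Poly_Mapping.lookup m j)) * Poly_Mapping.lookup p m"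
  using lookup_theta[of i p m] lookup_theta[of j p m]
  by (simp add: dtheta_def lookup_minus theta_def algebra_simps)

lemma dtheta_in_weylE: "dtheta i j \<in> weylE"
proof -
  have "dtheta i j = (\<lambda>p. theta i p + (scal (- 1) \<circ> theta j) p)"
    by (intro ext poly_mapping_eqI) (simp add: lookup_add algebra_simps)
  then show ?thesis
    using weylE_add[of "theta i" "scal (- 1) \<circ> theta j"] weylE_comp theta_in_weylE scal_in_weylE
    by metis
qed

lemma Hprime_eq: "Hprime = gen_algebra {dtheta i j | i j. True}"
  by (simp add: Hprime_def dtheta_def)

text \<open>The generators are diagonal on monomials, and diagonal operators form an algebra.
  Commutativity of \<open>Hprime\<close> is used through this description.\<close>

lemma Hprime_diagonal:
  "d \<in> Hprime \<Longrightarrow> \<exists>h. \<forall>p m. Poly_Mapping.lookup (d p) m = h m * Poly_Mapping.lookup p m"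
  unfolding Hprime_eq
proof (induction rule: gen_algebra.induct)
  case (scal c)
  then show ?case by (intro exI[of _ "\<lambda>_. c"]) simp
next
  case (incl d)
  then show ?case by auto
next
  case (add d e)
  then obtain h k where "\<forall>p m. Poly_Mapping.lookup (d p) m = h m * Poly_Mapping.lookup p m"
    "\<forall>p m. Poly_Mapping.lookup (e p) m = k m * Poly_Mapping.lookup p m" by blast
  then show ?case by (intro exI[of _ "\<lambda>m. h m + k m"]) (simp add: lookup_add algebra_simps)
next
  case (comp d e)
  then obtain h k where "\<forall>p m. Poly_Mapping.lookup (d p) m = h m * Poly_Mapping.lookup p m"
    "\<forall>p m. Poly_Mapping.lookup (e p) m = k m * Poly_Mapping.lookup p m" by blast
  then show ?case by (intro exI[of _ "\<lambda>m. h m * k m"]) simp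
qed

lemma dtheta_Hprime_commute: "d \<in> Hprime \<Longrightarrow> dtheta i j (d p) = d (dtheta i j p)"
  using Hprime_diagonal[of d] by (auto intro!: poly_mapping_eqI)

lemma theta_dtheta_commute: "theta k (dtheta i j p) = dtheta i j (theta k p)"
  by (intro poly_mapping_eqI) simp

lemma Hprime_weylE: "d \<in> Hprime \<Longrightarrow> d \<in> weylE"
  unfolding Hprime_eq
  by (induction rule: gen_algebra.induct)
    (auto intro: scal_in_weylE dtheta_in_weylE weylE_add weylE_comp simp del: o_apply)

lemma Hprime_gens: "scal c \<in> Hprime" "dtheta i j \<in> Hprime"
  unfolding Hprime_eq by (auto intro: gen_algebra.intros)

lemma gen_weight_space_lp: "gen_weight_space M \<mu> = {m \<in> carrier M. \<exists>N>0. \<forall>i.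
     lp (theta i) (replicate N (\<mu> i)) \<odot>\<^bsub>M\<^esub> m = \<zero>\<^bsub>M\<^esub>}"
  by (simp add: gen_weight_space_def lp_replicate shift_def theta_def)

context opmod begin

text \<open>There are finitely many indices, so nilpotency exponents chosen for each one can be
  raised to a common bound. The description by \<open>kset\<close> treats the coordinates
  separately.\<close>

lemma gws_iff:
  "m \<in> gen_weight_space M \<mu> \<longleftrightarrow> m \<in> carrier M \<and> (\<forall>i. m \<in> kset M (theta i) {\<mu> i})"
proof
  assume "m \<in> gen_weight_space M \<mu>"
  then obtain N where N: "m \<in> carrier M" "\<forall>i. lp (theta i) (replicate N (\<mu> i)) \<odot> m = \<zero>"
    by (auto simp: gen_weight_space_lp)
  then show "m \<in> carrier M \<and> (\<forall>i. m \<in> kset M (theta i) {\<mu> i})"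
    by (auto intro!: ksetI[where cs = "replicate N (\<mu> i)" for i])
next
  assume m: "m \<in> carrier M \<and> (\<forall>i. m \<in> kset M (theta i) {\<mu> i})"
  then have "\<forall>i. \<exists>cs. set cs \<subseteq> {\<mu> i} \<and> lp (theta i) cs \<odot> m = \<zero>" by (auto simp: kset_def)
  then obtain cs where cs: "\<And>i. set (cs i) \<subseteq> {\<mu> i}" "\<And>i. lp (theta i) (cs i) \<odot> m = \<zero>" by metis
  \<comment> \<open>A sum bounds all the lengths at once; \<open>Suc\<close> secures the strict
    positivity demanded by \<open>gen_weight_space\<close>.\<close>
  define N where "N = Suc (\<Sum>i\<in>UNIV. length (cs i))"
  have "lp (theta i) (replicate N (\<mu> i)) \<odot> m = \<zero>" for i
  proof -
    have "length (cs i) \<le> N"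
      using member_le_sum[of i UNIV "\<lambda>i. length (cs i)"] by (simp add: N_def)
    moreover have "cs i = replicate (length (cs i)) (\<mu> i)"
      using cs(1)[of i] by (metis replicate_eqI subsetD singletonD)
    ultimately have "replicate N (\<mu> i) = replicate (N - length (cs i)) (\<mu> i) @ cs i"
      by (metis replicate_add le_add_diff_inverse2)
    then show ?thesis using lp_append_zero[of "theta i" m _ "cs i"] cs(2) m by simp
  qed
  then show "m \<in> gen_weight_space M \<mu>"
    using m unfolding gen_weight_space_lp by (auto intro!: exI[of _ N]) (simp add: N_def)
qed

lemma gws_carrier: "m \<in> gen_weight_space M \<mu> \<Longrightarrow> m \<in> carrier M"
  by (simp add: gws_iff)

lemma gws_zero: "\<zero> \<in> gen_weight_space M \<mu>"
  by (simp add: gws_iff kset_zero)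

lemma gws_add: "m \<in> gen_weight_space M \<mu> \<Longrightarrow> m' \<in> gen_weight_space M \<mu> \<Longrightarrow> m \<oplus> m' \<in> gen_weight_space M \<mu>"
  by (simp add: gws_iff kset_add)

lemma gws_commute:
  assumes "d \<in> A" "\<And>i p. theta i (d p) = d (theta i p)" "m \<in> gen_weight_space M \<mu>"
  shows "d \<odot> m \<in> gen_weight_space M \<mu>"
  using assms by (simp add: gws_iff kset_commute)

lemma gws_scal: "m \<in> gen_weight_space M \<mu> \<Longrightarrow> scal c \<odot> m \<in> gen_weight_space M \<mu>"
  by (rule gws_commute) (simp_all add: weyl_scal theta_in_weyl)

lemma gws_theta: "m \<in> gen_weight_space M \<mu> \<Longrightarrow> theta i \<odot> m \<in> gen_weight_space M \<mu>"
  by (rule gws_commute) (simp_all add: theta_comm)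

lemma act_finsum:
  assumes "d \<in> A" "finite S" "f \<in> S \<rightarrow> carrier M"
  shows "d \<odot> finsum M f S = finsum M (\<lambda>x. d \<odot> f x) S"
  using assms(2,3)
proof (induction S rule: finite_induct)
  case (insert x S)
  then have "f x \<in> carrier M" "f \<in> S \<rightarrow> carrier M" by auto
  moreover have "(\<lambda>x. d \<odot> f x) \<in> S \<rightarrow> carrier M"
    using insert.prems assms(1) by (intro Pi_I act_closed) auto
  ultimately show ?case using insert assms(1) by (simp add: M.finsum_insert act_add_right M.finsum_closed)
qed (use assms(1) in simp)

text \<open>A weight \<mu> differs from \<mu>0 in some coordinate i. A polynomial in
  \<open>theta i\<close> that kills the \<mu>0 term leaves a shorter zero sum, so by induction it
  also kills the \<mu> term, which then has both \<mu>0 i and \<mu> i as its only generalized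
  eigenvalue.\<close>

lemma gws_independent:
  assumes "finite S" "\<And>\<mu>. \<mu> \<in> S \<Longrightarrow> f \<mu> \<in> gen_weight_space M \<mu>" "finsum M f S = \<zero>" "\<mu> \<in> S"
  shows "f \<mu> = \<zero>"
  using assms
proof (induction S arbitrary: f \<mu> rule: finite_induct)
  case (insert \<mu>0 S)
  have c: "f \<mu> \<in> carrier M" if "\<mu> \<in> insert \<mu>0 S" for \<mu>
    using insert.prems(1)[OF that] by (rule gws_carrier)
  then have fS: "f \<in> S \<rightarrow> carrier M" and f0: "f \<mu>0 \<in> carrier M" by auto
  have sum0: "f \<mu>0 \<oplus> finsum M f S = \<zero>"
    using insert.prems(2) insert.hyps fS f0 by (simp add: M.finsum_insert)
  have S: "f \<mu> = \<zero>" if \<mu>: "\<mu> \<in> S" for \<mu>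
  proof -
    from \<mu> insert.hyps have "\<mu> \<noteq> \<mu>0" by auto
    then obtain i where i: "\<mu> i \<noteq> \<mu>0 i" by (auto simp: fun_eq_iff)
    have "f \<mu>0 \<in> kset M (theta i) {\<mu>0 i}" using insert.prems(1)[of \<mu>0] by (simp add: gws_iff)
    then obtain cs where cs: "set cs \<subseteq> {\<mu>0 i}" "lp (theta i) cs \<odot> f \<mu>0 = \<zero>"
      by (auto simp: kset_def)
    let ?L = "lp (theta i) cs"
    have "?L \<odot> f \<mu> = \<zero>"
    proof (rule insert.IH[OF _ _ \<mu>])
      show "?L \<odot> f \<mu> \<in> gen_weight_space M \<mu>" if "\<mu> \<in> S" for \<mu>
      proof (rule gws_commute)
        show "theta j (?L p) = ?L (theta j p)" for j p
          using lp_commute[OF theta_in_weyl[of j], of "theta i" cs]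
          by (simp add: theta_comm fun_eq_iff)
      qed (use that insert.prems in auto)
      have "?L \<odot> (f \<mu>0 \<oplus> finsum M f S) = ?L \<odot> f \<mu>0 \<oplus> ?L \<odot> finsum M f S"
        using fS f0 by (intro act_add_right) (auto intro: M.finsum_closed)
      then show "(\<Oplus>\<mu>\<in>S. ?L \<odot> f \<mu>) = \<zero>"
        using cs(2) fS insert.hyps sum0 act_finsum[of ?L S f] M.finsum_closed[OF fS]
        by (metis A_basic(2) A_lp M.l_zero act_closed act_zero(1))
    qed
    then have "f \<mu> \<in> kset M (theta i) {\<mu>0 i}" using cs c[of \<mu>] \<mu> by (auto intro: ksetI)
    moreover have "f \<mu> \<in> kset M (theta i) {\<mu> i}" using insert.prems(1)[of \<mu>] \<mu> by (simp add: gws_iff)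
    ultimately show ?thesis using i kset_disjoint[of "theta i" "f \<mu>"] by auto
  qed
  then have "finsum M f S = \<zero>" by (simp add: M.finsum_cong' M.add.finprod_one_eqI)
  then have "f \<mu>0 = \<zero>" using sum0 f0 by simp
  then show ?case using S insert.prems(3) by auto
qed simp

text \<open>Decompositions are summed over their exact support, which changes when families are
  added; a common finite superset makes them comparable.\<close>

lemma gws_finsum_support:
  assumes "finite S" "{\<mu>. f \<mu> \<noteq> \<zero>} \<subseteq> S" "\<And>\<mu>. f \<mu> \<in> gen_weight_space M \<mu>"
  shows "finsum M f {\<mu>. f \<mu> \<noteq> \<zero>} = finsum M f S"
  using assms gws_carrier by (intro M.add.finprod_mono_neutral_cong_left) auto

lemma addspan_gws:
  assumes "m \<in> addspan M (\<Union>\<mu>\<in>\<Lambda>. gen_weight_space M \<mu>)"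
  shows "\<exists>f. (\<forall>\<mu>. f \<mu> \<in> gen_weight_space M \<mu>) \<and> finite {\<mu>. f \<mu> \<noteq> \<zero>} \<and> {\<mu>. f \<mu> \<noteq> \<zero>} \<subseteq> \<Lambda> \<and>
    m = finsum M f {\<mu>. f \<mu> \<noteq> \<zero>}"
  using assms
proof induction
  case zero
  show ?case by (intro exI[of _ "\<lambda>_. \<zero>"]) (auto simp: gws_zero)
next
  case (incl m)
  then obtain \<mu> where \<mu>: "\<mu> \<in> \<Lambda>" "m \<in> gen_weight_space M \<mu>" by blast
  let ?f = "\<lambda>\<nu>. if \<nu> = \<mu> then m else \<zero>"
  have f: "?f \<nu> \<in> gen_weight_space M \<nu>" for \<nu> using \<mu> by (simp add: gws_zero)
  have "finsum M ?f {\<nu>. ?f \<nu> \<noteq> \<zero>} = finsum M ?f {\<mu>}"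
    using f by (intro gws_finsum_support) auto
  also have "\<dots> = m" using \<mu> gws_carrier by (simp add: M.finsum_insert)
  finally have "m = finsum M ?f {\<nu>. ?f \<nu> \<noteq> \<zero>}" by simp
  moreover have "finite {\<nu>. ?f \<nu> \<noteq> \<zero>}" by (rule finite_subset[of _ "{\<mu>}"]) auto
  ultimately show ?case using f \<mu>(1) by (intro exI[of _ ?f]) auto
next
  case (add m m')
  then obtain f g where f: "\<And>\<mu>. f \<mu> \<in> gen_weight_space M \<mu>" "finite {\<mu>. f \<mu> \<noteq> \<zero>}" "{\<mu>. f \<mu> \<noteq> \<zero>} \<subseteq> \<Lambda>"
    "m = finsum M f {\<mu>. f \<mu> \<noteq> \<zero>}"
    and g: "\<And>\<mu>. g \<mu> \<in> gen_weight_space M \<mu>" "finite {\<mu>. g \<mu> \<noteq> \<zero>}" "{\<mu>. g \<mu> \<noteq> \<zero>} \<subseteq> \<Lambda>"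
    "m' = finsum M g {\<mu>. g \<mu> \<noteq> \<zero>}" by blast
  let ?S = "{\<mu>. f \<mu> \<noteq> \<zero>} \<union> {\<mu>. g \<mu> \<noteq> \<zero>}" and ?h = "\<lambda>\<mu>. f \<mu> \<oplus> g \<mu>"
  have h: "?h \<mu> \<in> gen_weight_space M \<mu>" for \<mu> using f g by (simp add: gws_add)
  have "f \<mu> \<in> carrier M" "g \<mu> \<in> carrier M" for \<mu> using f(1) g(1) by (auto intro: gws_carrier)
  then have fc: "f \<in> ?S \<rightarrow> carrier M" "g \<in> ?S \<rightarrow> carrier M" by auto
  have S: "finite ?S" "{\<mu>. ?h \<mu> \<noteq> \<zero>} \<subseteq> ?S" using f g by auto
  have "m \<oplus> m' = finsum M f ?S \<oplus> finsum M g ?S"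
    using f g gws_finsum_support[of ?S f] gws_finsum_support[of ?S g] by auto
  also have "\<dots> = finsum M ?h ?S"
    using fc by (rule M.finsum_addf[symmetric])
  also have "\<dots> = finsum M ?h {\<mu>. ?h \<mu> \<noteq> \<zero>}"
    using S h by (intro gws_finsum_support[symmetric]) auto
  finally have "m \<oplus> m' = finsum M ?h {\<mu>. ?h \<mu> \<noteq> \<zero>}" .
  moreover have "finite {\<mu>. ?h \<mu> \<noteq> \<zero>}" using S finite_subset by blast
  moreover have "{\<mu>. ?h \<mu> \<noteq> \<zero>} \<subseteq> \<Lambda>" using S f g by blast
  ultimately show ?case using h by (intro exI[of _ ?h]) auto
qed

text \<open>Spanning suffices because weight spaces are independent: for uniqueness this is applied
  to the difference of two families.\<close>

lemma gen_weight_decompI: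
  assumes "carrier M \<subseteq> addspan M (\<Union>\<mu>\<in>\<Lambda>. gen_weight_space M \<mu>)"
  shows "gen_weight_decomp M" "weight_support M \<subseteq> \<Lambda>"
proof -
  show "gen_weight_decomp M"
    unfolding gen_weight_decomp_def
  proof (intro ballI ex_ex1I)
    fix m assume "m \<in> carrier M"
    then show "\<exists>f. (\<forall>\<mu>. f \<mu> \<in> gen_weight_space M \<mu>) \<and> finite {\<mu>. f \<mu> \<noteq> \<zero>} \<and>
        m = finsum M f {\<mu>. f \<mu> \<noteq> \<zero>}"
      using addspan_gws assms by (meson subsetD)
  next
    fix m f g
    assume "(\<forall>\<mu>. f \<mu> \<in> gen_weight_space M \<mu>) \<and> finite {\<mu>. f \<mu> \<noteq> \<zero>} \<and> m = finsum M f {\<mu>. f \<mu> \<noteq> \<zero>}"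
      and "(\<forall>\<mu>. g \<mu> \<in> gen_weight_space M \<mu>) \<and> finite {\<mu>. g \<mu> \<noteq> \<zero>} \<and> m = finsum M g {\<mu>. g \<mu> \<noteq> \<zero>}"
    then have f: "\<And>\<mu>. f \<mu> \<in> gen_weight_space M \<mu>" "finite {\<mu>. f \<mu> \<noteq> \<zero>}" "m = finsum M f {\<mu>. f \<mu> \<noteq> \<zero>}"
      and g: "\<And>\<mu>. g \<mu> \<in> gen_weight_space M \<mu>" "finite {\<mu>. g \<mu> \<noteq> \<zero>}" "m = finsum M g {\<mu>. g \<mu> \<noteq> \<zero>}"
      by auto
    let ?S = "{\<mu>. f \<mu> \<noteq> \<zero>} \<union> {\<mu>. g \<mu> \<noteq> \<zero>}" and ?h = "\<lambda>\<mu>. f \<mu> \<oplus> scal (- 1) \<odot> g \<mu>"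
    have fc: "f \<in> ?S \<rightarrow> carrier M" and gc: "g \<in> ?S \<rightarrow> carrier M" using f g gws_carrier by auto
    have m: "m = finsum M f ?S" "m = finsum M g ?S"
      using f(3) g(3) gws_finsum_support[of ?S f] gws_finsum_support[of ?S g] f(1,2) g(1,2) by auto
    then have mc: "m \<in> carrier M" using M.finsum_closed[OF fc] by simp
    have "finsum M ?h ?S = finsum M f ?S \<oplus> finsum M (\<lambda>\<mu>. scal (- 1) \<odot> g \<mu>) ?S"
      using fc gc by (intro M.finsum_addf Pi_I act_closed) auto
    also have "finsum M (\<lambda>\<mu>. scal (- 1) \<odot> g \<mu>) ?S = scal (- 1) \<odot> finsum M g ?S"
      using f(2) g(2) gc by (intro act_finsum[symmetric]) auto
    finally have "finsum M ?h ?S = \<zero>" using mc m by (simp add: scal_minus_act M.r_neg)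
    then have h: "?h \<mu> = \<zero>" if "\<mu> \<in> ?S" for \<mu>
      using gws_independent[of ?S ?h \<mu>] f g that by (simp add: gws_add gws_scal)
    show "f = g"
    proof
      fix \<mu>
      have "f \<mu> \<in> carrier M" "g \<mu> \<in> carrier M" using f g gws_carrier by auto
      then show "f \<mu> = g \<mu>"
        using h[of \<mu>] M.minus_eq_zero_iff[of "f \<mu>" "g \<mu>"]
        by (cases "\<mu> \<in> ?S") (auto simp: scal_minus_act M.minus_eq)
    qed
  qed
  show "weight_support M \<subseteq> \<Lambda>"
  proof (rule ccontr)
    assume "\<not> weight_support M \<subseteq> \<Lambda>"
    then obtain \<mu> m where \<mu>: "\<mu> \<notin> \<Lambda>" "m \<in> gen_weight_space M \<mu>" "m \<noteq> \<zero>"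
      using gws_zero by (fastforce simp: weight_support_def)
    then have mc: "m \<in> carrier M" by (auto dest: gws_carrier)
    obtain f where f: "\<And>\<mu>. f \<mu> \<in> gen_weight_space M \<mu>" "finite {\<mu>. f \<mu> \<noteq> \<zero>}"
      "{\<mu>. f \<mu> \<noteq> \<zero>} \<subseteq> \<Lambda>" "m = finsum M f {\<mu>. f \<mu> \<noteq> \<zero>}"
      using addspan_gws[of m \<Lambda>] assms mc by blast
    \<comment> \<open>A weight vector outside \<Lambda> is decomposed inside \<Lambda>; entering its
      negative at its own weight produces a zero sum and contradicts independence.\<close>
    let ?S = "{\<mu>. f \<mu> \<noteq> \<zero>}" and ?h = "f(\<mu> := \<ominus> m)"
    have \<mu>S: "\<mu> \<notin> ?S" using f(3) \<mu>(1) by blast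
    have "\<ominus> m \<in> gen_weight_space M \<mu>" using gws_scal[OF \<mu>(2), of "- 1"] mc by (simp add: scal_minus_act)
    then have h: "?h \<nu> \<in> gen_weight_space M \<nu>" for \<nu> using f(1) by simp
    have "finsum M ?h (insert \<mu> ?S) = ?h \<mu> \<oplus> finsum M ?h ?S"
      using f(2) \<mu>S gws_carrier[OF h] by (intro M.finsum_insert Pi_I) blast+
    also have "finsum M ?h ?S = finsum M f ?S"
      using gws_carrier[OF f(1)] \<mu>S by (intro M.finsum_cong') auto
    also have "?h \<mu> \<oplus> finsum M f ?S = \<zero>" using f(4) mc by (simp add: M.l_neg)
    finally have "?h \<mu> = \<zero>"
      using gws_independent[OF _ h, of "insert \<mu> ?S" \<mu>] f(2) by blast
    then show False using \<mu>(3) mc by simp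
  qed
qed

lemma gen_weight_decompD:
  assumes "gen_weight_decomp M"
  shows "carrier M \<subseteq> addspan M (\<Union>\<mu>\<in>weight_support M. gen_weight_space M \<mu>)"
proof
  let ?A = "addspan M (\<Union>\<mu>\<in>weight_support M. gen_weight_space M \<mu>)"
  fix m assume "m \<in> carrier M"
  then obtain f where f: "\<And>\<mu>. f \<mu> \<in> gen_weight_space M \<mu>" "finite {\<mu>. f \<mu> \<noteq> \<zero>}"
    "m = finsum M f {\<mu>. f \<mu> \<noteq> \<zero>}"
    using assms unfolding gen_weight_decomp_def by metis
  have "f \<mu> \<in> ?A" for \<mu>
  proof (cases "f \<mu> = \<zero>")
    case False
    then have "\<mu> \<in> weight_support M" using f(1)[of \<mu>] by (auto simp: weight_support_def)
    then show ?thesis using f(1)[of \<mu>] by (intro addspan.incl) blast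
  qed (simp add: addspan.zero)
  note f_mem = this
  have "finsum M f S \<in> ?A" if "finite S" for S
    using that
  proof (induction S rule: finite_induct)
    case (insert \<mu> S)
    have "f \<nu> \<in> carrier M" for \<nu> using f(1) by (rule gws_carrier)
    then show ?case using insert f_mem by (simp add: M.finsum_insert addspan.add)
  qed (simp add: addspan.zero)
  then show "m \<in> ?A" using f by simp
qed

end

section \<open>Semisimplicity over the Cartan subalgebra\<close>

text \<open>The vectors of generalized weight \<open>\<mu>\<close> on which \<open>\<H>'\<close> acts semisimply, hence by scalars.\<close>

definition swt :: "('i oper, 'v) module \<Rightarrow> ('i \<Rightarrow> complex) \<Rightarrow> 'v set" where
  "swt M \<mu> = {m \<in> gen_weight_space M \<mu>. \<forall>i j. dtheta i j \<odot>\<^bsub>M\<^esub> m = scal (\<mu> i - \<mu> j) \<odot>\<^bsub>M\<^esub> m}"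

context opmod begin

lemma A_dtheta [simp]: "dtheta i j \<in> A"
  using dtheta_in_weylE weylE_sub by blast

lemma A_Hprime: "d \<in> Hprime \<Longrightarrow> d \<in> A"
  using Hprime_weylE weylE_sub by blast

lemma swt_gws: "m \<in> swt M \<mu> \<Longrightarrow> m \<in> gen_weight_space M \<mu>"
  by (simp add: swt_def)

lemma swt_carrier: "m \<in> swt M \<mu> \<Longrightarrow> m \<in> carrier M"
  by (auto simp: swt_def dest: gws_carrier)

lemma shift_dtheta_act:
  assumes m: "m \<in> carrier M"
  shows "shift (dtheta i j) (a - b) \<odot> m = shift (theta i) a \<odot> m \<oplus> scal (- 1) \<odot> (shift (theta j) b \<odot> m)"
proof -
  have e: "shift (dtheta i j) (a - b) = (\<lambda>p. shift (theta i) a p + (scal (- 1) \<circ> shift (theta j) b) p)"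
    by (intro ext poly_mapping_eqI) (simp add: shift_def lookup_add lookup_minus algebra_simps)
  have "(scal (- 1) \<circ> shift (theta j) b) \<odot> m = scal (- 1) \<odot> (shift (theta j) b \<odot> m)"
    using m by (intro act_comp) simp_all
  then show ?thesis
    unfolding e using act_add[of "shift (theta i) a" "scal (- 1) \<circ> shift (theta j) b" m] m
    by (metis A_basic(1,2) A_comp A_shift)
qed

lemma lp_scal_act: "T \<in> A \<Longrightarrow> m \<in> carrier M \<Longrightarrow> lp T cs \<odot> (scal c \<odot> m) = scal c \<odot> (lp T cs \<odot> m)"
  by (rule scal_act_comm) simp_all

text \<open>A difference of commuting nilpotent operators is nilpotent: each of the two summands of
  \<open>dtheta i j\<close> - (a - b) lowers one exponent, so the induction runs on p + q.\<close>

lemma dtheta_nilpotent: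
  assumes "m \<in> carrier M" "lp (theta i) (replicate p a) \<odot> m = \<zero>" "lp (theta j) (replicate q b) \<odot> m = \<zero>"
  shows "lp (dtheta i j) (replicate (p + q) (a - b)) \<odot> m = \<zero>"
  using assms
proof (induction "p + q" arbitrary: p q m)
  case (Suc n)
  show ?case
  proof (cases "p = 0 \<or> q = 0")
    case True
    then have "m = \<zero>" using Suc.prems by auto
    then show ?thesis by simp
  next
    case False
    then obtain p' q' where p: "p = Suc p'" and q: "q = Suc q'" by (metis not0_implies_Suc)
    let ?D = "lp (dtheta i j) (replicate n (a - b))"
    let ?x = "shift (theta i) a \<odot> m" and ?y = "shift (theta j) b \<odot> m"
    note m = Suc.prems(1)
    have ij: "lp (theta i) cs \<odot> (lp (theta j) ds \<odot> m) = lp (theta j) ds \<odot> (lp (theta i) cs \<odot> m)" for cs ds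
    proof (rule lp_commute_act)
      show "theta i (lp (theta j) ds r) = lp (theta j) ds (theta i r)" for r
        using lp_commute[OF theta_in_weyl[of i], of "theta j" ds] by (simp add: theta_comm fun_eq_iff)
    qed (use m in simp_all)
    have x: "lp (theta i) (replicate p' a) \<odot> ?x = \<zero>" "lp (theta j) (replicate q b) \<odot> ?x = \<zero>"
      using lp_lp_act[of "theta i" m "replicate p' a" "[a]"] ij[of "[a]" "replicate q b"] m Suc.prems(2,3) p
      by simp_all
    have y: "lp (theta j) (replicate q' b) \<odot> ?y = \<zero>" "lp (theta i) (replicate p a) \<odot> ?y = \<zero>"
      using lp_lp_act[of "theta j" m "replicate q' b" "[b]"] ij[of "replicate p a" "[b]"] m Suc.prems(2,3) q
      by simp_all
    have Dx: "?D \<odot> ?x = \<zero>" using Suc.hyps(1)[of p' q ?x] Suc.hyps(2) p x m by simp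
    have Dy: "?D \<odot> ?y = \<zero>" using Suc.hyps(1)[of p q' ?y] Suc.hyps(2) q y m by simp
    have "lp (dtheta i j) (replicate (p + q) (a - b)) \<odot> m = ?D \<odot> (shift (dtheta i j) (a - b) \<odot> m)"
      using lp_lp_act[of "dtheta i j" m "replicate n (a - b)" "[a - b]"] m
      by (simp flip: Suc.hyps(2))
    also have "\<dots> = \<zero>"
      using m Dx Dy by (simp add: shift_dtheta_act act_add_right lp_scal_act)
    finally show ?thesis .
  qed
qed simp

lemma gws_dtheta:
  assumes "m \<in> gen_weight_space M \<mu>"
  shows "m \<in> kset M (dtheta i j) {\<mu> i - \<mu> j}"
proof -
  from assms obtain N where "m \<in> carrier M" "\<forall>i. lp (theta i) (replicate N (\<mu> i)) \<odot> m = \<zero>"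
    by (auto simp: gen_weight_space_lp)
  then show ?thesis
    using dtheta_nilpotent by (intro ksetI[of _ _ "replicate (N + N) (\<mu> i - \<mu> j)"]) auto
qed

lemma addspan_gws_subset_kset:
  assumes "T \<in> A" "\<And>m \<mu>. \<mu> \<in> \<Lambda> \<Longrightarrow> m \<in> gen_weight_space M \<mu> \<Longrightarrow> m \<in> kset M T X"
    and "m \<in> addspan M (\<Union>\<mu>\<in>\<Lambda>. gen_weight_space M \<mu>)"
  shows "m \<in> kset M T X"
  using assms(3)
  by induction (use assms(1,2) in \<open>auto intro: kset_zero kset_add\<close>)

text \<open>Schur's argument: \<open>dtheta i j\<close> has an eigenvector in S, and its eigenspace
  is an \<open>Hprime\<close>-submodule by commutativity, hence all of S. Existence of the
  eigenvector comes from local finiteness instead of finite dimension.\<close>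

lemma simple_submodule_eigen:
  assumes S: "simple_submodule S (oper_ring Hprime) M"
    and k: "carrier M \<subseteq> kset M (dtheta i j) UNIV"
  shows "\<exists>c. \<forall>s\<in>S. dtheta i j \<odot> s = scal c \<odot> s"
proof -
  let ?T = "dtheta i j"
  from S have sub: "submodule S (oper_ring Hprime) M" and ne: "S \<noteq> {\<zero>}"
    and min: "\<And>T. submodule T (oper_ring Hprime) M \<Longrightarrow> T \<subseteq> S \<Longrightarrow> T = {\<zero>} \<or> T = S"
    by (auto simp: simple_submodule_def)
  interpret S: submodule S "oper_ring Hprime" M by (rule sub)
  have Sc: "s \<in> carrier M" if "s \<in> S" for s using S.subset that by auto
  have Sadd: "s \<oplus> t \<in> S" if "s \<in> S" "t \<in> S" for s t using S.m_closed that by simp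
  have Sact: "d \<odot> s \<in> S" if "d \<in> Hprime" "s \<in> S" for d s using S.smult_closed that by simp
  have S0: "\<zero> \<in> S" using S.one_closed by simp
  have Slp: "lp ?T cs \<odot> s \<in> S" if "s \<in> S" for s cs
  proof (induction cs)
    case (Cons c cs)
    have "shift ?T c \<odot> (lp ?T cs \<odot> s) = ?T \<odot> (lp ?T cs \<odot> s) \<oplus> scal (- c) \<odot> (lp ?T cs \<odot> s)"
      using Sc[OF that] by (simp add: shift_act M.minus_eq scal_minus_act)
    then show ?case using Cons Sc[OF that] by (simp add: Sadd Sact Hprime_gens)
  qed (use that Sc in simp)
  obtain v where v: "v \<in> S" "v \<noteq> \<zero>" using ne S0 by blast
  obtain cs where "lp ?T cs \<odot> v = \<zero>" using k Sc[OF v(1)] by (auto simp: kset_def)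
  \<comment> \<open>Applying the factors successively to \<open>v\<close>, the last nonzero vector
    before reaching zero is the eigenvector.\<close>
  then have "\<exists>c y. y \<in> S \<and> y \<noteq> \<zero> \<and> ?T \<odot> y = scal c \<odot> y"
  proof (induction cs)
    case (Cons c cs)
    show ?case
    proof (cases "lp ?T cs \<odot> v = \<zero>")
      case False
      have "?T \<odot> (lp ?T cs \<odot> v) = scal c \<odot> (lp ?T cs \<odot> v)"
        using Cons.prems Sc[OF v(1)] by (simp add: shift_act_zero)
      then show ?thesis using False Slp[OF v(1)] by blast
    qed (rule Cons.IH)
  qed (use v Sc in simp)
  then obtain c y where y: "y \<in> S" "y \<noteq> \<zero>" "?T \<odot> y = scal c \<odot> y" by blast
  let ?U = "{s \<in> S. ?T \<odot> s = scal c \<odot> s}"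
  have "submodule ?U (oper_ring Hprime) M"
  proof (intro submodule.intro subgroup.intro submodule_axioms.intro)
    show "?U \<subseteq> carrier (add_monoid M)" using Sc by auto
    show "x \<otimes>\<^bsub>add_monoid M\<^esub> z \<in> ?U" if "x \<in> ?U" "z \<in> ?U" for x z
      using that by (auto simp: Sadd act_add_right Sc)
    show "\<one>\<^bsub>add_monoid M\<^esub> \<in> ?U" using S0 by simp
    show "inv\<^bsub>add_monoid M\<^esub> x \<in> ?U" if "x \<in> ?U" for x
    proof -
      have "inv\<^bsub>add_monoid M\<^esub> x = \<ominus> x" by (simp add: a_inv_def)
      moreover have "\<ominus> x \<in> S" using S.m_inv_closed[of x] that by (simp add: a_inv_def)
      ultimately show ?thesis using that Sc by (simp add: act_minus)
    qed
    show "d \<odot> x \<in> ?U" if "d \<in> carrier (oper_ring Hprime)" "x \<in> ?U" for d x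
    proof -
      have d: "d \<in> Hprime" using that by simp
      then have "?T \<odot> (d \<odot> x) = d \<odot> (?T \<odot> x)"
        using that Sc by (intro act_commute) (auto simp: A_Hprime dtheta_Hprime_commute)
      then show ?thesis using that Sc by (auto simp: Sact d A_Hprime scal_act_comm)
    qed
  qed
  then have "?U = {\<zero>} \<or> ?U = S" by (rule min) auto
  then show ?thesis using y by blast
qed

text \<open>Semisimplicity writes \<open>m\<close> as a sum of eigenvectors of
  \<open>dtheta i j\<close>. Those with eigenvalue different from \<mu> i - \<mu> j add up to an r
  that, as a difference of elements with this generalized eigenvalue, must vanish; so
  \<open>m\<close> is a genuine eigenvector.\<close>

lemma semisimple_gws:
  assumes "gen_weight_decomp M" "semisimple_module (oper_ring Hprime) M"
    and m: "m \<in> gen_weight_space M \<mu>"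
  shows "m \<in> swt M \<mu>"
proof -
  have "dtheta i j \<odot> m = scal (\<mu> i - \<mu> j) \<odot> m" for i j
  proof -
    let ?T = "dtheta i j" and ?c = "\<mu> i - \<mu> j"
    let ?G = "\<Union>c. {m \<in> carrier M. ?T \<odot> m = scal c \<odot> m}"
    have k: "carrier M \<subseteq> kset M ?T UNIV"
    proof
      fix x assume "x \<in> carrier M"
      then have "x \<in> addspan M (\<Union>\<mu>\<in>weight_support M. gen_weight_space M \<mu>)"
        using gen_weight_decompD[OF assms(1)] by blast
      then show "x \<in> kset M ?T UNIV"
      proof (rule addspan_gws_subset_kset[rotated 2])
        show "y \<in> kset M ?T UNIV" if "y \<in> gen_weight_space M \<mu>" for y \<mu>
          using gws_dtheta[OF that, of i j] kset_mono[of _ UNIV M ?T] by blast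
      qed simp
    qed
    have "x \<in> addspan M ?G" if "x \<in> carrier M" for x
    proof -
      have sub: "S \<subseteq> ?G" if "simple_submodule S (oper_ring Hprime) M" for S
      proof -
        have "S \<subseteq> carrier M"
          using that subgroup.subset[OF submodule.axioms(1)] by (fastforce simp: simple_submodule_def)
        then show ?thesis using simple_submodule_eigen[OF that k] by blast
      qed
      have "x \<in> generate (add_monoid M) (\<Union>{S. simple_submodule S (oper_ring Hprime) M})"
        using assms(2) that by (simp add: semisimple_module_def)
      then show ?thesis
      proof induction
        case one
        then show ?case using addspan.zero[of M] by simp
      next
        case (incl h)
        then show ?case using sub by (blast intro: addspan.incl)
      next
        case (inv h)
        then obtain c where h: "h \<in> carrier M" "?T \<odot> h = scal c \<odot> h" using sub by blast
        then have "?T \<odot> (\<ominus> h) = scal c \<odot> (\<ominus> h)" by (simp add: act_minus)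
        then have "\<ominus> h \<in> ?G" using h by auto
        then show ?case by (simp add: a_inv_def addspan.incl)
      next
        case (eng h h')
        then show ?case using addspan.add[of h M ?G h'] by simp
      qed
    qed
    \<comment> \<open>The eigenvectors are grouped by whether their eigenvalue is \<open>?c\<close>;
      \<open>r\<close> collects all the others, whose roots avoid \<open>?c\<close>.\<close>
    moreover have "\<exists>y r. y \<in> carrier M \<and> ?T \<odot> y = scal ?c \<odot> y \<and> r \<in> kset M ?T (- {?c}) \<and> x = y \<oplus> r"
      if "x \<in> addspan M ?G" for x
      using that
    proof induction
      case zero
      then show ?case by (intro exI[of _ \<zero>]) (simp add: kset_zero)
    next
      case (incl x)
      then obtain c where c: "x \<in> carrier M" "?T \<odot> x = scal c \<odot> x" by blast
      show ?case
      proof (cases "c = ?c")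
        case True
        then show ?thesis using c by (intro exI[of _ x] exI[of _ \<zero>]) (simp add: kset_zero)
      next
        case False
        then have "x \<in> kset M ?T (- {?c})"
          using c by (intro ksetI[of _ _ "[c]"]) (auto simp: shift_act_zero)
        then show ?thesis using c by (intro exI[of _ \<zero>] exI[of _ x]) simp
      qed
    next
      case (add x x')
      then obtain y r y' r' where y: "y \<in> carrier M" "?T \<odot> y = scal ?c \<odot> y" "r \<in> kset M ?T (- {?c})" "x = y \<oplus> r"
        and y': "y' \<in> carrier M" "?T \<odot> y' = scal ?c \<odot> y'" "r' \<in> kset M ?T (- {?c})" "x' = y' \<oplus> r'"
        by blast
      then have "r \<in> carrier M" "r' \<in> carrier M" by (auto dest: kset_carrier)
      with y y' have "x \<oplus> x' = (y \<oplus> y') \<oplus> (r \<oplus> r')" by (simp add: M.a_ac)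
      with y y' show ?case
        by (intro exI[of _ "y \<oplus> y'"] exI[of _ "r \<oplus> r'"]) (simp add: act_add_right kset_add)
    qed
    ultimately obtain y r where y: "y \<in> carrier M" "?T \<odot> y = scal ?c \<odot> y"
      and r: "r \<in> kset M ?T (- {?c})" and e: "m = y \<oplus> r"
      using gws_carrier[OF m] by blast
    have rc: "r \<in> carrier M" using r by (rule kset_carrier)
    have "y \<in> kset M ?T {?c}"
      using y by (intro ksetI[of _ _ "[?c]"]) (auto simp: shift_act_zero)
    then have "\<ominus> y \<oplus> m \<in> kset M ?T {?c}"
      using gws_dtheta[OF m] by (intro kset_add kset_minus) simp_all
    moreover have "\<ominus> y \<oplus> m = r" using e y rc by (simp add: M.a_assoc[symmetric] M.l_neg)
    ultimately have "r = \<zero>" using r kset_disjoint[of ?T r "{?c}" "- {?c}"] by simp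
    then show ?thesis using e y by simp
  qed
  then show ?thesis using m by (simp add: swt_def)
qed

text \<open>The generators of \<open>Hprime\<close> act on \<open>m\<close> by scalars, so the line
  through \<open>m\<close> is stable, and a line contains no proper nonzero subspace.\<close>

lemma swt_scal_multiples_simple:
  assumes m: "m \<in> swt M \<mu>" "m \<noteq> \<zero>"
  shows "simple_submodule (range (\<lambda>c. scal c \<odot> m)) (oper_ring Hprime) M"
proof -
  let ?S = "range (\<lambda>c. scal c \<odot> m)"
  have mc: "m \<in> carrier M" using m by (auto dest: swt_carrier)
  have act: "\<exists>h. d \<odot> m = scal h \<odot> m" if "d \<in> Hprime" for d
    using that unfolding Hprime_eq
  proof (induction rule: gen_algebra.induct)
    case (incl d)
    then show ?case using m by (auto simp: swt_def)
  next
    case (add d e)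
    then obtain h k where "d \<odot> m = scal h \<odot> m" "e \<odot> m = scal k \<odot> m" by blast
    then have "(\<lambda>p. d p + e p) \<odot> m = scal (h + k) \<odot> m"
      using add mc A_Hprime by (simp add: act_add scal_add_act Hprime_eq)
    then show ?case ..
  next
    case (comp d e)
    then obtain h k where "d \<odot> m = scal h \<odot> m" "e \<odot> m = scal k \<odot> m" by blast
    moreover have "(d \<circ> e) \<odot> m = d \<odot> (e \<odot> m)"
      using comp.hyps mc A_Hprime by (intro act_comp) (simp_all add: Hprime_eq)
    ultimately have "(d \<circ> e) \<odot> m = scal (k * h) \<odot> m"
      using scal_act_comm[of d m k] comp.hyps mc A_Hprime[of d] by (simp add: Hprime_eq)
    then show ?case ..
  qed blast
  have "submodule ?S (oper_ring Hprime) M"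
  proof (intro submodule.intro subgroup.intro submodule_axioms.intro)
    show "?S \<subseteq> carrier (add_monoid M)" using mc by auto
    show "x \<otimes>\<^bsub>add_monoid M\<^esub> z \<in> ?S" if "x \<in> ?S" "z \<in> ?S" for x z
      using that mc by (auto simp: scal_add_act[symmetric])
    show "\<one>\<^bsub>add_monoid M\<^esub> \<in> ?S" using mc scal_zero_act[of m] by (metis monoid.simps(2) rangeI)
    show "inv\<^bsub>add_monoid M\<^esub> x \<in> ?S" if "x \<in> ?S" for x
    proof -
      from that obtain c where "x = scal c \<odot> m" by blast
      then have "inv\<^bsub>add_monoid M\<^esub> x = scal (- c) \<odot> m"
        using scal_minus_act[OF mc, of c] by (simp add: a_inv_def)
      then show ?thesis by blast
    qed
    show "d \<odot> x \<in> ?S" if "d \<in> carrier (oper_ring Hprime)" "x \<in> ?S" for d x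
    proof -
      have d: "d \<in> A" using that A_Hprime by simp
      from that obtain c h where "x = scal c \<odot> m" "d \<odot> m = scal h \<odot> m" using act[of d] by auto
      then have "d \<odot> x = scal (c * h) \<odot> m" using scal_act_comm[OF d mc, of c] mc by simp
      then show ?thesis by blast
    qed
  qed
  moreover have "?S \<noteq> {\<zero>}" using m(2) scal_one_act[OF mc] by (metis rangeI singletonD)
  moreover have "T = {\<zero>} \<or> T = ?S" if T: "submodule T (oper_ring Hprime) M" "T \<subseteq> ?S" for T
  proof (rule disjCI)
    assume "\<not> T = ?S"
    interpret T: submodule T "oper_ring Hprime" M by (rule T)
    have "c = 0" if "scal c \<odot> m \<in> T" for c
    proof (rule ccontr)
      assume "c \<noteq> 0"
      then have "scal d \<odot> m \<in> T" for d
        using T.smult_closed[of "scal (d / c)" "scal c \<odot> m"] that mc by (simp add: Hprime_gens)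
      then show False using T(2) \<open>\<not> T = ?S\<close> by blast
    qed
    then have "t = \<zero>" if "t \<in> T" for t
      using T(2) that scal_zero_act[OF mc] by blast
    moreover have "\<zero> \<in> T" using T.one_closed by simp
    ultimately show "T = {\<zero>}" by blast
  qed
  ultimately show ?thesis by (simp add: simple_submodule_def)
qed

lemma semisimple_moduleI:
  assumes "carrier M \<subseteq> addspan M (\<Union>\<mu>. swt M \<mu>)"
  shows "semisimple_module (oper_ring Hprime) M"
  unfolding semisimple_module_def
proof
  let ?X = "\<Union>{S. simple_submodule S (oper_ring Hprime) M}"
  have X: "?X \<subseteq> carrier (add_monoid M)"
    using subgroup.subset[OF submodule.axioms(1)] by (fastforce simp: simple_submodule_def)
  show "generate (add_monoid M) ?X \<subseteq> carrier M"
    using M.add.generate_incl X by simp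
  show "carrier M \<subseteq> generate (add_monoid M) ?X"
  proof
    fix x assume "x \<in> carrier M"
    then have "x \<in> addspan M (\<Union>\<mu>. swt M \<mu>)" using assms by blast
    then show "x \<in> generate (add_monoid M) ?X"
    proof induction
      case zero
      then show ?case using generate.one[of "add_monoid M"] by simp
    next
      case (incl x)
      then obtain \<mu> where x: "x \<in> swt M \<mu>" by blast
      show ?case
      proof (cases "x = \<zero>")
        case True
        then show ?thesis using generate.one[of "add_monoid M"] by simp
      next
        case False
        have "x = scal 1 \<odot> x" using swt_carrier[OF x] by simp
        then have "x \<in> range (\<lambda>c. scal c \<odot> x)" by (rule range_eqI)
        then show ?thesis using swt_scal_multiples_simple[OF x False] by (blast intro: generate.incl)
      qed
    next
      case (add x y)
      then show ?case using generate.eng[of x "add_monoid M" ?X y] by simp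
    qed
  qed
qed

lemma swt_theta: "m \<in> swt M \<mu> \<Longrightarrow> theta k \<odot> m \<in> swt M \<mu>"
  using act_commute[of "dtheta i j" "theta k" m for i j] swt_carrier[of m \<mu>]
  by (auto simp: swt_def gws_theta theta_dtheta_commute scal_act_comm)

lemma swt_add: "m \<in> swt M \<mu> \<Longrightarrow> m' \<in> swt M \<mu> \<Longrightarrow> m \<oplus> m' \<in> swt M \<mu>"
  using swt_carrier[of m \<mu>] swt_carrier[of m' \<mu>] by (simp add: swt_def gws_add act_add_right)

lemma swt_scal: "m \<in> swt M \<mu> \<Longrightarrow> scal c \<odot> m \<in> swt M \<mu>"
  using swt_carrier[of m \<mu>] scal_act_comm[OF A_dtheta, of m _ _ c]
  by (simp add: swt_def gws_scal mult.commute)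

lemma act_sum_zero:
  assumes "finite I" "\<And>i. i \<in> I \<Longrightarrow> d i \<in> A \<and> d i \<odot> m = \<zero>" "m \<in> carrier M"
  shows "(\<lambda>p. \<Sum>i\<in>I. d i p) \<in> A \<and> (\<lambda>p. \<Sum>i\<in>I. d i p) \<odot> m = \<zero>"
  using assms(1,2)
proof (induction I rule: finite_induct)
  case empty
  then show ?case using A_basic(1)[of 0] assms(3) by (simp add: scal_zero_left)
next
  case (insert i I)
  then show ?case using assms(3) act_add[of "d i" "\<lambda>p. \<Sum>i\<in>I. d i p" m] A_add[of "d i" "\<lambda>p. \<Sum>i\<in>I. d i p"]
    by simp
qed

text \<open>\<open>euler\<close> - |\<mu>| is the sum over j of \<open>dtheta j i\<close> - (\<mu> j
  - \<mu> i), plus CARD('i) times \<open>theta i\<close> - \<mu> i. The first sum kills vectors on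
  which \<open>Hprime\<close> acts by scalars.\<close>

lemma shift_euler_swt:
  assumes m: "m \<in> swt M \<mu>"
  shows "shift euler (\<Sum>j\<in>UNIV. \<mu> j) \<odot> m = scal (of_nat CARD('i)) \<odot> (shift (theta i) (\<mu> i) \<odot> m)"
proof -
  note mc = swt_carrier[OF m]
  let ?d = "\<lambda>j. shift (dtheta j i) (\<mu> j - \<mu> i)"
  let ?s = "\<lambda>p. \<Sum>j\<in>UNIV. ?d j p"
  have s: "?s \<in> A \<and> ?s \<odot> m = \<zero>"
    using m mc by (intro act_sum_zero) (auto simp: shift_act_zero swt_def)
  have "shift euler (\<Sum>j\<in>UNIV. \<mu> j) = (\<lambda>p. ?s p + (scal (of_nat CARD('i)) \<circ> shift (theta i) (\<mu> i)) p)"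
  proof (intro ext poly_mapping_eqI)
    fix p :: "'i cpoly" and k
    let ?l = "Poly_Mapping.lookup p k" and ?k = "\<lambda>j. complex_of_nat (Poly_Mapping.lookup k j)"
    have "Poly_Mapping.lookup (?s p) k = (\<Sum>j\<in>UNIV. (?k j - \<mu> j - (?k i - \<mu> i)) * ?l)"
      by (simp add: lookup_sum shift_def lookup_minus algebra_simps)
    also have "\<dots> = ((\<Sum>j\<in>UNIV. ?k j) - (\<Sum>j\<in>UNIV. \<mu> j) - of_nat CARD('i) * (?k i - \<mu> i)) * ?l"
      by (simp add: sum_distrib_right[symmetric] sum_subtractf)
    finally show "Poly_Mapping.lookup (shift euler (\<Sum>j\<in>UNIV. \<mu> j) p) k =
        Poly_Mapping.lookup (?s p + (scal (of_nat CARD('i)) \<circ> shift (theta i) (\<mu> i)) p) k"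
      by (simp add: lookup_add) (simp add: shift_def lookup_minus mdeg_def algebra_simps)
  qed
  then have "shift euler (\<Sum>j\<in>UNIV. \<mu> j) \<odot> m =
      ?s \<odot> m \<oplus> (scal (of_nat CARD('i)) \<circ> shift (theta i) (\<mu> i)) \<odot> m"
    using s mc act_add[of ?s "scal (of_nat CARD('i)) \<circ> shift (theta i) (\<mu> i)" m]
    by (metis A_basic(1,2) A_comp A_shift)
  also have "(scal (of_nat CARD('i)) \<circ> shift (theta i) (\<mu> i)) \<odot> m =
      scal (of_nat CARD('i)) \<odot> (shift (theta i) (\<mu> i) \<odot> m)"
    using mc by (intro act_comp) simp_all
  finally show ?thesis using s mc by simp
qed

text \<open>By the preceding identity a nilpotency exponent of \<open>theta i\<close> - \<mu> i at
  \<open>m\<close> is also one of \<open>euler\<close> - |\<mu>|. A single arbitrary coordinate is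
  enough.\<close>

lemma swt_euler:
  assumes "m \<in> swt M \<mu>"
  shows "m \<in> kset M euler {\<Sum>j\<in>UNIV. \<mu> j}"
proof -
  fix i :: 'i
  let ?a = "\<Sum>j\<in>UNIV. \<mu> j"
  have "lp euler (replicate N ?a) \<odot> m = \<zero>"
    if "m \<in> swt M \<mu>" "lp (theta i) (replicate N (\<mu> i)) \<odot> m = \<zero>" for N m
    using that
  proof (induction N arbitrary: m)
    case 0
    then show ?case using swt_carrier by simp
  next
    case (Suc N)
    note mc = swt_carrier[OF Suc.prems(1)]
    let ?m = "shift (theta i) (\<mu> i) \<odot> m"
    have "?m = theta i \<odot> m \<oplus> scal (- \<mu> i) \<odot> m"
      using mc by (simp add: shift_act scal_minus_act M.minus_eq)
    then have m': "?m \<in> swt M \<mu>" using Suc.prems(1) by (simp add: swt_add swt_theta swt_scal)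
    have "lp (theta i) (replicate N (\<mu> i)) \<odot> ?m = \<zero>"
      using lp_lp_act[of "theta i" m "replicate N (\<mu> i)" "[\<mu> i]"] mc Suc.prems(2) by simp
    then have 0: "lp euler (replicate N ?a) \<odot> ?m = \<zero>" using Suc.IH m' by blast
    have "lp euler (replicate (Suc N) ?a) \<odot> m = lp euler (replicate N ?a) \<odot> (shift euler ?a \<odot> m)"
      using lp_lp_act[of euler m "replicate N ?a" "[?a]"] mc by simp
    also have "\<dots> = \<zero>"
      using 0 mc unfolding shift_euler_swt[OF Suc.prems(1), of i] by (simp add: lp_scal_act)
    finally show ?case .
  qed
  note nil = this
  have "m \<in> gen_weight_space M \<mu>" using assms by (rule swt_gws)
  then obtain N where "lp (theta i) (replicate N (\<mu> i)) \<odot> m = \<zero>"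
    by (auto simp: gen_weight_space_lp)
  then show ?thesis
    using nil[OF assms] swt_carrier[OF assms] by (intro ksetI[of _ _ "replicate N ?a"]) auto
qed

end

section \<open>Modules over the Weyl algebra\<close>

definition coset :: "('i \<Rightarrow> complex) \<Rightarrow> ('i \<Rightarrow> complex) set" where
  "coset \<nu> = {\<mu>. \<forall>i. \<mu> i - \<nu> i \<in> \<int>}"

lemma coset_add: "\<mu> \<in> coset \<nu> \<Longrightarrow> (\<And>i. k i \<in> \<int>) \<Longrightarrow> (\<lambda>i. \<mu> i + k i) \<in> coset \<nu>"
  by (auto simp: coset_def diff_add_eq[symmetric] intro!: Ints_add)

lemma coset_sum:
  fixes \<nu> :: "'i :: finite \<Rightarrow> complex"
  shows "\<mu> \<in> coset \<nu> \<Longrightarrow> (\<Sum>i\<in>UNIV. \<mu> i) - (\<Sum>i\<in>UNIV. \<nu> i) \<in> \<int>"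
  unfolding sum_subtractf[symmetric] by (rule Ints_sum) (simp add: coset_def)

text \<open>Only the carrier shrinks while the operations stay the same, so spans and products of
  factors can be compared directly with those of M.\<close>

definition Epart :: "complex \<Rightarrow> ('i :: finite oper, 'v) module \<Rightarrow> ('i oper, 'v) module" where
  "Epart a M = M\<lparr>carrier := kset M euler {a}\<rparr>"

lemma addspan_restrict [simp]: "addspan (M\<lparr>carrier := H\<rparr>) S = addspan M S"
proof
  have "x \<in> addspan M S" if "x \<in> addspan (M\<lparr>carrier := H\<rparr>) S" for x
    using that by induction (auto intro: addspan.intros)
  then show "addspan (M\<lparr>carrier := H\<rparr>) S \<subseteq> addspan M S" by blast
  have "x \<in> addspan (M\<lparr>carrier := H\<rparr>) S" if "x \<in> addspan M S" for x
    using that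
  proof induction
    case zero
    then show ?case using addspan.zero[of "M\<lparr>carrier := H\<rparr>"] by simp
  next
    case (add x y)
    then show ?case using addspan.add[of x "M\<lparr>carrier := H\<rparr>"] by simp
  qed (rule addspan.incl)
  then show "addspan M S \<subseteq> addspan (M\<lparr>carrier := H\<rparr>) S" by blast
qed

lemma kset_restrict: "H \<subseteq> carrier M \<Longrightarrow> kset (M\<lparr>carrier := H\<rparr>) T X = H \<inter> kset M T X"
  by (auto simp: kset_def)

lemma swt_restrict: "H \<subseteq> carrier M \<Longrightarrow> swt (M\<lparr>carrier := H\<rparr>) \<mu> = H \<inter> swt M \<mu>"
  by (auto simp: swt_def gen_weight_space_lp)

lemma addspan_Un_mono: "S \<subseteq> T \<Longrightarrow> addspan M S \<subseteq> addspan M T"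
  by (rule addspan_mono) (auto intro: addspan.incl)

context opmod begin

lemma E_locally_nilpotent_iff: "E_locally_nilpotent a M \<longleftrightarrow> carrier M \<subseteq> kset M euler {a}"
proof -
  have "(\<exists>N>0. lp euler (replicate N a) \<odot> m = \<zero>) \<longleftrightarrow> (\<exists>cs. set cs \<subseteq> {a} \<and> lp euler cs \<odot> m = \<zero>)"
    if m: "m \<in> carrier M" for m
  proof
    assume "\<exists>cs. set cs \<subseteq> {a} \<and> lp euler cs \<odot> m = \<zero>"
    then obtain cs where cs: "set cs \<subseteq> {a}" "lp euler cs \<odot> m = \<zero>" by blast
    then have "cs = replicate (length cs) a" by (metis replicate_eqI subsetD singletonD)
    \<comment> \<open>One extra factor covers the empty list, since the exponent must be
      positive.\<close>
    then have "replicate (Suc (length cs)) a = [a] @ cs" by simp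
    then have "lp euler (replicate (Suc (length cs)) a) \<odot> m = \<zero>"
      using lp_append_zero[of euler m "[a]" cs] cs m by simp
    then show "\<exists>N>0. lp euler (replicate N a) \<odot> m = \<zero>" by blast
  next
    assume "\<exists>N>0. lp euler (replicate N a) \<odot> m = \<zero>"
    then obtain N where "lp euler (replicate N a) \<odot> m = \<zero>" by blast
    then show "\<exists>cs. set cs \<subseteq> {a} \<and> lp euler cs \<odot> m = \<zero>"
      by (intro exI[of _ "replicate N a"]) auto
  qed
  then show ?thesis
    unfolding E_locally_nilpotent_def lp_replicate[symmetric] shift_def[symmetric]
    by (auto simp: kset_def)
qed

text \<open>Decomposition, support and semisimplicity merge into one spanning condition. Objects of
  both categories are recognised by it, and it is easily checked on generators.\<close>

lemma weight_conditions_iff: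
  "gen_weight_decomp M \<and> weight_support M \<subseteq> \<Lambda> \<and> semisimple_module (oper_ring Hprime) M \<longleftrightarrow>
    carrier M \<subseteq> addspan M (\<Union>\<mu>\<in>\<Lambda>. swt M \<mu>)" (is "?L \<longleftrightarrow> ?R")
proof
  assume L: ?L
  have "addspan M (\<Union>\<mu>\<in>weight_support M. gen_weight_space M \<mu>) \<subseteq> addspan M (\<Union>\<mu>\<in>\<Lambda>. swt M \<mu>)"
    using L semisimple_gws by (intro addspan_Un_mono) blast
  then show ?R using gen_weight_decompD L by blast
next
  assume R: ?R
  have "addspan M (\<Union>\<mu>\<in>\<Lambda>. swt M \<mu>) \<subseteq> addspan M (\<Union>\<mu>\<in>\<Lambda>. gen_weight_space M \<mu>)"
    using swt_gws by (intro addspan_Un_mono) blast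
  moreover have "addspan M (\<Union>\<mu>\<in>\<Lambda>. swt M \<mu>) \<subseteq> addspan M (\<Union>\<mu>. swt M \<mu>)"
    by (intro addspan_Un_mono) blast
  ultimately show ?L
    using R gen_weight_decompI[of \<Lambda>] semisimple_moduleI by blast
qed

section \<open>Weight shifts and splitting off the degree a part\<close>

lemma act_intertwine:
  assumes "T \<in> A" "d \<in> A" "\<And>p. T (d p) = d (T p) + scal k (d p)" "m \<in> carrier M"
  shows "T \<odot> (d \<odot> m) = d \<odot> (T \<odot> m) \<oplus> scal k \<odot> (d \<odot> m)"
proof -
  have "T \<circ> d = (\<lambda>p. (d \<circ> T) p + (scal k \<circ> d) p)" using assms(3) by auto
  then have "(T \<circ> d) \<odot> m = (d \<circ> T) \<odot> m \<oplus> (scal k \<circ> d) \<odot> m"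
    using act_add[of "d \<circ> T" "scal k \<circ> d" m] assms by (metis A_basic(1) A_comp)
  moreover have "(T \<circ> d) \<odot> m = T \<odot> (d \<odot> m)" "(d \<circ> T) \<odot> m = d \<odot> (T \<odot> m)"
    "(scal k \<circ> d) \<odot> m = scal k \<odot> (d \<odot> m)"
    using assms by (auto intro!: act_comp)
  ultimately show ?thesis by simp
qed

text \<open>Subtracting the relations for i and j gives the commutator (k i - k j) d with
  \<open>dtheta i j\<close>. Hence the scalar action of \<open>Hprime\<close> moves along with the
  generalized weight.\<close>

lemma swt_intertwine:
  assumes "d \<in> A" "\<And>i p. theta i (d p) = d (theta i p) + scal (k i) (d p)" "m \<in> swt M \<mu>"
  shows "d \<odot> m \<in> swt M (\<lambda>i. \<mu> i + k i)"
proof -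
  note mc = swt_carrier[OF assms(3)]
  have "d \<odot> m \<in> gen_weight_space M (\<lambda>i. \<mu> i + k i)"
    using assms kset_intertwine[of "theta i" d "k i" m "{\<mu> i}" for i]
    by (auto simp: gws_iff swt_def add.commute)
  moreover have "dtheta i j \<odot> (d \<odot> m) = scal (\<mu> i + k i - (\<mu> j + k j)) \<odot> (d \<odot> m)" for i j
  proof -
    have "dtheta i j p = theta i p - theta j p" for p
      by (simp add: dtheta_def theta_def)
    then have "dtheta i j (d p) = d (dtheta i j p) + scal (k i - k j) (d p)" for p
      using assms(1,2) A_weyl[of d] scal_add_left[of "k i" "- k j" "d p"]
      by (simp add: weyl_minus scal_minus_left)
    then have "dtheta i j \<odot> (d \<odot> m) = d \<odot> (dtheta i j \<odot> m) \<oplus> scal (k i - k j) \<odot> (d \<odot> m)"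
      using assms(1) mc by (intro act_intertwine) simp_all
    also have "d \<odot> (dtheta i j \<odot> m) = scal (\<mu> i - \<mu> j) \<odot> (d \<odot> m)"
      using assms(1,3) scal_act_comm[OF assms(1) mc] by (simp add: swt_def)
    finally show ?thesis
      using assms(1) mc by (simp add: scal_add_act[symmetric] algebra_simps)
  qed
  ultimately show ?thesis by (simp add: swt_def)
qed

text \<open>Each weight vector goes entirely into one of the two parts, according to whether its
  degree is a. The degree a part is recorded as a sum of weight vectors, not merely as an element
  killed by a power of \<open>euler\<close> - a.\<close>

lemma E_split:
  assumes "m \<in> addspan M (\<Union>\<mu>\<in>\<Lambda>. swt M \<mu>)"
  shows "\<exists>n r. n \<in> addspan M (\<Union>\<mu>\<in>{\<mu>\<in>\<Lambda>. (\<Sum>i\<in>UNIV. \<mu> i) = a}. swt M \<mu>) \<and>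
    r \<in> kset M euler (- {a}) \<and> m = n \<oplus> r" (is "\<exists>n r. n \<in> ?N \<and> _")
  using assms
proof induction
  case zero
  then show ?case by (intro exI[of _ \<zero>]) (simp add: kset_zero addspan.zero)
next
  case (incl m)
  then obtain \<mu> where \<mu>: "\<mu> \<in> \<Lambda>" "m \<in> swt M \<mu>" by blast
  show ?case
  proof (cases "(\<Sum>i\<in>UNIV. \<mu> i) = a")
    case True
    then have "m \<in> ?N" using \<mu> by (intro addspan.incl) blast
    then show ?thesis using swt_carrier[OF \<mu>(2)]
      by (intro exI[of _ m] exI[of _ \<zero>]) (simp add: kset_zero)
  next
    case False
    then have "m \<in> kset M euler (- {a})"
      using swt_euler[OF \<mu>(2)] kset_mono[of "{\<Sum>i\<in>UNIV. \<mu> i}" "- {a}" M euler] by auto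
    then show ?thesis using swt_carrier[OF \<mu>(2)]
      by (intro exI[of _ \<zero>] exI[of _ m]) (simp add: addspan.zero)
  qed
next
  case (add m m')
  then obtain n r n' r' where n: "n \<in> ?N" "r \<in> kset M euler (- {a})" "m = n \<oplus> r"
    and n': "n' \<in> ?N" "r' \<in> kset M euler (- {a})" "m' = n' \<oplus> r'" by blast
  have "n \<in> carrier M" "n' \<in> carrier M"
    using n(1) n'(1) addspan_closed swt_carrier by blast+
  moreover have "r \<in> carrier M" "r' \<in> carrier M" using n n' by (auto dest: kset_carrier)
  ultimately have "m \<oplus> m' = (n \<oplus> n') \<oplus> (r \<oplus> r')" using n n' by (simp add: M.a_ac)
  then show ?case using n n'
    by (intro exI[of _ "n \<oplus> n'"] exI[of _ "r \<oplus> r'"]) (simp add: addspan.add kset_add)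
qed

lemma addspan_swt_kset:
  assumes "m \<in> addspan M (\<Union>\<mu>\<in>{\<mu>\<in>\<Lambda>. (\<Sum>i\<in>UNIV. \<mu> i) = a}. swt M \<mu>)"
  shows "m \<in> kset M euler {a}"
  using assms
proof induction
  case (incl m)
  then show ?case using swt_euler by blast
qed (auto intro: kset_zero kset_add)

lemma E_split_unique:
  assumes "n \<in> kset M euler {a}" "r \<in> kset M euler (- {a})"
    and "n' \<in> kset M euler {a}" "r' \<in> kset M euler (- {a})" "n \<oplus> r = n' \<oplus> r'"
  shows "n = n'"
proof -
  have c: "n \<in> carrier M" "r \<in> carrier M" "n' \<in> carrier M" "r' \<in> carrier M"
    using assms by (auto dest: kset_carrier)
  have "\<ominus> n' \<oplus> n = \<ominus> n' \<oplus> (n \<oplus> r) \<oplus> \<ominus> r" using c by (simp add: M.a_assoc M.r_neg)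
  also have "\<dots> = r' \<oplus> \<ominus> r" using c assms(5) by (simp add: M.a_assoc[symmetric] M.l_neg)
  finally have "\<ominus> n' \<oplus> n \<in> kset M euler (- {a})"
    using assms by (simp add: kset_add kset_minus)
  moreover have "\<ominus> n' \<oplus> n \<in> kset M euler {a}" using assms by (simp add: kset_add kset_minus)
  ultimately have "\<ominus> n' \<oplus> n = \<zero>" using kset_disjoint[of euler] by auto
  then have "n \<ominus> n' = \<zero>" using c by (simp add: M.minus_eq M.a_comm)
  then show ?thesis using c M.minus_eq_zero_iff by simp
qed

lemma opmod_weylE: "opmod weylE M"
proof -
  have sub: "d \<in> weylE \<Longrightarrow> d \<in> A" for d using weylE_sub by blast
  have "left_module (oper_ring weylE) M"
    by (intro left_module.intro left_module_axioms.intro ring_weylE M.abelian_group_axioms)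
      (simp_all add: sub act_add act_add_right)
  then show ?thesis
    by (intro opmod.intro opmod_axioms.intro) (auto simp: weylE_iff)
qed

lemma opmod_Epart: "opmod weylE (Epart a M)"
proof -
  interpret W: opmod weylE M by (rule opmod_weylE)
  have "left_module (oper_ring weylE) (Epart a M)"
    unfolding Epart_def
  proof (rule W.left_module_restrict)
    show "d \<odot> x \<in> kset M euler {a}" if "d \<in> carrier (oper_ring weylE)" "x \<in> kset M euler {a}" for d x
      using that weylE_sub by (intro kset_commute) (auto simp: weylE_iff)
  qed (auto simp: kset_zero kset_add dest: kset_carrier)
  then show ?thesis
    by (intro opmod.intro opmod_axioms.intro) (auto simp: weylE_iff)
qed

text \<open>The degree a summand given by \<open>E_split\<close> is a sum of weight vectors that lie
  in the degree a part; uniqueness of the splitting identifies it with the given element.\<close>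

lemma Epart_conditions:
  assumes c: "carrier M \<subseteq> addspan M (\<Union>\<mu>\<in>\<Lambda>. swt M \<mu>)"
  shows "carrier (Epart a M) \<subseteq> addspan (Epart a M) (\<Union>\<mu>\<in>\<Lambda>. swt (Epart a M) \<mu>)"
    and "carrier (Epart a M) \<subseteq> kset (Epart a M) euler {a}"
proof -
  let ?H = "kset M euler {a}"
  have H: "?H \<subseteq> carrier M" by (auto dest: kset_carrier)
  show "carrier (Epart a M) \<subseteq> kset (Epart a M) euler {a}"
    by (simp add: Epart_def kset_restrict[OF H])
  have "m \<in> addspan M (\<Union>\<mu>\<in>\<Lambda>. ?H \<inter> swt M \<mu>)" if m: "m \<in> ?H" for m
  proof -
    let ?G = "\<Union>\<mu>\<in>{\<mu>\<in>\<Lambda>. (\<Sum>i\<in>UNIV. \<mu> i) = a}. swt M \<mu>"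
    obtain n r where n: "n \<in> addspan M ?G" "r \<in> kset M euler (- {a})" "m = n \<oplus> r"
      using E_split[of m \<Lambda> a] c m H by blast
    have nk: "n \<in> ?H" using n(1) by (rule addspan_swt_kset)
    then have "m = n"
      using E_split_unique[OF m kset_zero nk n(2)] n(3) m H by auto
    moreover have "addspan M ?G \<subseteq> addspan M (\<Union>\<mu>\<in>\<Lambda>. ?H \<inter> swt M \<mu>)"
      using swt_euler by (intro addspan_Un_mono) auto
    ultimately show ?thesis using n(1) by blast
  qed
  then show "carrier (Epart a M) \<subseteq> addspan (Epart a M) (\<Union>\<mu>\<in>\<Lambda>. swt (Epart a M) \<mu>)"
    unfolding Epart_def swt_restrict[OF H] by auto
qed

end

text \<open>The projection onto degree a along the other generalized eigenspaces of
  \<open>euler\<close>. It carries meaning only where a splitting exists, which holds for the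
  modules spanned by weight vectors.\<close>

definition Epr :: "('i :: finite oper, 'v) module \<Rightarrow> complex \<Rightarrow> 'v \<Rightarrow> 'v" where
  "Epr M a m = (THE n. n \<in> kset M euler {a} \<and> (\<exists>r\<in>kset M euler (- {a}). m = n \<oplus>\<^bsub>M\<^esub> r))"

lemma sDH_mod_Ob:
  "M \<in> Ob (sDH_mod \<nu> :: (('i :: finite oper, 'v) module, 'v \<Rightarrow> 'v) cat) \<longleftrightarrow>
    opmod weyl M \<and> carrier M \<subseteq> addspan M (\<Union>\<mu>\<in>coset \<nu>. swt M \<mu>)"
proof -
  have "left_module (oper_ring weyl) M \<longleftrightarrow> opmod weyl M"
    by (auto simp: opmod_def opmod_axioms_def weylE_iff)
  then show ?thesis
    unfolding sDH_mod_def lmod_cat_def coset_def[symmetric]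
    using opmod.weight_conditions_iff[of weyl M "coset \<nu>"] by auto
qed

lemma sDEH_mod_Ob:
  "M \<in> Ob (sDEH_mod a \<nu> :: (('i :: finite oper, 'v) module, 'v \<Rightarrow> 'v) cat) \<longleftrightarrow>
    opmod weylE M \<and> carrier M \<subseteq> addspan M (\<Union>\<mu>\<in>coset \<nu>. swt M \<mu>) \<and> carrier M \<subseteq> kset M euler {a}"
proof -
  have "left_module (oper_ring weylE) M \<longleftrightarrow> opmod weylE M"
    by (auto simp: opmod_def opmod_axioms_def weylE_iff)
  then show ?thesis
    unfolding sDEH_mod_def lmod_cat_def coset_def[symmetric]
    using opmod.weight_conditions_iff[of weylE M "coset \<nu>"] opmod.E_locally_nilpotent_iff[of weylE M a]
    by auto
qed

section \<open>Differential operators acting on weight vectors and degree parts\<close>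

locale dmod = opmod weyl M for M :: "('i :: finite oper, 'v) module" (structure)
begin

lemma swt_tmul: "m \<in> swt M \<mu> \<Longrightarrow> tmul j \<odot> m \<in> swt M (\<lambda>i. \<mu> i + (if i = j then 1 else 0))"
  by (rule swt_intertwine) (simp_all add: theta_tmul)

lemma swt_del: "m \<in> swt M \<mu> \<Longrightarrow> del j \<odot> m \<in> swt M (\<lambda>i. \<mu> i + (if i = j then - 1 else 0))"
  by (rule swt_intertwine) (simp_all add: theta_del)

text \<open>\<open>tmul j\<close> and \<open>del j\<close> move weights by integers and so stay in
  the coset; the weight vectors thus span a submodule over \<open>weyl\<close>.\<close>

lemma addspan_swt_weyl:
  assumes "d \<in> weyl" "m \<in> addspan M (\<Union>\<mu>\<in>coset \<nu>. swt M \<mu>)"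
  shows "d \<odot> m \<in> addspan M (\<Union>\<mu>\<in>coset \<nu>. swt M \<mu>)"
proof -
  let ?G = "\<Union>\<mu>\<in>coset \<nu>. swt M \<mu>"
  have G: "?G \<subseteq> carrier M" using swt_carrier by blast
  have gen: "d \<odot> m \<in> addspan M ?G"
    if "d \<in> weyl" "\<And>m \<mu>. \<mu> \<in> coset \<nu> \<Longrightarrow> m \<in> swt M \<mu> \<Longrightarrow> \<exists>\<mu>'\<in>coset \<nu>. d \<odot> m \<in> swt M \<mu>'"
      "m \<in> addspan M ?G" for d m
  proof (rule addspan_smult[OF G _ _ that(3)])
    show "d \<odot> x \<in> addspan M ?G" if "x \<in> ?G" for x
    proof -
      from that obtain \<mu> where "\<mu> \<in> coset \<nu>" "x \<in> swt M \<mu>" by blast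
      then show ?thesis using \<open>\<And>m \<mu>. \<mu> \<in> coset \<nu> \<Longrightarrow> m \<in> swt M \<mu> \<Longrightarrow> \<exists>\<mu>'\<in>coset \<nu>. d \<odot> m \<in> swt M \<mu>'\<close>
        by (blast intro: addspan.incl)
    qed
  qed (use that(1) in simp)
  have "d \<odot> m \<in> addspan M ?G" if "d \<in> gen_algebra (range tmul \<union> range del)" for d
    using that assms(2)
  proof (induction arbitrary: m rule: gen_algebra.induct)
    case (scal c)
    then show ?case using swt_scal by (intro gen) auto
  next
    case (incl d)
    then show ?case
    proof (elim UnE rangeE)
      fix j assume d: "d = tmul j"
      have "(\<lambda>i. \<mu> i + (if i = j then 1 else 0)) \<in> coset \<nu>" if "\<mu> \<in> coset \<nu>" for \<mu>
        using that by (rule coset_add) auto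
      then show ?thesis
        unfolding d using swt_tmul[of _ _ j] by (intro gen incl.prems) (simp, blast)
    next
      fix j assume d: "d = del j"
      have "(\<lambda>i. \<mu> i + (if i = j then - 1 else 0)) \<in> coset \<nu>" if "\<mu> \<in> coset \<nu>" for \<mu>
        using that by (rule coset_add) auto
      then show ?thesis
        unfolding d using swt_del[of _ _ j] by (intro gen incl.prems) (simp, blast)
    qed
  next
    case (add d e)
    then have "d \<in> weyl" "e \<in> weyl" "m \<in> carrier M"
      using addspan_closed[OF G] by (auto simp: weyl_def)
    then show ?case using add by (simp add: act_add addspan.add)
  next
    case (comp d e)
    then have "(d \<circ> e) \<odot> m = d \<odot> (e \<odot> m)"
      using addspan_closed[OF G] by (intro act_comp) (auto simp: weyl_def)
    moreover have "d \<odot> (e \<odot> m) \<in> addspan M ?G" by (intro comp.IH comp.prems)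
    ultimately show ?case by metis
  qed
  then show ?thesis using assms(1) by (simp add: weyl_def)
qed

text \<open>A summand of \<open>d\<close> of degree k \<noteq> 0 moves \<open>n\<close> to degree a
  + k, away from a. Thus taking the degree a part in the module corresponds to \<open>proj0\<close>
  in the algebra, which links the two constructions.\<close>

lemma weyl_act_split:
  assumes "d \<in> weyl" "n \<in> kset M euler {a}"
  shows "\<exists>r\<in>kset M euler (- {a}). d \<odot> n = proj0 d \<odot> n \<oplus> r"
  using assms(1)
proof (induction rule: weyl_deg_induct)
  case (deg d k)
  note d = weyl_degD[OF deg] and nc = kset_carrier[OF assms(2)]
  show ?case
  proof (cases "k = 0")
    case True
    then have "proj0 d = d" using deg proj0_weylE by (simp add: weyl_deg_0)
    then show ?thesis using d nc by (intro bexI[of _ \<zero>]) (auto simp: kset_zero)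
  next
    case False
    have "d \<odot> n \<in> kset M euler ((+) (of_int k) ` {a})"
      using d deg assms(2) by (intro kset_intertwine) (auto simp: weyl_deg_def)
    then have "d \<odot> n \<in> kset M euler (- {a})"
      using kset_mono[of "(+) (of_int k) ` {a}" "- {a}" M euler] False by auto
    then show ?thesis
      using proj0_weyl_deg[OF deg False] d nc by (intro bexI[of _ "d \<odot> n"]) auto
  qed
next
  case (add d e)
  note nc = kset_carrier[OF assms(2)]
  from add obtain r s where r: "r \<in> kset M euler (- {a})" "d \<odot> n = proj0 d \<odot> n \<oplus> r"
    and s: "s \<in> kset M euler (- {a})" "e \<odot> n = proj0 e \<odot> n \<oplus> s" by blast
  have p: "proj0 d \<in> weyl" "proj0 e \<in> weyl" using proj0_in_weylE add by (auto simp: weylE_iff)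
  have "r \<in> carrier M" "s \<in> carrier M" using r s by (auto dest: kset_carrier)
  then have "(\<lambda>p. d p + e p) \<odot> n = proj0 (\<lambda>p. d p + e p) \<odot> n \<oplus> (r \<oplus> s)"
    using r(2) s(2) add p nc by (simp add: proj0_add act_add M.a_ac)
  then show ?case using r s by (intro bexI[of _ "r \<oplus> s"]) (simp_all add: kset_add)
qed

lemma Epr_eq:
  assumes "n \<in> kset M euler {a}" "r \<in> kset M euler (- {a})"
  shows "Epr M a (n \<oplus> r) = n"
  unfolding Epr_def using assms E_split_unique by (intro the_equality) blast+

lemma Epr_kset: "n \<in> kset M euler {a} \<Longrightarrow> Epr M a n = n"
  using Epr_eq[of n a \<zero>] by (simp add: kset_zero kset_carrier)

lemma kset_weylE: "d \<in> weylE \<Longrightarrow> n \<in> kset M euler X \<Longrightarrow> d \<odot> n \<in> kset M euler X"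
  by (rule kset_commute) (auto simp: weylE_iff)

lemma Epr_weyl_act:
  assumes "d \<in> weyl" "n \<in> kset M euler {a}"
  shows "Epr M a (d \<odot> n) = proj0 d \<odot> n"
  using weyl_act_split[OF assms] Epr_eq kset_weylE[OF proj0_in_weylE[OF assms(1)] assms(2)] by auto

end

lemma shift_shift: "shift (shift T b) c = shift T (b + c)"
  by (auto simp: shift_def scal_add_left)

lemma lp_shift: "lp (shift T b) (map (\<lambda>c. c - b) cs) = lp T cs"
  by (induction cs) (simp_all add: lp_simps shift_shift)

text \<open>Subtracting b from T translates its eigenvalues by - b. This brings surjectivity of
  \<open>theta i0\<close> - b under the case of a nonzero eigenvalue.\<close>

lemma kset_shift: "m \<in> kset M T {c} \<Longrightarrow> m \<in> kset M (shift T b) {c - b}"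
proof -
  assume "m \<in> kset M T {c}"
  then obtain cs where "m \<in> carrier M" "set cs \<subseteq> {c}" "lp T cs \<odot>\<^bsub>M\<^esub> m = \<zero>\<^bsub>M\<^esub>" by (auto simp: kset_def)
  then show ?thesis by (intro ksetI[of _ _ "map (\<lambda>c. c - b) cs"]) (auto simp: lp_shift)
qed

lemma weyl_deg_funpow: "d \<in> weyl_deg k \<Longrightarrow> d ^^ j \<in> weyl_deg (int j * k)"
proof (induction j)
  case 0
  then show ?case using scal_in_weylE[of 1] by (simp add: weyl_deg_0 scal_one id_def)
next
  case (Suc j)
  then have "d \<circ> d ^^ j \<in> weyl_deg (k + int j * k)" by (intro weyl_deg_comp)
  moreover have "k + int j * k = int (Suc j) * k" by (simp add: algebra_simps)
  ultimately show ?case unfolding funpow.simps by metis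
qed

text \<open>An object of the source category with a chosen coordinate \<open>i0\<close> in which
  \<nu> is not integral; the same \<open>i0\<close> serves both ends of a morphism.\<close>

locale dobj = dmod M for M :: "('i :: finite oper, 'v) module" (structure) +
  fixes a :: complex and \<nu> :: "'i \<Rightarrow> complex" and i0 :: 'i
  assumes span: "carrier M \<subseteq> addspan M (\<Union>\<mu>\<in>coset \<nu>. swt M \<mu>)"
    and i0: "\<nu> i0 \<notin> \<int>" and a: "a - (\<Sum>i\<in>UNIV. \<nu> i) \<in> \<int>"
begin

abbreviation "pr \<equiv> Epr M a"

lemma dobj_induct [consumes 1, case_names zero swt add]:
  assumes "m \<in> carrier M" "P \<zero>" "\<And>m \<mu>. \<mu> \<in> coset \<nu> \<Longrightarrow> m \<in> swt M \<mu> \<Longrightarrow> P m"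
    and "\<And>m m'. m \<in> carrier M \<Longrightarrow> m' \<in> carrier M \<Longrightarrow> P m \<Longrightarrow> P m' \<Longrightarrow> P (m \<oplus> m')"
  shows "P m"
proof -
  have "m \<in> addspan M (\<Union>\<mu>\<in>coset \<nu>. swt M \<mu>)" using span assms(1) by blast
  then have "m \<in> carrier M \<and> P m"
  proof induction
    case (incl x)
    then show ?case using assms(3) swt_carrier by blast
  qed (use assms(2,4) in auto)
  then show ?thesis ..
qed

lemma pr_split:
  assumes "m \<in> carrier M"
  obtains n r where "n \<in> kset M euler {a}" "r \<in> kset M euler (- {a})" "m = n \<oplus> r" "pr m = n"
proof -
  have "m \<in> addspan M (\<Union>\<mu>\<in>coset \<nu>. swt M \<mu>)" using assms span by (rule rev_subsetD)
  from E_split[OF this, of a] obtain n r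
    where "n \<in> addspan M (\<Union>\<mu>\<in>{\<mu>\<in>coset \<nu>. (\<Sum>i\<in>UNIV. \<mu> i) = a}. swt M \<mu>)"
      and r: "r \<in> kset M euler (- {a})" and m: "m = n \<oplus> r" by (elim exE conjE)
  then have n: "n \<in> kset M euler {a}" by (intro addspan_swt_kset)
  show ?thesis by (rule that[OF n r m]) (unfold m, rule Epr_eq[OF n r])
qed

lemma pr_closed: "m \<in> carrier M \<Longrightarrow> pr m \<in> kset M euler {a}"
  by (erule pr_split) simp

lemma pr_carrier [simp]: "m \<in> carrier M \<Longrightarrow> pr m \<in> carrier M"
  by (rule kset_carrier[OF pr_closed])

lemma pr_add:
  assumes "m \<in> carrier M" "m' \<in> carrier M"
  shows "pr (m \<oplus> m') = pr m \<oplus> pr m'"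
proof -
  obtain n r where n: "n \<in> kset M euler {a}" "r \<in> kset M euler (- {a})" "m = n \<oplus> r" "pr m = n"
    using pr_split[OF assms(1)] .
  obtain n' r' where n': "n' \<in> kset M euler {a}" "r' \<in> kset M euler (- {a})" "m' = n' \<oplus> r'" "pr m' = n'"
    using pr_split[OF assms(2)] .
  have "n \<in> carrier M" "r \<in> carrier M" "n' \<in> carrier M" "r' \<in> carrier M"
    using n n' by (auto dest: kset_carrier)
  then have "m \<oplus> m' = (n \<oplus> n') \<oplus> (r \<oplus> r')" using n n' by (simp add: M.a_ac)
  then show ?thesis using n n' Epr_eq[of "n \<oplus> n'" a "r \<oplus> r'"] by (simp add: kset_add)
qed

lemma pr_weylE:
  assumes "d \<in> weylE" "m \<in> carrier M"
  shows "pr (d \<odot> m) = d \<odot> pr m"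
proof -
  have d: "d \<in> weyl" using assms by (simp add: weylE_iff)
  obtain n r where n: "n \<in> kset M euler {a}" "r \<in> kset M euler (- {a})" "m = n \<oplus> r" "pr m = n"
    using pr_split[OF assms(2)] .
  then have "n \<in> carrier M" "r \<in> carrier M" by (auto dest: kset_carrier)
  then have "d \<odot> m = d \<odot> n \<oplus> d \<odot> r" using d n(3) by (simp add: act_add_right)
  then show ?thesis
    using n(4) Epr_eq[OF kset_weylE[OF assms(1) n(1)] kset_weylE[OF assms(1) n(2)]] by simp
qed

lemma kset_theta: "m \<in> carrier M \<Longrightarrow> m \<in> kset M (theta i) {c. c - \<nu> i \<in> \<int>}"
proof (induction rule: dobj_induct)
  case (swt m \<mu>)
  then have "m \<in> kset M (theta i) {\<mu> i}" using swt_gws[OF swt(2)] by (simp add: gws_iff)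
  then show ?case
    using kset_mono[of "{\<mu> i}" "{c. c - \<nu> i \<in> \<int>}" M "theta i"] swt(1) by (auto simp: coset_def)
qed (auto intro: kset_zero kset_add)

text \<open>The integrality of a - |\<nu>| enters here: |\<mu>| differs from |\<nu>|, and therefore
  from a, by an integer.\<close>

lemma kset_euler: "m \<in> carrier M \<Longrightarrow> m \<in> kset M euler {c. c - a \<in> \<int>}"
proof (induction rule: dobj_induct)
  case (swt m \<mu>)
  have "(\<Sum>i\<in>UNIV. \<mu> i) - a \<in> \<int>"
    using Ints_diff[OF coset_sum[OF swt(1)] a] by simp
  then show ?case
    using swt_euler[OF swt(2)] kset_mono[of "{\<Sum>i\<in>UNIV. \<mu> i}" "{c. c - a \<in> \<int>}" M euler] by auto
qed (auto intro: kset_zero kset_add)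

text \<open>All eigenvalues of \<open>theta i0\<close> lie in \<nu> i0 + Z, which is disjoint from
  Z. The cases c = 0 and c = - 1 give injectivity of \<open>del i0\<close> and
  \<open>tmul i0\<close>.\<close>

lemma theta_shift_inj:
  assumes "m \<in> carrier M" "shift (theta i0) c \<odot> m = \<zero>" "c \<in> \<int>"
  shows "m = \<zero>"
proof (rule kset_disjoint)
  show "m \<in> kset M (theta i0) {c}" using assms by (intro ksetI[of _ _ "[c]"]) auto
  show "m \<in> kset M (theta i0) {c. c - \<nu> i0 \<in> \<int>}" using assms(1) by (rule kset_theta)
  show "{c} \<inter> {c. c - \<nu> i0 \<in> \<int>} = {}" using assms(3) i0 Ints_diff[of c "c - \<nu> i0"] by auto
qed simp

lemma tmul_del_act: "m \<in> carrier M \<Longrightarrow> tmul i \<odot> (del i \<odot> m) = theta i \<odot> m"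
  using act_comp[of "tmul i" "del i" m] by (simp add: theta_def comp_def)

lemma del_tmul_act: "m \<in> carrier M \<Longrightarrow> del i \<odot> (tmul i \<odot> m) = shift (theta i) (- 1) \<odot> m"
proof -
  have "shift (theta i) (- 1) = del i \<circ> tmul i"
    by (auto simp: shift_def del_theta_self scal_minus_left scal_one)
  then show "m \<in> carrier M \<Longrightarrow> ?thesis" by (simp del: o_apply)
qed

lemma tmul_inj: "m \<in> carrier M \<Longrightarrow> tmul i0 \<odot> m = \<zero> \<Longrightarrow> m = \<zero>"
  using del_tmul_act[of m i0] theta_shift_inj[of m "- 1"] by simp

lemma del_inj: "m \<in> carrier M \<Longrightarrow> del i0 \<odot> m = \<zero> \<Longrightarrow> m = \<zero>"
  using tmul_del_act[of m i0] theta_shift_inj[of m 0] shift_act_zero[of "theta i0" m 0] by simp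

lemma funpow_inj:
  assumes "d \<in> weyl" "\<And>m. m \<in> carrier M \<Longrightarrow> d \<odot> m = \<zero> \<Longrightarrow> m = \<zero>"
  shows "m \<in> carrier M \<Longrightarrow> (d ^^ j) \<odot> m = \<zero> \<Longrightarrow> m = \<zero>"
proof (induction j)
  case 0
  then show ?case by (simp add: id_def[symmetric])
next
  case (Suc j)
  have j: "d ^^ j \<in> weyl" for j
    by (induction j) (use assms(1) A_basic(4) in \<open>simp add: id_def\<close>,
      unfold funpow.simps, rule weyl_comp[OF assms(1)])
  have "(d ^^ Suc j) \<odot> m = d \<odot> ((d ^^ j) \<odot> m)"
    unfolding funpow.simps using assms(1) j Suc.prems by (intro act_comp)
  then have "d \<odot> ((d ^^ j) \<odot> m) = \<zero>" using Suc.prems(2) by metis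
  then show ?case using Suc.IH Suc.prems(1) assms(2)[of "(d ^^ j) \<odot> m"] j by simp
qed

text \<open>On weight \<mu> the operator has generalized eigenvalue \<mu> i0 - b, which is not even
  an integer. The preimage has the same weight, so its degree stays known.\<close>

lemma theta_shift_surj:
  assumes "\<mu> \<in> coset \<nu>" "m \<in> swt M \<mu>" "b \<in> \<int>"
  shows "\<exists>u\<in>swt M \<mu>. shift (theta i0) b \<odot> u = m"
proof (rule kset_surj)
  show "m \<in> kset M (shift (theta i0) b) {\<mu> i0 - b}"
    using swt_gws[OF assms(2)] by (intro kset_shift) (simp add: gws_iff)
  show "\<mu> i0 - b \<noteq> 0"
  proof
    assume "\<mu> i0 - b = 0"
    then have "\<nu> i0 = b - (\<mu> i0 - \<nu> i0)" by simp
    then show False using assms(1,3) i0 Ints_diff[of b "\<mu> i0 - \<nu> i0"] by (simp add: coset_def)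
  qed
  show "shift (theta i0) b \<odot> x \<in> swt M \<mu>" if "x \<in> swt M \<mu>" for x
  proof -
    have "shift (theta i0) b \<odot> x = theta i0 \<odot> x \<oplus> scal (- b) \<odot> x"
      using swt_carrier[OF that] by (simp add: shift_act M.minus_eq scal_minus_act)
    then show ?thesis using that by (simp add: swt_add swt_theta swt_scal)
  qed
qed (use assms(2) in \<open>auto intro: swt_add swt_scal swt_carrier\<close>)

text \<open>Induction on the distance of |\<mu>| from a: invertibility of \<open>theta i0\<close>,
  or of its shift, writes a weight vector as \<open>tmul i0\<close> or \<open>del i0\<close> applied
  to one whose degree is closer to a.\<close>

lemma swt_generated:
  assumes "\<mu> \<in> coset \<nu>" "m \<in> swt M \<mu>"
  shows "\<exists>d\<in>weyl. \<exists>n\<in>kset M euler {a}. m = d \<odot> n"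
proof -
  have step: "\<exists>d\<in>weyl. \<exists>n\<in>kset M euler {a}. m = d \<odot> n"
    if "e \<in> weyl" "m' \<in> carrier M" "m = e \<odot> m'" "\<exists>d\<in>weyl. \<exists>n\<in>kset M euler {a}. m' = d \<odot> n" for e m m'
  proof -
    from that obtain d n where dn: "d \<in> weyl" "n \<in> kset M euler {a}" "m' = d \<odot> n" by blast
    then have "m = (e \<circ> d) \<odot> n" using that(1,3) kset_carrier[OF dn(2)] act_comp[of e d n] by simp
    then show ?thesis using dn that(1) weyl_comp by blast
  qed
  have base: "\<exists>d\<in>weyl. \<exists>n\<in>kset M euler {a}. m = d \<odot> n" if "m \<in> swt M \<mu>" "(\<Sum>i\<in>UNIV. \<mu> i) = a" for m \<mu>
  proof -
    have "m = id \<odot> m" using swt_carrier[OF that(1)] by simp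
    then show ?thesis using swt_euler[OF that(1)] that(2) A_basic(4) by blast
  qed
  have e: "(\<lambda>i. \<mu> i + (if i = i0 then c else 0)) \<in> coset \<nu>" if "\<mu> \<in> coset \<nu>" "c \<in> \<int>" for \<mu> c
    using that by (intro coset_add) auto
  have s: "(\<Sum>i\<in>UNIV. \<mu> i + (if i = i0 then c else 0)) = (\<Sum>i\<in>UNIV. \<mu> i) + c" for \<mu> and c :: complex
    by (simp add: sum.distrib)
  have up: "\<exists>d\<in>weyl. \<exists>n\<in>kset M euler {a}. m = d \<odot> n"
    if "\<mu> \<in> coset \<nu>" "m \<in> swt M \<mu>" "(\<Sum>i\<in>UNIV. \<mu> i) = a + of_nat k" for m \<mu> k
    using that
  proof (induction k arbitrary: m \<mu>)
    case 0
    then show ?case using base by simp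
  next
    case (Suc k)
    \<comment> \<open>With b = 0 the operator is \<open>theta i0\<close>, so \<open>m\<close> is
      \<open>tmul i0\<close> applied to \<open>del i0 \<odot> u\<close>, whose degree is one
      less.\<close>
    obtain u where u: "u \<in> swt M \<mu>" "shift (theta i0) 0 \<odot> u = m"
      using theta_shift_surj[of \<mu> m 0] Suc.prems by auto
    have uc: "u \<in> carrier M" using u(1) by (rule swt_carrier)
    have "m = tmul i0 \<odot> (del i0 \<odot> u)"
      using u(2) uc by (simp add: tmul_del_act shift_def scal_zero_left)
    moreover have "\<exists>d\<in>weyl. \<exists>n\<in>kset M euler {a}. del i0 \<odot> u = d \<odot> n"
      using Suc.IH[OF e swt_del[OF u(1)]] Suc.prems s[of \<mu> "- 1"] by simp
    ultimately show ?case using step[of "tmul i0"] uc by simp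
  qed
  have down: "\<exists>d\<in>weyl. \<exists>n\<in>kset M euler {a}. m = d \<odot> n"
    if "\<mu> \<in> coset \<nu>" "m \<in> swt M \<mu>" "(\<Sum>i\<in>UNIV. \<mu> i) = a - of_nat k" for m \<mu> k
    using that
  proof (induction k arbitrary: m \<mu>)
    case 0
    then show ?case using base by simp
  next
    case (Suc k)
    \<comment> \<open>With b = - 1 the operator is \<open>del i0\<close> after
      \<open>tmul i0\<close>, so \<open>m\<close> is \<open>del i0\<close> applied to a vector whose
      degree is one more.\<close>
    obtain u where u: "u \<in> swt M \<mu>" "shift (theta i0) (- 1) \<odot> u = m"
      using theta_shift_surj[of \<mu> m "- 1"] Suc.prems by auto
    have uc: "u \<in> carrier M" using u(1) by (rule swt_carrier)
    have "m = del i0 \<odot> (tmul i0 \<odot> u)"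
      using u(2) uc by (simp add: del_tmul_act)
    moreover have "\<exists>d\<in>weyl. \<exists>n\<in>kset M euler {a}. tmul i0 \<odot> u = d \<odot> n"
      using Suc.IH[OF e swt_tmul[OF u(1)]] Suc.prems s[of \<mu> 1] by simp
    ultimately show ?case using step[of "del i0"] uc by simp
  qed
  have "(\<Sum>i\<in>UNIV. \<mu> i) - a \<in> \<int>"
    using Ints_diff[OF coset_sum[OF assms(1)] a] by simp
  then obtain z where z: "(\<Sum>i\<in>UNIV. \<mu> i) - a = of_int z" by (auto elim: Ints_cases)
  show ?thesis
  proof (cases "z \<ge> 0")
    case True
    then have "(\<Sum>i\<in>UNIV. \<mu> i) = a + of_nat (nat z)" using z by (simp add: algebra_simps)
    then show ?thesis using up assms by blast
  next
    case False
    then have "(\<Sum>i\<in>UNIV. \<mu> i) = a - of_nat (nat (- z))" using z by (simp add: algebra_simps)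
    then show ?thesis using down assms by blast
  qed
qed

text \<open>The roots of a polynomial in \<open>euler\<close> killing \<open>y\<close> are removed
  one at a time. What remains is an eigenvector of degree in a + Z; an injective power of
  \<open>del i0\<close> or \<open>tmul i0\<close> moves it to degree a, where \<open>pr\<close> is
  the identity and the hypothesis makes it zero.\<close>

lemma pr_nondegenerate:
  assumes "y \<in> carrier M" "\<And>d. d \<in> weyl \<Longrightarrow> pr (d \<odot> y) = \<zero>"
  shows "y = \<zero>"
proof -
  obtain cs where "set cs \<subseteq> {c. c - a \<in> \<int>}" "lp euler cs \<odot> y = \<zero>"
    using kset_euler[OF assms(1)] by (auto simp: kset_def)
  then show ?thesis
  proof (induction cs)
    case (Cons c cs)
    let ?z = "lp euler cs \<odot> y"
    have zc: "?z \<in> carrier M" using assms(1) by simp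
    have zp: "pr (d \<odot> ?z) = \<zero>" if "d \<in> weyl" for d
      using assms(2)[of "d \<circ> lp euler cs"] act_comp[of d "lp euler cs" y] that assms(1) by simp
    have "?z = \<zero>"
    proof -
      from Cons.prems obtain z where "c - a = of_int z" by (auto elim: Ints_cases)
      then have z: "c = a + of_int z" by (simp add: algebra_simps)
      have zk: "?z \<in> kset M euler {c}"
        using Cons.prems zc assms(1) by (intro ksetI[of _ _ "[c]"]) simp_all
      \<comment> \<open>Here \<open>z\<close> is the integer c - a and \<open>?z\<close> the
        eigenvector; an operator of degree - z takes it exactly to degree a.\<close>
      have *: "?z = \<zero>" if d: "d \<in> weyl_deg (- z)" and inj: "d \<odot> ?z = \<zero> \<Longrightarrow> ?z = \<zero>" for d
      proof -
        have dw: "d \<in> weyl" using d by (rule weyl_degD)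
        have "d \<odot> ?z \<in> kset M euler ((+) (of_int (- z)) ` {c})"
          using dw d zk by (intro kset_intertwine) (auto simp: weyl_deg_def)
        then have "d \<odot> ?z \<in> kset M euler {a}" using z by simp
        then show ?thesis using zp[OF dw] Epr_kset inj by simp
      qed
      show ?thesis
      proof (cases "z \<ge> 0")
        case True
        then have "del i0 ^^ nat z \<in> weyl_deg (- z)"
          using weyl_deg_funpow[OF del_in_weyl_deg[of i0], of "nat z"] by simp
        then show ?thesis
          by (rule *) (rule funpow_inj[OF weyl_gen(2) del_inj zc])
      next
        case False
        then have "tmul i0 ^^ nat (- z) \<in> weyl_deg (- z)"
          using weyl_deg_funpow[OF tmul_in_weyl_deg[of i0], of "nat (- z)"] by simp
        then show ?thesis
          by (rule *) (rule funpow_inj[OF weyl_gen(1) tmul_inj zc])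
      qed
    qed
    then show ?case using Cons by simp
  qed (use assms(1) in simp)
qed

end

section \<open>The degree part functor\<close>

lemma lmod_homD:
  assumes "f \<in> lmod_hom R M N"
  shows "x \<in> carrier M \<Longrightarrow> f x \<in> carrier N"
    and "x \<in> carrier M \<Longrightarrow> y \<in> carrier M \<Longrightarrow> f (x \<oplus>\<^bsub>M\<^esub> y) = f x \<oplus>\<^bsub>N\<^esub> f y"
    and "c \<in> carrier R \<Longrightarrow> x \<in> carrier M \<Longrightarrow> f (c \<odot>\<^bsub>M\<^esub> x) = c \<odot>\<^bsub>N\<^esub> f x"
    and "f \<in> extensional (carrier M)"
  using assms by (auto simp: lmod_hom_def PiE_def)

lemma lmod_homI:
  assumes "f \<in> extensional (carrier M)" "\<And>x. x \<in> carrier M \<Longrightarrow> f x \<in> carrier N"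
    and "\<And>x y. x \<in> carrier M \<Longrightarrow> y \<in> carrier M \<Longrightarrow> f (x \<oplus>\<^bsub>M\<^esub> y) = f x \<oplus>\<^bsub>N\<^esub> f y"
    and "\<And>c x. c \<in> carrier R \<Longrightarrow> x \<in> carrier M \<Longrightarrow> f (c \<odot>\<^bsub>M\<^esub> x) = c \<odot>\<^bsub>N\<^esub> f x"
  shows "f \<in> lmod_hom R M N"
  using assms by (auto simp: lmod_hom_def PiE_def)

lemma opmod_hom_zero:
  assumes "opmod A X" "opmod A Y" "f \<in> lmod_hom (oper_ring A) X Y"
  shows "f \<zero>\<^bsub>X\<^esub> = \<zero>\<^bsub>Y\<^esub>"
proof -
  interpret X: opmod A X by fact
  interpret Y: opmod A Y by fact
  note f = lmod_homD[OF assms(3)]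
  have "f (scal 0 \<odot>\<^bsub>X\<^esub> \<zero>\<^bsub>X\<^esub>) = scal 0 \<odot>\<^bsub>Y\<^esub> f \<zero>\<^bsub>X\<^esub>" by (rule f) simp_all
  then show ?thesis using f(1)[of "\<zero>\<^bsub>X\<^esub>"] by simp
qed

text \<open>Homomorphisms commute with every polynomial in T, so they preserve the roots; in
  particular they preserve degree and weight.\<close>

lemma opmod_hom_kset:
  assumes "opmod A X" "opmod A Y" "f \<in> lmod_hom (oper_ring A) X Y" "T \<in> A" "m \<in> kset X T S"
  shows "f m \<in> kset Y T S"
proof -
  interpret X: opmod A X by fact
  note f = lmod_homD[OF assms(3)]
  from assms(5) obtain cs where cs: "m \<in> carrier X" "set cs \<subseteq> S" "lp T cs \<odot>\<^bsub>X\<^esub> m = \<zero>\<^bsub>X\<^esub>"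
    by (auto simp: kset_def)
  have "lp T cs \<odot>\<^bsub>Y\<^esub> f m = f (lp T cs \<odot>\<^bsub>X\<^esub> m)"
    using f(3)[of "lp T cs" m] cs(1) assms(4) by simp
  then show ?thesis
    using cs f(1) opmod_hom_zero[OF assms(1-3)] by (intro ksetI) auto
qed

lemma sDH_mod_simps:
  "Hom (sDH_mod \<nu>) = lmod_hom (oper_ring weyl)"
  "Idt (sDH_mod \<nu>) = (\<lambda>M. \<lambda>x\<in>carrier M. x)"
  "Cmp (sDH_mod \<nu>) = (\<lambda>L M N g f. compose (carrier L) g f)"
  by (simp_all add: sDH_mod_def lmod_cat_def)

lemma sDEH_mod_simps:
  "Hom (sDEH_mod a \<nu>) = lmod_hom (oper_ring weylE)"
  "Idt (sDEH_mod a \<nu>) = (\<lambda>M. \<lambda>x\<in>carrier M. x)"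
  "Cmp (sDEH_mod a \<nu>) = (\<lambda>L M N g f. compose (carrier L) g f)"
  by (simp_all add: sDEH_mod_def lmod_cat_def)

lemma Epart_simps [simp]: "carrier (Epart a M) = kset M euler {a}" "smult (Epart a M) = smult M"
  "add (Epart a M) = add M" "zero (Epart a M) = zero M"
  by (simp_all add: Epart_def)

lemma Epart_hom:
  fixes X Y :: "('i :: finite oper, 'v) module"
  assumes "opmod weyl X" "opmod weyl Y" "f \<in> lmod_hom (oper_ring weyl) X Y"
  shows "restrict f (kset X euler {a}) \<in> lmod_hom (oper_ring weylE) (Epart a X) (Epart a Y)"
proof -
  interpret X: opmod weyl X by fact
  interpret Ea: opmod weylE "Epart a X" by (rule X.opmod_Epart)
  note f = lmod_homD[OF assms(3)]
  show ?thesis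
  proof (rule lmod_homI)
    fix x y assume x: "x \<in> carrier (Epart a X)" "y \<in> carrier (Epart a X)"
    then show "restrict f (kset X euler {a}) (x \<oplus>\<^bsub>Epart a X\<^esub> y) =
        restrict f (kset X euler {a}) x \<oplus>\<^bsub>Epart a Y\<^esub> restrict f (kset X euler {a}) y"
      using f(2)[of x y] X.kset_add[of euler x "{a}" y] by (auto dest: kset_carrier)
  next
    fix d :: "'i oper" and x assume d: "d \<in> carrier (oper_ring weylE)" "x \<in> carrier (Epart a X)"
    then have "d \<odot>\<^bsub>X\<^esub> x \<in> kset X euler {a}" using Ea.act_closed[of d x] by simp
    then show "restrict f (kset X euler {a}) (d \<odot>\<^bsub>Epart a X\<^esub> x) = d \<odot>\<^bsub>Epart a Y\<^esub> restrict f (kset X euler {a}) x"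
      using f(3)[of d x] d kset_carrier[of x X] by (auto simp: weylE_iff)
  qed (use opmod_hom_kset[OF assms] in auto)
qed

lemma cat_functor_Epart:
  "cat_functor (sDH_mod \<nu> :: (('i :: finite oper, 'v) module, 'v \<Rightarrow> 'v) cat) (sDEH_mod a \<nu>)
    (Epart a) (\<lambda>X Y f. restrict f (kset X euler {a}))" (is "cat_functor ?C ?D _ _")
proof (intro cat_functor.intro cat_functor_axioms.intro)
  show "category ?C" unfolding sDH_mod_def by (rule category_lmod_cat)
  show "category ?D" unfolding sDEH_mod_def by (rule category_lmod_cat)
  show "Epart a X \<in> Ob ?D" if "X \<in> Ob ?C" for X
    using that opmod.opmod_Epart[of weyl X a] opmod.Epart_conditions[of weyl X "coset \<nu>" a]
    unfolding sDH_mod_Ob sDEH_mod_Ob by blast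
  show "restrict f (kset X euler {a}) \<in> Hom ?D (Epart a X) (Epart a Y)"
    if "X \<in> Ob ?C" "Y \<in> Ob ?C" "f \<in> Hom ?C X Y" for X Y f
    using that unfolding sDH_mod_simps sDEH_mod_simps sDH_mod_Ob by (intro Epart_hom) auto
  show "restrict (Idt ?C X) (kset X euler {a}) = Idt ?D (Epart a X)" for X
    by (auto simp: sDH_mod_simps sDEH_mod_simps fun_eq_iff dest: kset_carrier)
  show "restrict (Cmp ?C X Y Z g f) (kset X euler {a}) =
      Cmp ?D (Epart a X) (Epart a Y) (Epart a Z) (restrict g (kset Y euler {a})) (restrict f (kset X euler {a}))"
    if "X \<in> Ob ?C" "Y \<in> Ob ?C" "Z \<in> Ob ?C" "f \<in> Hom ?C X Y" "g \<in> Hom ?C Y Z" for X Y Z f g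
  proof
    fix x
    have "f x \<in> kset Y euler {a}" if "x \<in> kset X euler {a}"
      using opmod_hom_kset[of weyl X Y f euler x] that \<open>X \<in> Ob ?C\<close> \<open>Y \<in> Ob ?C\<close> \<open>f \<in> Hom ?C X Y\<close>
      by (simp add: sDH_mod_Ob sDH_mod_simps euler_in_weyl)
    then show "restrict (Cmp ?C X Y Z g f) (kset X euler {a}) x =
      Cmp ?D (Epart a X) (Epart a Y) (Epart a Z) (restrict g (kset Y euler {a})) (restrict f (kset X euler {a})) x"
      by (auto simp: sDH_mod_simps sDEH_mod_simps compose_def dest: kset_carrier)
  qed
qed

text \<open>Every weight vector of X is an operator applied to an element of degree a, so values in
  degree a determine a homomorphism.\<close>

lemma Epart_faithful:
  fixes X Y :: "('i :: finite oper, 'v) module"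
  assumes "dobj X a \<nu> i0" "dobj Y a \<nu> i0"
    and f: "f \<in> lmod_hom (oper_ring weyl) X Y" and g: "g \<in> lmod_hom (oper_ring weyl) X Y"
    and eq: "\<And>n. n \<in> kset X euler {a} \<Longrightarrow> f n = g n"
  shows "f = g"
proof (rule extensionalityI)
  interpret X: dobj X a \<nu> i0 by fact
  interpret Y: dobj Y a \<nu> i0 by fact
  show "f x = g x" if "x \<in> carrier X" for x
    using that
  proof (induction rule: X.dobj_induct)
    case zero
    then show ?case
      using opmod_hom_zero[OF X.opmod_axioms Y.opmod_axioms f] opmod_hom_zero[OF X.opmod_axioms Y.opmod_axioms g]
      by simp
  next
    case (swt m \<mu>)
    obtain d n where dn: "d \<in> weyl" "n \<in> kset X euler {a}" "m = d \<odot>\<^bsub>X\<^esub> n"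
      using X.swt_generated[OF swt] by blast
    then show ?case
      using lmod_homD(3)[OF f, of d n] lmod_homD(3)[OF g, of d n] eq kset_carrier[OF dn(2)] by simp
  next
    case (add m m')
    then show ?case using lmod_homD(2)[OF f] lmod_homD(2)[OF g] by simp
  qed
qed (use lmod_homD(4)[OF f] lmod_homD(4)[OF g] in auto)

text \<open>The extension of \<open>g\<close> is defined by its graph: \<open>m'\<close> is the image of \<open>m\<close> if \<open>g\<close> maps the
  degree \<open>a\<close> part of \<open>d m\<close> to that of \<open>d m'\<close>, for all differential operators \<open>d\<close>.\<close>

lemma Epart_full:
  fixes X Y :: "('i :: finite oper, 'v) module"
  assumes "dobj X a \<nu> i0" "dobj Y a \<nu> i0"
    and g: "g \<in> lmod_hom (oper_ring weylE) (Epart a X) (Epart a Y)"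
  shows "\<exists>f \<in> lmod_hom (oper_ring weyl) X Y. restrict f (kset X euler {a}) = g"
proof -
  interpret X: dobj X a \<nu> i0 by fact
  interpret Y: dobj Y a \<nu> i0 by fact
  have g_closed: "g n \<in> kset Y euler {a}" if "n \<in> kset X euler {a}" for n
    using lmod_homD(1)[OF g, of n] that by simp
  have g_add: "g (n \<oplus>\<^bsub>X\<^esub> n') = g n \<oplus>\<^bsub>Y\<^esub> g n'" if "n \<in> kset X euler {a}" "n' \<in> kset X euler {a}" for n n'
    using lmod_homD(2)[OF g, of n n'] that by simp
  have g_act: "g (d \<odot>\<^bsub>X\<^esub> n) = d \<odot>\<^bsub>Y\<^esub> g n" if "d \<in> weylE" "n \<in> kset X euler {a}" for d n
    using lmod_homD(3)[OF g, of d n] that by simp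
  define R where "R m m' \<longleftrightarrow> m' \<in> carrier Y \<and> (\<forall>d\<in>weyl. g (X.pr (d \<odot>\<^bsub>X\<^esub> m)) = Y.pr (d \<odot>\<^bsub>Y\<^esub> m'))" for m m'
  have R_add: "R (m \<oplus>\<^bsub>X\<^esub> n) (m' \<oplus>\<^bsub>Y\<^esub> n')"
    if "R m m'" "R n n'" "m \<in> carrier X" "n \<in> carrier X" for m n m' n'
    using that by (simp add: R_def X.act_add_right Y.act_add_right X.pr_add Y.pr_add g_add X.pr_closed)
  have R_act: "R (e \<odot>\<^bsub>X\<^esub> m) (e \<odot>\<^bsub>Y\<^esub> m')" if "R m m'" "m \<in> carrier X" "e \<in> weyl"
    for e :: "'i oper" and m m'
    unfolding R_def
  proof (intro conjI ballI)
    show "e \<odot>\<^bsub>Y\<^esub> m' \<in> carrier Y" using that by (simp add: R_def)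
    fix d :: "'i oper" assume d: "d \<in> weyl"
    then have "d \<circ> e \<in> weyl" using that(3) by (rule weyl_comp)
    then have "g (X.pr ((d \<circ> e) \<odot>\<^bsub>X\<^esub> m)) = Y.pr ((d \<circ> e) \<odot>\<^bsub>Y\<^esub> m')" using that(1) by (simp only: R_def)
    then show "g (X.pr (d \<odot>\<^bsub>X\<^esub> (e \<odot>\<^bsub>X\<^esub> m))) = Y.pr (d \<odot>\<^bsub>Y\<^esub> (e \<odot>\<^bsub>Y\<^esub> m'))"
      using that d X.act_comp[of d e m] Y.act_comp[of d e m'] by (simp only: R_def)
  qed
  \<comment> \<open>On degree a both projections become \<open>proj0 d\<close>, and this operator
    lies in \<open>weylE\<close>, over which \<open>g\<close> is linear.\<close>
  have R_E: "R n (g n)" if n: "n \<in> kset X euler {a}" for n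
    unfolding R_def
  proof (intro conjI ballI)
    show "g n \<in> carrier Y" using kset_carrier[OF g_closed[OF n]] .
    fix d :: "'i oper" assume d: "d \<in> weyl"
    show "g (X.pr (d \<odot>\<^bsub>X\<^esub> n)) = Y.pr (d \<odot>\<^bsub>Y\<^esub> g n)"
      using X.Epr_weyl_act[OF d n] Y.Epr_weyl_act[OF d g_closed[OF n]] g_act[OF proj0_in_weylE[OF d] n]
      by simp
  qed
  have R_zero: "R \<zero>\<^bsub>X\<^esub> \<zero>\<^bsub>Y\<^esub>"
  proof -
    have "g \<zero>\<^bsub>X\<^esub> = \<zero>\<^bsub>Y\<^esub>"
      using opmod_hom_zero[OF X.opmod_Epart Y.opmod_Epart g] by simp
    then show ?thesis using R_E[OF X.kset_zero] by simp
  qed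
  \<comment> \<open>Existence of an image uses that X is generated in degree a: the relation is
    stable under sums and under the action of \<open>weyl\<close>.\<close>
  have R_ex: "\<exists>m'. R m m'" if "m \<in> carrier X" for m
    using that
  proof (induction rule: X.dobj_induct)
    case zero
    show ?case using R_zero by blast
  next
    case (swt m \<mu>)
    obtain d n where dn: "d \<in> weyl" "n \<in> kset X euler {a}" "m = d \<odot>\<^bsub>X\<^esub> n"
      using X.swt_generated[OF swt] by blast
    then show ?case using R_act[OF R_E] kset_carrier[OF dn(2)] by blast
  next
    case (add m m')
    then show ?case using R_add by blast
  qed
  \<comment> \<open>Two candidates differ by an element of Y whose whole orbit under
    \<open>weyl\<close> has degree a part zero; \<open>pr_nondegenerate\<close> makes it
    vanish.\<close>
  have R_unique: "m' = m''" if "R m m'" "R m m''" for m m' m''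
  proof -
    have c: "m' \<in> carrier Y" "m'' \<in> carrier Y" using that by (auto simp: R_def)
    let ?y = "m' \<oplus>\<^bsub>Y\<^esub> scal (- 1) \<odot>\<^bsub>Y\<^esub> m''"
    have "Y.pr (d \<odot>\<^bsub>Y\<^esub> ?y) = \<zero>\<^bsub>Y\<^esub>" if d: "d \<in> weyl" for d
    proof -
      have "Y.pr (d \<odot>\<^bsub>Y\<^esub> ?y) = Y.pr (d \<odot>\<^bsub>Y\<^esub> m') \<oplus>\<^bsub>Y\<^esub> scal (- 1) \<odot>\<^bsub>Y\<^esub> Y.pr (d \<odot>\<^bsub>Y\<^esub> m'')"
        using d c by (simp add: Y.act_add_right Y.pr_add Y.pr_weylE[OF scal_in_weylE] Y.scal_act_comm)
      moreover have "Y.pr (d \<odot>\<^bsub>Y\<^esub> m') = Y.pr (d \<odot>\<^bsub>Y\<^esub> m'')"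
        using \<open>R m m'\<close> \<open>R m m''\<close> d unfolding R_def by metis
      ultimately show ?thesis using d c by (simp add: Y.scal_minus_act Y.r_neg)
    qed
    moreover have "?y \<in> carrier Y" using c by simp
    ultimately have "?y = \<zero>\<^bsub>Y\<^esub>" by (rule Y.pr_nondegenerate[rotated])
    then show ?thesis
      using c Y.M.minus_eq_zero_iff[of m' m''] by (simp add: Y.scal_minus_act Y.M.minus_eq)
  qed
  define f where "f = (\<lambda>m\<in>carrier X. THE m'. R m m')"
  have f_eq: "f m = m'" if "m \<in> carrier X" "R m m'" for m m'
    using that R_unique by (auto simp: f_def intro!: the_equality)
  have f_R: "R m (f m)" if "m \<in> carrier X" for m
    using R_ex[OF that] f_eq[OF that] by blast
  have "f \<in> lmod_hom (oper_ring weyl) X Y"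
  proof (rule lmod_homI)
    show "f x \<in> carrier Y" if "x \<in> carrier X" for x using f_R[OF that] by (simp add: R_def)
    show "f (x \<oplus>\<^bsub>X\<^esub> y) = f x \<oplus>\<^bsub>Y\<^esub> f y" if "x \<in> carrier X" "y \<in> carrier X" for x y
      using that by (intro f_eq R_add f_R) simp_all
    show "f (d \<odot>\<^bsub>X\<^esub> x) = d \<odot>\<^bsub>Y\<^esub> f x" if "d \<in> carrier (oper_ring weyl)" "x \<in> carrier X" for d x
      using that by (intro f_eq R_act f_R) simp_all
  qed (simp add: f_def)
  moreover have "restrict f (kset X euler {a}) = g"
  proof (rule extensionalityI)
    show "g \<in> extensional (kset X euler {a})" using lmod_homD(4)[OF g] by simp
    show "restrict f (kset X euler {a}) x = g x" if "x \<in> kset X euler {a}" for x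
      using f_eq[OF kset_carrier[OF that] R_E[OF that]] that by simp
  qed simp
  ultimately show ?thesis by blast
qed

section \<open>Induced modules\<close>

unbundle cardinal_syntax

lemma finite_ordLeq_infinite: "finite A \<Longrightarrow> infinite B \<Longrightarrow> |A| \<le>o |B|"
  by (intro ordLess_imp_ordLeq finite_ordLess_infinite) (auto simp: Field_card_of card_of_well_order_on)

text \<open>The Boolean argument selects one of two operations, so that a single cardinality bound
  covers both sum and composition of operators as well as addition alone.\<close>

inductive_set binary_closure :: "(bool \<Rightarrow> 'a \<Rightarrow> 'a \<Rightarrow> 'a) \<Rightarrow> 'a set \<Rightarrow> 'a set" for f G where
  base: "x \<in> G \<Longrightarrow> x \<in> binary_closure f G"
| step: "x \<in> binary_closure f G \<Longrightarrow> y \<in> binary_closure f G \<Longrightarrow> f b x y \<in> binary_closure f G"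

text \<open>The closure is a countable union of stages, and each stage adds two images of the square
  of the previous one; an infinite cardinal absorbs all of this.\<close>

lemma card_of_binary_closure:
  fixes f :: "bool \<Rightarrow> 'a \<Rightarrow> 'a \<Rightarrow> 'a" and K :: "'b set"
  assumes K: "infinite K" and G: "|G| \<le>o |K|"
  shows "|binary_closure f G| \<le>o |K|"
proof -
  define S where "S = rec_nat G (\<lambda>_ A. A \<union> ((\<lambda>(x, y). f True x y) ` (A \<times> A) \<union> (\<lambda>(x, y). f False x y) ` (A \<times> A)))"
  have S0: "S 0 = G" and SSuc: "S (Suc n) = S n \<union> ((\<lambda>(x, y). f True x y) ` (S n \<times> S n) \<union>
    (\<lambda>(x, y). f False x y) ` (S n \<times> S n))" for n
    by (simp_all add: S_def)
  have KF: "infinite (Field |K| )" using K by (simp add: Field_card_of)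
  have "|S n| \<le>o |K|" for n
  proof (induction n)
    case (Suc n)
    then have "|S n \<times> S n| \<le>o |K|"
      by (intro card_of_Times_ordLeq_infinite_Field[OF KF]) (auto simp: card_of_Card_order)
    then have im: "|h ` (S n \<times> S n)| \<le>o |K|" for h :: "_ \<Rightarrow> 'a"
      using card_of_image ordLeq_transitive by blast
    show ?case
      unfolding SSuc by (intro card_of_Un_ordLeq_infinite_Field[OF KF] im Suc card_of_Card_order)
  qed (use G S0 in simp)
  then have U: "|\<Union>n\<in>UNIV. S n| \<le>o |K|"
    using K by (intro card_of_UNION_ordLeq_infinite) (auto simp: infinite_iff_card_of_nat)
  have mono: "S m \<subseteq> S n" if "m \<le> n" for m n
    using that by (rule lift_Suc_mono_le[rotated]) (simp add: SSuc)
  have "x \<in> (\<Union>n\<in>UNIV. S n)" if "x \<in> binary_closure f G" for x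
    using that
  proof induction
    case (base x)
    then show ?case using S0 by blast
  next
    case (step x y b)
    then obtain m n where "x \<in> S m" "y \<in> S n" by blast
    then have "x \<in> S (max m n)" "y \<in> S (max m n)"
      using mono[of m "max m n"] mono[of n "max m n"] by auto
    then have xy: "(x, y) \<in> S (max m n) \<times> S (max m n)" by blast
    have "f b x y \<in> S (Suc (max m n))"
      unfolding SSuc using imageI[OF xy, of "\<lambda>(x, y). f True x y"] imageI[OF xy, of "\<lambda>(x, y). f False x y"]
      by (cases b) simp_all
    then show ?case by blast
  qed
  then have "binary_closure f G \<subseteq> (\<Union>n\<in>UNIV. S n)" by blast
  then show ?thesis using U card_of_mono1 ordLeq_transitive by blast
qed

text \<open>Apart from the scalars there are finitely many generators, and sums and composites do
  not raise an infinite cardinality.\<close>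

lemma card_of_weyl: "|weyl :: ('i :: finite) oper set| \<le>o |UNIV :: complex set|"
proof -
  define f :: "bool \<Rightarrow> 'i oper \<Rightarrow> 'i oper \<Rightarrow> 'i oper"
    where "f b = (if b then (\<lambda>d e p. d p + e p) else (\<circ>))" for b
  let ?G = "range scal \<union> (range tmul \<union> range del) :: 'i oper set"
  have inf: "infinite (UNIV :: complex set)" by (rule infinite_UNIV_char_0)
  have fin: "|range tmul \<union> range del :: 'i oper set| \<le>o |UNIV :: complex set|"
    using inf by (intro finite_ordLeq_infinite) auto
  have "infinite (Field |UNIV :: complex set| )" using inf by (simp add: Field_card_of)
  then have "|?G| \<le>o |UNIV :: complex set|"
    by (intro card_of_Un_ordLeq_infinite_Field[OF _ card_of_image fin] card_of_Card_order)
  then have "|binary_closure f ?G| \<le>o |UNIV :: complex set|"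
    by (rule card_of_binary_closure[OF inf])
  moreover have "d \<in> binary_closure f ?G" if "d \<in> weyl" for d
    using that unfolding weyl_def
  proof (induction rule: gen_algebra.induct)
    case (add d e)
    then have "f True d e \<in> binary_closure f ?G" by (intro binary_closure.step)
    moreover have "f True d e = (\<lambda>p. d p + e p)" by (simp add: f_def)
    ultimately show ?case by metis
  next
    case (comp d e)
    then have "f False d e \<in> binary_closure f ?G" by (intro binary_closure.step)
    moreover have "f False d e = d \<circ> e" by (simp add: f_def)
    ultimately show ?case by metis
  qed (auto intro: binary_closure.base)
  then have "weyl \<subseteq> binary_closure f ?G" by blast
  ultimately show ?thesis using card_of_mono1 ordLeq_transitive by blast
qed

text \<open>Transport of structure along an injection moves a module of functions on operators back
  to the universe type.\<close>

lemma left_module_transport: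
  fixes M :: "('r, 'w) module" and h :: "'w \<Rightarrow> 'v"
  assumes M: "left_module R M" and h: "inj_on h (carrier M)"
  shows "\<exists>M' :: ('r, 'v) module. left_module R M' \<and> carrier M' = h ` carrier M \<and> \<zero>\<^bsub>M'\<^esub> = h \<zero>\<^bsub>M\<^esub> \<and>
    (\<forall>x\<in>carrier M. \<forall>y\<in>carrier M. h x \<oplus>\<^bsub>M'\<^esub> h y = h (x \<oplus>\<^bsub>M\<^esub> y)) \<and>
    (\<forall>a. \<forall>x\<in>carrier M. a \<odot>\<^bsub>M'\<^esub> h x = h (a \<odot>\<^bsub>M\<^esub> x))"
proof -
  interpret left_module R M by fact
  let ?k = "the_inv_into (carrier M) h"
  define M' :: "('r, 'v) module" where "M' = \<lparr>carrier = h ` carrier M, mult = (\<lambda>x y. x),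
    one = h \<zero>\<^bsub>M\<^esub>, zero = h \<zero>\<^bsub>M\<^esub>, add = (\<lambda>x y. h (?k x \<oplus>\<^bsub>M\<^esub> ?k y)), smult = (\<lambda>a x. h (a \<odot>\<^bsub>M\<^esub> ?k x))\<rparr>"
  have k: "?k (h x) = x" if "x \<in> carrier M" for x using h that by (rule the_inv_into_f_f)
  have c: "carrier M' = h ` carrier M" and z: "\<zero>\<^bsub>M'\<^esub> = h \<zero>\<^bsub>M\<^esub>" by (simp_all add: M'_def)
  have add: "h x \<oplus>\<^bsub>M'\<^esub> h y = h (x \<oplus>\<^bsub>M\<^esub> y)" if "x \<in> carrier M" "y \<in> carrier M" for x y
    using that by (simp add: M'_def k)
  have act: "a \<odot>\<^bsub>M'\<^esub> h x = h (a \<odot>\<^bsub>M\<^esub> x)" if "x \<in> carrier M" for a x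
    using that by (simp add: M'_def k)
  have "abelian_group M'"
  proof (rule abelian_groupI)
    fix x assume "x \<in> carrier M'"
    then obtain y where y: "y \<in> carrier M" "x = h y" by (auto simp: c)
    then have "h (\<ominus>\<^bsub>M\<^esub> y) \<oplus>\<^bsub>M'\<^esub> x = \<zero>\<^bsub>M'\<^esub>" by (simp add: add z M.l_neg)
    then show "\<exists>y\<in>carrier M'. y \<oplus>\<^bsub>M'\<^esub> x = \<zero>\<^bsub>M'\<^esub>" using y by (auto simp: c)
  qed (auto simp: c z add M.a_ac)
  then have "left_module R M'"
    by (intro left_module.intro left_module_axioms.intro R.ring_axioms)
      (auto simp: c add act smult_closed smult_l_distr smult_r_distr smult_assoc smult_one)
  then show ?thesis using c z add act by blast
qed

text \<open>The coinduced module, without the condition of \<open>\<D>\<^sup>E\<close>-linearity: the submodule \<open>induced\<close> below consists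
  of \<open>\<D>\<^sup>E\<close>-linear maps anyway.\<close>

definition weyl_maps :: "('i oper, 'v) module \<Rightarrow> ('i oper, 'i oper \<Rightarrow> 'v) module" where
  "weyl_maps N = \<lparr>carrier = {\<phi> \<in> extensional weyl. (\<forall>d\<in>weyl. \<phi> d \<in> carrier N) \<and>
      (\<forall>d\<in>weyl. \<forall>e\<in>weyl. \<phi> (\<lambda>p. d p + e p) = \<phi> d \<oplus>\<^bsub>N\<^esub> \<phi> e)},
    mult = (\<lambda>\<phi> \<psi>. \<phi>), one = (\<lambda>d\<in>weyl. \<zero>\<^bsub>N\<^esub>), zero = (\<lambda>d\<in>weyl. \<zero>\<^bsub>N\<^esub>),
    add = (\<lambda>\<phi> \<psi>. \<lambda>d\<in>weyl. \<phi> d \<oplus>\<^bsub>N\<^esub> \<psi> d), smult = (\<lambda>e \<phi>. \<lambda>d\<in>weyl. \<phi> (d \<circ> e))\<rparr>"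

text \<open>Operators act by right multiplication in the argument, which reverses the order once
  more and so gives a left action.\<close>

lemma left_module_weyl_maps:
  fixes N :: "('i oper, 'v) module"
  assumes "abelian_group N"
  shows "left_module (oper_ring weyl) (weyl_maps N)"
proof -
  interpret N: abelian_group N by fact
  let ?W = "weyl_maps N"
  have c: "\<phi> d \<in> carrier N" "\<phi> (\<lambda>p. d p + e p) = \<phi> d \<oplus>\<^bsub>N\<^esub> \<phi> e" "\<phi> \<in> extensional weyl"
    if "\<phi> \<in> carrier ?W" "d \<in> weyl" "e \<in> weyl" for \<phi> d e
    using that by (auto simp: weyl_maps_def)
  have ext: "\<phi> = \<psi>" if "\<phi> \<in> extensional weyl" "\<psi> \<in> extensional weyl" "\<And>d. d \<in> weyl \<Longrightarrow> \<phi> d = \<psi> d"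
    for \<phi> \<psi> :: "'i oper \<Rightarrow> 'v"
    using that by (rule extensionalityI)
  have cE: "\<phi> \<in> extensional weyl" if "\<phi> \<in> carrier ?W" for \<phi>
    using that by (auto simp: weyl_maps_def)
  have add_ext: "\<phi> \<oplus>\<^bsub>?W\<^esub> \<psi> \<in> extensional weyl" and add: "d \<in> weyl \<Longrightarrow> (\<phi> \<oplus>\<^bsub>?W\<^esub> \<psi>) d = \<phi> d \<oplus>\<^bsub>N\<^esub> \<psi> d" for \<phi> \<psi> d
    by (simp_all add: weyl_maps_def)
  have smult_ext: "e \<odot>\<^bsub>?W\<^esub> \<phi> \<in> extensional weyl" and smult: "d \<in> weyl \<Longrightarrow> (e \<odot>\<^bsub>?W\<^esub> \<phi>) d = \<phi> (d \<circ> e)" for e \<phi> d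
    by (simp_all add: weyl_maps_def)
  have zero_ext: "\<zero>\<^bsub>?W\<^esub> \<in> extensional weyl" and zero: "d \<in> weyl \<Longrightarrow> \<zero>\<^bsub>?W\<^esub> d = \<zero>\<^bsub>N\<^esub>" for d
    by (simp_all add: weyl_maps_def)
  have I: "\<phi> \<in> carrier ?W" if "\<phi> \<in> extensional weyl" "\<And>d. d \<in> weyl \<Longrightarrow> \<phi> d \<in> carrier N"
    "\<And>d e. d \<in> weyl \<Longrightarrow> e \<in> weyl \<Longrightarrow> \<phi> (\<lambda>p. d p + e p) = \<phi> d \<oplus>\<^bsub>N\<^esub> \<phi> e" for \<phi>
    using that by (simp add: weyl_maps_def)
  have add_closed: "\<phi> \<oplus>\<^bsub>?W\<^esub> \<psi> \<in> carrier ?W" if "\<phi> \<in> carrier ?W" "\<psi> \<in> carrier ?W" for \<phi> \<psi>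
    using that by (intro I) (simp_all add: add_ext add weyl_add c N.a_ac)
  have "abelian_group ?W"
  proof (rule abelian_groupI)
    fix \<phi> assume \<phi>: "\<phi> \<in> carrier ?W"
    have "(\<lambda>d\<in>weyl. \<ominus>\<^bsub>N\<^esub> \<phi> d) \<in> carrier ?W"
      using \<phi> by (intro I) (simp_all add: c weyl_add N.minus_add)
    moreover have "(\<lambda>d\<in>weyl. \<ominus>\<^bsub>N\<^esub> \<phi> d) \<oplus>\<^bsub>?W\<^esub> \<phi> = \<zero>\<^bsub>?W\<^esub>"
      using \<phi> by (intro ext add_ext zero_ext) (simp add: add zero c N.l_neg)
    ultimately show "\<exists>\<psi>\<in>carrier ?W. \<psi> \<oplus>\<^bsub>?W\<^esub> \<phi> = \<zero>\<^bsub>?W\<^esub>" by blast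
  next
    show "\<zero>\<^bsub>?W\<^esub> \<in> carrier ?W" by (intro I zero_ext) (simp_all add: zero weyl_add)
    show "\<zero>\<^bsub>?W\<^esub> \<oplus>\<^bsub>?W\<^esub> \<phi> = \<phi>" if "\<phi> \<in> carrier ?W" for \<phi>
      using that by (intro ext add_ext cE) (simp_all add: add zero c)
    show "(\<phi> \<oplus>\<^bsub>?W\<^esub> \<psi>) \<oplus>\<^bsub>?W\<^esub> \<chi> = \<phi> \<oplus>\<^bsub>?W\<^esub> (\<psi> \<oplus>\<^bsub>?W\<^esub> \<chi>)"
      if "\<phi> \<in> carrier ?W" "\<psi> \<in> carrier ?W" "\<chi> \<in> carrier ?W" for \<phi> \<psi> \<chi>
      using that by (intro ext add_ext) (simp_all add: add c N.a_assoc)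
    show "\<phi> \<oplus>\<^bsub>?W\<^esub> \<psi> = \<psi> \<oplus>\<^bsub>?W\<^esub> \<phi>" if "\<phi> \<in> carrier ?W" "\<psi> \<in> carrier ?W" for \<phi> \<psi>
      using that by (intro ext add_ext) (simp_all add: add c N.a_comm)
  qed (rule add_closed)
  moreover have smult_closed: "e \<odot>\<^bsub>?W\<^esub> \<phi> \<in> carrier ?W" if e: "e \<in> weyl" and \<phi>: "\<phi> \<in> carrier ?W" for e \<phi>
  proof (rule I[OF smult_ext])
    show "(e \<odot>\<^bsub>?W\<^esub> \<phi>) d \<in> carrier N" if "d \<in> weyl" for d
      unfolding smult[OF that] using \<phi> weyl_comp[OF that e] weyl_comp[OF that e] by (rule c)
    show "(e \<odot>\<^bsub>?W\<^esub> \<phi>) (\<lambda>p. d p + d' p) = (e \<odot>\<^bsub>?W\<^esub> \<phi>) d \<oplus>\<^bsub>N\<^esub> (e \<odot>\<^bsub>?W\<^esub> \<phi>) d'"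
      if "d \<in> weyl" "d' \<in> weyl" for d d'
    proof -
      have "(\<lambda>p. d p + d' p) \<circ> e = (\<lambda>p. (d \<circ> e) p + (d' \<circ> e) p)" by auto
      then have "\<phi> ((\<lambda>p. d p + d' p) \<circ> e) = \<phi> (\<lambda>p. (d \<circ> e) p + (d' \<circ> e) p)" by (rule arg_cong)
      also have "\<dots> = \<phi> (d \<circ> e) \<oplus>\<^bsub>N\<^esub> \<phi> (d' \<circ> e)"
        by (rule c(2)[OF \<phi> weyl_comp[OF that(1) e] weyl_comp[OF that(2) e]])
      finally show ?thesis
        unfolding smult[OF that(1)] smult[OF that(2)] smult[OF weyl_add[OF that]] .
    qed
  qed
  moreover have "(\<lambda>p. e p + e' p) \<odot>\<^bsub>?W\<^esub> \<phi> = e \<odot>\<^bsub>?W\<^esub> \<phi> \<oplus>\<^bsub>?W\<^esub> e' \<odot>\<^bsub>?W\<^esub> \<phi>"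
    if e: "e \<in> weyl" "e' \<in> weyl" and \<phi>: "\<phi> \<in> carrier ?W" for e e' \<phi>
  proof (rule ext[OF smult_ext add_ext])
    fix d :: "'i oper" assume d: "d \<in> weyl"
    have "d \<circ> (\<lambda>p. e p + e' p) = (\<lambda>p. (d \<circ> e) p + (d \<circ> e') p)"
      using d by (auto simp: weyl_additive)
    then have "\<phi> (d \<circ> (\<lambda>p. e p + e' p)) = \<phi> (\<lambda>p. (d \<circ> e) p + (d \<circ> e') p)" by (rule arg_cong)
    also have "\<dots> = \<phi> (d \<circ> e) \<oplus>\<^bsub>N\<^esub> \<phi> (d \<circ> e')"
      by (rule c(2)[OF \<phi> weyl_comp[OF d e(1)] weyl_comp[OF d e(2)]])
    finally show "((\<lambda>p. e p + e' p) \<odot>\<^bsub>?W\<^esub> \<phi>) d = (e \<odot>\<^bsub>?W\<^esub> \<phi> \<oplus>\<^bsub>?W\<^esub> e' \<odot>\<^bsub>?W\<^esub> \<phi>) d"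
      unfolding add[OF d] smult[OF d] .
  qed
  moreover have "e \<odot>\<^bsub>?W\<^esub> (\<phi> \<oplus>\<^bsub>?W\<^esub> \<psi>) = e \<odot>\<^bsub>?W\<^esub> \<phi> \<oplus>\<^bsub>?W\<^esub> e \<odot>\<^bsub>?W\<^esub> \<psi>"
    if e: "e \<in> weyl" for e \<phi> \<psi>
  proof (rule ext[OF smult_ext add_ext])
    fix d :: "'i oper" assume d: "d \<in> weyl"
    show "(e \<odot>\<^bsub>?W\<^esub> (\<phi> \<oplus>\<^bsub>?W\<^esub> \<psi>)) d = (e \<odot>\<^bsub>?W\<^esub> \<phi> \<oplus>\<^bsub>?W\<^esub> e \<odot>\<^bsub>?W\<^esub> \<psi>) d"
      unfolding add[OF d] smult[OF d] using weyl_comp[OF d e] by (rule add)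
  qed
  moreover have "(e \<circ> e') \<odot>\<^bsub>?W\<^esub> \<phi> = e \<odot>\<^bsub>?W\<^esub> (e' \<odot>\<^bsub>?W\<^esub> \<phi>)" if e: "e \<in> weyl" for e e' \<phi>
  proof (rule ext[OF smult_ext smult_ext])
    fix d :: "'i oper" assume d: "d \<in> weyl"
    show "((e \<circ> e') \<odot>\<^bsub>?W\<^esub> \<phi>) d = (e \<odot>\<^bsub>?W\<^esub> (e' \<odot>\<^bsub>?W\<^esub> \<phi>)) d"
      unfolding smult[OF d] smult[OF weyl_comp[OF d e]] comp_assoc ..
  qed
  moreover have "id \<odot>\<^bsub>?W\<^esub> \<phi> = \<phi>" if \<phi>: "\<phi> \<in> carrier ?W" for \<phi>
    by (rule ext[OF smult_ext cE[OF \<phi>]]) (simp add: smult)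
  ultimately show ?thesis
    by (intro left_module.intro left_module_axioms.intro ring_weyl) simp_all
qed

text \<open>The embedding of N into the coinduced module that comes from the projection of
  \<open>weyl\<close> onto its degree zero part.\<close>

definition unit_map :: "('i :: finite oper, 'v) module \<Rightarrow> 'v \<Rightarrow> 'i oper \<Rightarrow> 'v" where
  "unit_map N n = (\<lambda>d\<in>weyl. proj0 d \<odot>\<^bsub>N\<^esub> n)"

definition induced_gens :: "('i :: finite oper, 'v) module \<Rightarrow> ('i oper \<Rightarrow> 'v) set" where
  "induced_gens N = (\<lambda>(d, n). d \<odot>\<^bsub>weyl_maps N\<^esub> unit_map N n) ` (weyl \<times> carrier N)"

text \<open>The submodule generated by the maps \<open>d \<mapsto> d\<^sub>0 n\<close>, where \<open>d\<^sub>0\<close> is the degree zero component of \<open>d\<close>.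
  It is the image of \<open>\<D> \<otimes> N\<close> in the coinduced module.\<close>

definition induced :: "('i :: finite oper, 'v) module \<Rightarrow> ('i oper, 'i oper \<Rightarrow> 'v) module" where
  "induced N = (weyl_maps N)\<lparr>carrier := addspan (weyl_maps N) (induced_gens N)\<rparr>"

context
  fixes N :: "('i :: finite oper, 'v) module" (structure)
  assumes N: "opmod weylE N"
begin

interpretation N: opmod weylE N by (rule N)

interpretation W: left_module "oper_ring weyl" "weyl_maps N"
  by (rule left_module_weyl_maps) (rule N.M.abelian_group_axioms)

lemma unit_map_closed:
  assumes "n \<in> carrier N"
  shows "unit_map N n \<in> carrier (weyl_maps N)"
  using assms
  by (auto simp: unit_map_def weyl_maps_def proj0_in_weylE weyl_add proj0_add N.act_add)

lemma unit_map_add: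
  "n \<in> carrier N \<Longrightarrow> n' \<in> carrier N \<Longrightarrow>
    unit_map N (n \<oplus> n') = unit_map N n \<oplus>\<^bsub>weyl_maps N\<^esub> unit_map N n'"
  by (auto simp: unit_map_def weyl_maps_def proj0_in_weylE N.act_add_right)

text \<open>This is the right linearity of \<open>proj0\<close> over \<open>weylE\<close>, evaluated
  on \<open>n\<close>.\<close>

lemma unit_map_weylE:
  assumes "e \<in> weylE" "n \<in> carrier N"
  shows "unit_map N (e \<odot> n) = e \<odot>\<^bsub>weyl_maps N\<^esub> unit_map N n"
proof -
  have e: "e \<in> weyl" using assms(1) by (simp add: weylE_iff)
  have "proj0 d \<odot> (e \<odot> n) = proj0 (d \<circ> e) \<odot> n" if "d \<in> weyl" for d
    unfolding proj0_comp_weylE[OF that assms(1)]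
    using N.act_comp[OF proj0_in_weylE[OF that] assms] by (rule sym)
  then show ?thesis
    using weyl_comp[OF _ e] by (auto simp: unit_map_def weyl_maps_def fun_eq_iff)
qed

text \<open>Evaluation at \<open>id\<close> recovers \<open>n\<close>, because \<open>id\<close> is
  its own degree zero part.\<close>

lemma unit_map_inj: "inj_on (unit_map N) (carrier N)"
proof (rule inj_onI)
  fix n n' assume n: "n \<in> carrier N" "n' \<in> carrier N" and eq: "unit_map N n = unit_map N n'"
  have "(id :: 'i oper) \<in> weylE" by (rule N.A_basic(4))
  then have "proj0 id = (id :: 'i oper)" "(id :: 'i oper) \<in> weyl"
    by (rule proj0_weylE, simp add: weylE_iff)
  then show "n = n'" using fun_cong[OF eq, of id] n by (simp add: unit_map_def)
qed

lemma induced_gens_closed: "induced_gens N \<subseteq> carrier (weyl_maps N)"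
proof -
  have "d \<odot>\<^bsub>weyl_maps N\<^esub> unit_map N n \<in> carrier (weyl_maps N)" if "d \<in> weyl" "n \<in> carrier N" for d n
    using W.smult_closed[of d "unit_map N n"] that unit_map_closed by simp
  then show ?thesis by (auto simp: induced_gens_def)
qed

lemma left_module_induced: "left_module (oper_ring weyl) (induced N)"
  unfolding induced_def
proof (rule W.left_module_restrict)
  let ?S = "addspan (weyl_maps N) (induced_gens N)"
  show "?S \<subseteq> carrier (weyl_maps N)" using W.addspan_closed[OF induced_gens_closed] by blast
  show "e \<odot>\<^bsub>weyl_maps N\<^esub> x \<in> ?S" if e: "e \<in> carrier (oper_ring weyl)" and x: "x \<in> ?S" for e x
  proof (rule W.addspan_smult[OF induced_gens_closed e _ x])
    fix y assume "y \<in> induced_gens N"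
    then obtain d n where y: "d \<in> weyl" "n \<in> carrier N" "y = d \<odot>\<^bsub>weyl_maps N\<^esub> unit_map N n"
      by (auto simp: induced_gens_def)
    have "e \<odot>\<^bsub>weyl_maps N\<^esub> y = (e \<circ> d) \<odot>\<^bsub>weyl_maps N\<^esub> unit_map N n"
      using W.smult_assoc[of e d "unit_map N n"] y e unit_map_closed by simp
    also have "\<dots> \<in> induced_gens N"
      unfolding induced_gens_def using e y weyl_comp[of e d] by (intro rev_image_eqI[of "(e \<circ> d, n)"]) simp_all
    finally show "e \<odot>\<^bsub>weyl_maps N\<^esub> y \<in> ?S" by (rule addspan.incl)
  qed
qed (auto intro: addspan.intros)

text \<open>A nonzero N contains a complex line, so it is infinite and at least as large as
  \<open>weyl\<close>. The generators are indexed by \<open>weyl\<close> \<times> N, and finite sums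
  keep the bound. If N is zero, so is the induced module, and any map is injective on it.\<close>

lemma induced_embeds: "\<exists>h :: _ \<Rightarrow> 'v. inj_on h (carrier (induced N))"
proof (cases "carrier N = {\<zero>}")
  case True
  have W0: "\<phi> = \<zero>\<^bsub>weyl_maps N\<^esub>" if "\<phi> \<in> carrier (weyl_maps N)" for \<phi>
    using that True by (intro extensionalityI[of _ weyl]) (auto simp: weyl_maps_def)
  have "\<phi> = \<zero>\<^bsub>weyl_maps N\<^esub>" if "\<phi> \<in> carrier (induced N)" for \<phi>
    using that by (intro W0 W.addspan_closed[OF induced_gens_closed]) (simp add: induced_def)
  then have "carrier (induced N) \<subseteq> {\<zero>\<^bsub>weyl_maps N\<^esub>}" by blast
  then have "inj_on h (carrier (induced N))" for h :: "_ \<Rightarrow> 'v"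
    by (rule inj_on_subset[rotated]) simp
  then show ?thesis by blast
next
  case False
  then obtain n where n: "n \<in> carrier N" "n \<noteq> \<zero>" using N.M.zero_closed by blast
  have "inj (\<lambda>c. scal c \<odot> n)"
  proof (rule injI)
    fix c d assume eq: "scal c \<odot> n = scal d \<odot> n"
    have "scal (c + - d) \<odot> n = \<zero>"
      unfolding N.scal_add_act[OF n(1)] N.scal_minus_act[OF n(1)] eq using n(1) by (simp add: N.M.r_neg)
    then have "c + - d = 0" using N.scal_act_zeroD[OF n(1)] n(2) by blast
    then show "c = d" by simp
  qed
  moreover have "range (\<lambda>c. scal c \<odot> n) \<subseteq> carrier N" using n by auto
  ultimately have C: "|UNIV :: complex set| \<le>o |carrier N|" using card_of_ordLeq by blast
  then have inf: "infinite (carrier N)"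
    using card_of_ordLeq_infinite infinite_UNIV_char_0 by blast
  then have KF: "infinite (Field |carrier N| )" by (simp add: Field_card_of)
  have "|weyl :: 'i oper set| \<le>o |carrier N|" using card_of_weyl C ordLeq_transitive by blast
  then have "|(weyl :: 'i oper set) \<times> carrier N| \<le>o |carrier N|"
    by (intro card_of_Times_ordLeq_infinite_Field[OF KF] card_of_mono1 card_of_Card_order order_refl)
  then have G: "|induced_gens N| \<le>o |carrier N|"
    unfolding induced_gens_def using card_of_image ordLeq_transitive by blast
  have "|{\<zero>\<^bsub>weyl_maps N\<^esub>}| \<le>o |carrier N|"
    using inf by (intro finite_ordLeq_infinite) auto
  with G have G': "|induced_gens N \<union> {\<zero>\<^bsub>weyl_maps N\<^esub>}| \<le>o |carrier N|"
    by (intro card_of_Un_ordLeq_infinite_Field[OF KF]) (auto simp: card_of_Card_order)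
  \<comment> \<open>Both Boolean values stand for addition, and zero is added to the generators as
    the empty sum.\<close>
  let ?B = "binary_closure (\<lambda>_. add (weyl_maps N)) (induced_gens N \<union> {\<zero>\<^bsub>weyl_maps N\<^esub>})"
  have "x \<in> ?B" if "x \<in> addspan (weyl_maps N) (induced_gens N)" for x
    using that
  proof induction
    case (add x y)
    then show ?case by (intro binary_closure.step[where f = "\<lambda>_. add (weyl_maps N)"])
  qed (auto intro: binary_closure.base)
  then have "carrier (induced N) \<subseteq> ?B" by (auto simp: induced_def)
  then have "|carrier (induced N)| \<le>o |carrier N|"
    by (rule ordLeq_transitive[OF card_of_mono1 card_of_binary_closure[OF inf G']])
  then show ?thesis unfolding card_of_ordLeq[symmetric] by (elim exE conjE) (rule exI)
qed

text \<open>The realization in the universe is described only by a linear embedding of N whose image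
  generates M; the identification of the degree a part rests on these two properties.\<close>

lemma ex_induced:
  "\<exists>(M :: ('i oper, 'v) module) \<phi>. opmod weyl M \<and> \<phi> \<in> lmod_hom (oper_ring weylE) N M \<and>
    inj_on \<phi> (carrier N) \<and> carrier M \<subseteq> addspan M ((\<lambda>(d, n). d \<odot>\<^bsub>M\<^esub> \<phi> n) ` (weyl \<times> carrier N))"
proof -
  obtain h :: "('i oper \<Rightarrow> 'v) \<Rightarrow> 'v" where h: "inj_on h (carrier (induced N))"
    using induced_embeds by (elim exE)
  interpret I: left_module "oper_ring weyl" "induced N" by (rule left_module_induced)
  obtain M :: "('i oper, 'v) module" where M: "left_module (oper_ring weyl) M"
    "carrier M = h ` carrier (induced N)" "\<zero>\<^bsub>M\<^esub> = h \<zero>\<^bsub>induced N\<^esub>"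
    "\<And>x y. x \<in> carrier (induced N) \<Longrightarrow> y \<in> carrier (induced N) \<Longrightarrow> h x \<oplus>\<^bsub>M\<^esub> h y = h (x \<oplus>\<^bsub>induced N\<^esub> y)"
    "\<And>d x. x \<in> carrier (induced N) \<Longrightarrow> d \<odot>\<^bsub>M\<^esub> h x = h (d \<odot>\<^bsub>induced N\<^esub> x)"
    using left_module_transport[OF left_module_induced h] by (elim exE conjE) (simp only: Ball_def)
  have u: "unit_map N n \<in> carrier (induced N)" if "n \<in> carrier N" for n
  proof -
    have "unit_map N n = id \<odot>\<^bsub>weyl_maps N\<^esub> unit_map N n"
      using W.smult_one[OF unit_map_closed[OF that]] by simp
    also have "\<dots> \<in> induced_gens N"
      unfolding induced_gens_def using that N.A_basic(4)
      by (intro rev_image_eqI[of "(id, n)"]) (simp_all add: weylE_iff)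
    finally show ?thesis by (simp add: induced_def addspan.incl)
  qed
  have ind: "add (induced N) = add (weyl_maps N)" "smult (induced N) = smult (weyl_maps N)"
    by (simp_all add: induced_def)
  let ?\<phi> = "\<lambda>n\<in>carrier N. h (unit_map N n)"
  have "?\<phi> \<in> lmod_hom (oper_ring weylE) N M"
  proof (rule lmod_homI)
    show "?\<phi> (x \<oplus> y) = ?\<phi> x \<oplus>\<^bsub>M\<^esub> ?\<phi> y" if "x \<in> carrier N" "y \<in> carrier N" for x y
      using that by (simp add: M(4) u ind unit_map_add)
    show "?\<phi> (d \<odot> x) = d \<odot>\<^bsub>M\<^esub> ?\<phi> x" if "d \<in> carrier (oper_ring weylE)" "x \<in> carrier N" for d x
      using that by (simp add: M(5) u ind unit_map_weylE)
  qed (auto simp: M(2) u)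
  moreover have "inj_on ?\<phi> (carrier N)"
  proof (rule inj_onI)
    fix x y assume "x \<in> carrier N" "y \<in> carrier N" "?\<phi> x = ?\<phi> y"
    then show "x = y" using inj_onD[OF h, of "unit_map N x" "unit_map N y"] u inj_onD[OF unit_map_inj] by simp
  qed
  moreover have "carrier M \<subseteq> addspan M ((\<lambda>(d, n). d \<odot>\<^bsub>M\<^esub> ?\<phi> n) ` (weyl \<times> carrier N))" (is "_ \<subseteq> addspan M ?S")
  proof
    have G: "induced_gens N \<subseteq> carrier (induced N)" by (auto simp: induced_def intro: addspan.incl)
    have "x \<in> carrier (induced N) \<and> h x \<in> addspan M ?S" if "x \<in> addspan (induced N) (induced_gens N)" for x
      using that
    proof induction
      case zero
      then show ?case using addspan.zero[of M ?S] by (simp add: M(3))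
    next
      case (incl x)
      then obtain d n where x: "d \<in> weyl" "n \<in> carrier N" "x = d \<odot>\<^bsub>weyl_maps N\<^esub> unit_map N n"
        by (auto simp: induced_gens_def)
      then have "h x = d \<odot>\<^bsub>M\<^esub> ?\<phi> n" by (simp add: M(5) u ind)
      then have "h x \<in> ?S" using x(1,2) by (intro rev_image_eqI[of "(d, n)"]) simp_all
      then show ?case using incl G addspan.incl[of "h x" ?S M] by blast
    next
      case (add x y)
      then show ?case using addspan.add[of "h x" M ?S "h y"] by (simp add: M(4))
    qed
    moreover fix y assume "y \<in> carrier M"
    ultimately show "y \<in> addspan M ?S" by (auto simp: M(2) induced_def)
  qed
  moreover have "opmod weyl M"
    using M(1) by (intro opmod.intro opmod_axioms.intro) (auto simp: weylE_iff)
  ultimately show ?thesis by blast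
qed

end

section \<open>Essential surjectivity\<close>

text \<open>The degree a part of d (\<phi> n) is \<open>proj0 d\<close> applied to \<phi> n, that
  is, the image under \<phi> of \<open>proj0 d\<close> applied to n. Since such elements generate M,
  its degree a part is no larger than the image of N.\<close>

lemma Epart_essentially_surjective:
  fixes N :: "('i :: finite oper, 'v) module"
  assumes N_Ob: "N \<in> Ob (sDEH_mod a \<nu>)"
  shows "\<exists>M \<in> Ob (sDH_mod \<nu>). \<exists>f. is_iso (sDEH_mod a \<nu>) (Epart a M) N f"
proof -
  have N: "opmod weylE N" "carrier N \<subseteq> addspan N (\<Union>\<mu>\<in>coset \<nu>. swt N \<mu>)" "carrier N \<subseteq> kset N euler {a}"
    using N_Ob by (simp_all add: sDEH_mod_Ob)
  interpret N: opmod weylE N by (rule N(1))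
  obtain M :: "('i oper, 'v) module" and \<phi> where M: "opmod weyl M"
    and \<phi>: "\<phi> \<in> lmod_hom (oper_ring weylE) N M" and inj: "inj_on \<phi> (carrier N)"
    and gen: "carrier M \<subseteq> addspan M ((\<lambda>(d, n). d \<odot>\<^bsub>M\<^esub> \<phi> n) ` (weyl \<times> carrier N))"
    using ex_induced[OF N(1)] by (elim exE conjE)
  interpret M: dmod M by (intro dmod.intro M)
  note h = lmod_homD[OF \<phi>]
  note \<phi>_kset = opmod_hom_kset[OF N(1) M.opmod_weylE \<phi>]
  have \<phi>_zero: "\<phi> \<zero>\<^bsub>N\<^esub> = \<zero>\<^bsub>M\<^esub>" by (rule opmod_hom_zero[OF N(1) M.opmod_weylE \<phi>])
  let ?V = "addspan M (\<Union>\<mu>\<in>coset \<nu>. swt M \<mu>)"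
  have \<phi>_swt: "\<phi> n \<in> swt M \<mu>" if n: "n \<in> swt N \<mu>" for n \<mu>
  proof -
    have nc: "n \<in> carrier N" using n by (rule N.swt_carrier)
    have "\<phi> n \<in> gen_weight_space M \<mu>"
      using N.swt_gws[OF n] \<phi>_kset[OF theta_in_weylE] h(1) by (simp add: N.gws_iff M.gws_iff)
    moreover have "dtheta i j \<odot>\<^bsub>M\<^esub> \<phi> n = scal (\<mu> i - \<mu> j) \<odot>\<^bsub>M\<^esub> \<phi> n" for i j
      using n h(3)[of "dtheta i j" n] h(3)[of "scal (\<mu> i - \<mu> j)" n] nc
      by (simp add: swt_def dtheta_in_weylE scal_in_weylE)
    ultimately show ?thesis by (simp add: swt_def)
  qed
  have \<phi>_V: "\<phi> n \<in> ?V" if "n \<in> carrier N" for n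
  proof -
    have "n \<in> addspan N (\<Union>\<mu>\<in>coset \<nu>. swt N \<mu>)" using N(2) that by blast
    then have "n \<in> carrier N \<and> \<phi> n \<in> ?V"
    proof induction
      case (incl n)
      then obtain \<mu> where "\<mu> \<in> coset \<nu>" "n \<in> swt N \<mu>" by blast
      then show ?case using \<phi>_swt N.swt_carrier by (blast intro: addspan.incl)
    qed (auto simp: \<phi>_zero h(2) intro: addspan.zero addspan.add)
    then show ?thesis ..
  qed
  \<comment> \<open>\<open>?V\<close> is stable under \<open>weyl\<close> and contains the image of
    \<phi>, hence all generators of M.\<close>
  have "carrier M \<subseteq> ?V"
    using gen addspan_mono[of "(\<lambda>(d, n). d \<odot>\<^bsub>M\<^esub> \<phi> n) ` (weyl \<times> carrier N)" M]
      M.addspan_swt_weyl[OF _ \<phi>_V] by fastforce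
  then have M_Ob: "M \<in> Ob (sDH_mod \<nu>)" using M by (simp add: sDH_mod_Ob)
  have \<phi>_E: "\<phi> n \<in> kset M euler {a}" if "n \<in> carrier N" for n
    using \<phi>_kset[OF euler_in_weylE] N(3) that by blast
  have split: "\<exists>n\<in>carrier N. \<exists>r\<in>kset M euler (- {a}). m = \<phi> n \<oplus>\<^bsub>M\<^esub> r" if "m \<in> carrier M" for m
  proof -
    have "m \<in> addspan M ((\<lambda>(d, n). d \<odot>\<^bsub>M\<^esub> \<phi> n) ` (weyl \<times> carrier N))" using gen that by blast
    then show ?thesis
    proof induction
      case zero
      show ?case by (intro bexI[of _ "\<zero>\<^bsub>N\<^esub>"] bexI[of _ "\<zero>\<^bsub>M\<^esub>"]) (simp_all add: \<phi>_zero M.kset_zero)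
    next
      case (incl m)
      then obtain d n where d: "d \<in> weyl" "n \<in> carrier N" "m = d \<odot>\<^bsub>M\<^esub> \<phi> n" by auto
      obtain r where "r \<in> kset M euler (- {a})" "m = proj0 d \<odot>\<^bsub>M\<^esub> \<phi> n \<oplus>\<^bsub>M\<^esub> r"
        using M.weyl_act_split[OF d(1) \<phi>_E[OF d(2)]] d(3) by blast
      moreover have "proj0 d \<odot>\<^bsub>M\<^esub> \<phi> n = \<phi> (proj0 d \<odot>\<^bsub>N\<^esub> n)" "proj0 d \<odot>\<^bsub>N\<^esub> n \<in> carrier N"
        using proj0_in_weylE[OF d(1)] d(2) h(3) by simp_all
      ultimately show ?case by metis
    next
      case (add x y)
      then obtain n r n' r' where n: "n \<in> carrier N" "r \<in> kset M euler (- {a})" "x = \<phi> n \<oplus>\<^bsub>M\<^esub> r"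
        and n': "n' \<in> carrier N" "r' \<in> kset M euler (- {a})" "y = \<phi> n' \<oplus>\<^bsub>M\<^esub> r'" by blast
      have "r \<in> carrier M" "r' \<in> carrier M" using n(2) n'(2) by (auto dest: kset_carrier)
      then have "x \<oplus>\<^bsub>M\<^esub> y = \<phi> (n \<oplus>\<^bsub>N\<^esub> n') \<oplus>\<^bsub>M\<^esub> (r \<oplus>\<^bsub>M\<^esub> r')"
        using n n' h(1) by (simp add: h(2) M.M.a_ac)
      then show ?case using n n'
        by (intro bexI[of _ "n \<oplus>\<^bsub>N\<^esub> n'"] bexI[of _ "r \<oplus>\<^bsub>M\<^esub> r'"]) (simp_all add: M.kset_add)
    qed
  qed
  have image: "\<phi> ` carrier N = kset M euler {a}"
  proof
    show "\<phi> ` carrier N \<subseteq> kset M euler {a}" using \<phi>_E by blast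
    show "kset M euler {a} \<subseteq> \<phi> ` carrier N"
    proof
      fix m assume m: "m \<in> kset M euler {a}"
      then obtain n r where n: "n \<in> carrier N" "r \<in> kset M euler (- {a})" "m = \<phi> n \<oplus>\<^bsub>M\<^esub> r"
        using split[OF kset_carrier[OF m]] by (elim bexE)
      have "m = \<phi> n"
        using M.E_split_unique[OF m M.kset_zero \<phi>_E[OF n(1)] n(2)] n(3) kset_carrier[OF m] by simp
      then show "m \<in> \<phi> ` carrier N" using n(1) by blast
    qed
  qed
  \<comment> \<open>The isomorphism is the inverse of \<phi>, made \<open>undefined\<close> outside
    degree a because morphisms are extensional.\<close>
  define f where "f = (\<lambda>m\<in>kset M euler {a}. the_inv_into (carrier N) \<phi> m)"
  have f\<phi>: "f (\<phi> n) = n" if "n \<in> carrier N" for n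
    using that inj \<phi>_E by (simp add: f_def the_inv_into_f_f)
  have f_ex: "\<exists>n\<in>carrier N. m = \<phi> n \<and> f m = n" if "m \<in> kset M euler {a}" for m
  proof -
    obtain n where "n \<in> carrier N" "m = \<phi> n" using \<open>m \<in> kset M euler {a}\<close> unfolding image[symmetric] by (rule imageE)
    then show ?thesis using f\<phi> by simp
  qed
  have "f \<in> lmod_hom (oper_ring weylE) (Epart a M) N"
  proof (rule lmod_homI)
    show "f m \<in> carrier N" if "m \<in> carrier (Epart a M)" for m using f_ex that by auto
    show "f (m \<oplus>\<^bsub>Epart a M\<^esub> m') = f m \<oplus>\<^bsub>N\<^esub> f m'"
      if m: "m \<in> carrier (Epart a M)" "m' \<in> carrier (Epart a M)" for m m'
    proof -
      obtain n n' where n: "n \<in> carrier N" "n' \<in> carrier N" "m = \<phi> n" "m' = \<phi> n'"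
        using f_ex m by (metis Epart_simps(1))
      then show ?thesis using f\<phi>[of "n \<oplus>\<^bsub>N\<^esub> n'"] by (simp add: h(2) f\<phi>)
    qed
    show "f (d \<odot>\<^bsub>Epart a M\<^esub> m) = d \<odot>\<^bsub>N\<^esub> f m"
      if d: "d \<in> carrier (oper_ring weylE)" and m: "m \<in> carrier (Epart a M)" for d m
    proof -
      obtain n where n: "n \<in> carrier N" "m = \<phi> n" using f_ex m by (metis Epart_simps(1))
      have "f (d \<odot>\<^bsub>M\<^esub> \<phi> n) = f (\<phi> (d \<odot>\<^bsub>N\<^esub> n))" using d n(1) by (simp only: h(3))
      then show ?thesis using f\<phi>[of "d \<odot>\<^bsub>N\<^esub> n"] d n by (simp add: f\<phi>)
    qed
  qed (simp add: f_def)
  moreover have "\<phi> \<in> lmod_hom (oper_ring weylE) N (Epart a M)"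
    by (rule lmod_homI) (use h \<phi>_E in simp_all)
  moreover have "compose (kset M euler {a}) \<phi> f = (\<lambda>x\<in>kset M euler {a}. x)"
    using f_ex by (fastforce simp: compose_def fun_eq_iff)
  moreover have "compose (carrier N) f \<phi> = (\<lambda>x\<in>carrier N. x)"
    by (auto simp: compose_def fun_eq_iff f\<phi>)
  ultimately have "is_iso (sDEH_mod a \<nu>) (Epart a M) N f"
    unfolding is_iso_def sDEH_mod_simps by auto
  then show ?thesis using M_Ob by blast
qed

theorem proposition6p9:
  fixes n :: nat and a :: complex and \<nu> :: "'i :: finite \<Rightarrow> complex"
  assumes "n \<ge> 1" and "CARD('i) = n + 1"
    and "\<not> (\<forall>i. \<nu> i \<in> \<int>)"
    and "a - (\<Sum>i\<in>UNIV. \<nu> i) \<in> \<int>"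
  shows "equivalent_categories
    (sDH_mod \<nu> :: (('i oper, 'v) module, 'v \<Rightarrow> 'v) cat)
    (sDEH_mod a \<nu> :: (('i oper, 'v) module, 'v \<Rightarrow> 'v) cat)"
proof (rule equivalent_categories_if_fully_faithful[OF cat_functor_Epart])
  obtain i0 where i0: "\<nu> i0 \<notin> \<int>" using assms(3) by blast
  fix X Y :: "('i oper, 'v) module"
  assume XY: "X \<in> Ob (sDH_mod \<nu>)" "Y \<in> Ob (sDH_mod \<nu>)"
  have dobj: "dobj Z a \<nu> i0" if "Z \<in> Ob (sDH_mod \<nu>)" for Z :: "('i oper, 'v) module"
    using that i0 assms(4) by (intro dobj.intro dobj_axioms.intro dmod.intro) (simp_all add: sDH_mod_Ob)
  show "bij_betw (\<lambda>f. restrict f (kset X euler {a})) (Hom (sDH_mod \<nu>) X Y)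
      (Hom (sDEH_mod a \<nu>) (Epart a X) (Epart a Y))"
    unfolding bij_betw_def sDH_mod_simps sDEH_mod_simps
  proof
    show "inj_on (\<lambda>f. restrict f (kset X euler {a})) (lmod_hom (oper_ring weyl) X Y)"
    proof (rule inj_onI)
      fix f g assume f: "f \<in> lmod_hom (oper_ring weyl) X Y" and g: "g \<in> lmod_hom (oper_ring weyl) X Y"
        and eq: "restrict f (kset X euler {a}) = restrict g (kset X euler {a})"
      have "f n = g n" if "n \<in> kset X euler {a}" for n using fun_cong[OF eq, of n] that by simp
      then show "f = g" by (rule Epart_faithful[OF dobj[OF XY(1)] dobj[OF XY(2)] f g])
    qed
    show "(\<lambda>f. restrict f (kset X euler {a})) ` lmod_hom (oper_ring weyl) X Y =
        lmod_hom (oper_ring weylE) (Epart a X) (Epart a Y)"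
      using Epart_full[OF dobj[OF XY(1)] dobj[OF XY(2)]] Epart_hom[of X Y _ a] XY
      by (auto simp: sDH_mod_Ob)
  qed
qed (rule Epart_essentially_surjective)

end
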